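(* Let $\mathcal{A}$ be an abelian category, and let $M=\bigoplus_{i\in I}M_i$ be a direct sum decomposition in $\mathcal{A}$ for some finite set $I$. Then: (1) Assume that $\mathcal{A}$ is AB3*. (i) If $\mathrm{Hom}_{\mathcal{A}}(M_i,M_j)=0$ for every $i,j\in I$ with $i\neq j$, then $M$ is self-CS-Baer if and only if $M_i$ is self-CS-Baer for each $i\in I$. (ii) $M$ is strongly self-CS-Baer if and only if $M_i$ is strongly self-CS-Baer for each $i\in I$ and $\mathrm{Hom}_{\mathcal{A}}(M_i,M_j)=0$ for every $i,j\in I$ with $i\neq j$. (2) Assume that $\mathcal{A}$ is AB3. (i) If $\mathrm{Hom}_{\mathcal{A}}(M_i,M_j)=0$ for every $i,j\in I$ with $i\neq j$, then $M$ is dual self-CS-Baer if and only if $M_i$ is dual self-CS-Baer for each $i\in I$. (ii) $M$ is dual strongly self-CS-Baer if and only if $M_i$ is dual strongly self-CS-Baer for each $i\in I$ and $\mathrm{Hom}_{\mathcal{A}}(M_i,M_j)=0$ for every $i,j\in I$ with $i\neq j$.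
   Context: An abelian category is AB3 (AB3* ) if it has arbitrary coproducts (products); it then has arbitrary sums (intersections) of families of subobjects. A subobject $i:K\to M$ is fully invariant if for every $h:M\to M$ one has $hi=i\alpha$ for some $\alpha:K\to K$. A subobject $L$ of $M$ lies above a direct summand $K$ of $M$ if $K\subseteq L$ and $L/K$ is superfluous in $M/K$ (a subobject $A$ of $B$ is superfluous if $A+X=B$ implies $X=B$ for every subobject $X$ of $B$). In an AB3* abelian category, $M$ is self-CS-Baer (strongly self-CS-Baer) if for every family $(f_\lambda)_{\lambda\in\Lambda}$ of endomorphisms of $M$, $\bigcap_{\lambda}\mathrm{Ker}(f_\lambda)$ is essential in a direct summand (fully invariant direct summand) of $M$. In an AB3 abelian category, $M$ is dual self-CS-Baer (dual strongly self-CS-Baer) if for every such family $\sum_{\lambda}\mathrm{Im}(f_\lambda)$ lies above a direct summand (fully invariant direct summand) of $M$. *)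

theory Defs
  imports "HOL-Algebra.Group" "HOL-Library.Equipollence"
begin

section \<open>Categories\<close>

record ('o, 'm) cat =
  Obj :: "'o set"
  Arr :: "'m set"
  Dom :: "'m \<Rightarrow> 'o"
  Cod :: "'m \<Rightarrow> 'o"
  Ident :: "'o \<Rightarrow> 'm"
  Comp :: "'m \<Rightarrow> 'm \<Rightarrow> 'm"  (infixl \<open>\<cdot>\<index>\<close> 70)

definition hom_set :: "('o, 'm, 'z) cat_scheme \<Rightarrow> 'o \<Rightarrow> 'o \<Rightarrow> 'm set" where
  "hom_set C A B = {f \<in> Arr C. Dom C f = A \<and> Cod C f = B}"

locale category =
  fixes C (structure)
  assumes Dom_in_Obj: "f \<in> Arr C \<Longrightarrow> Dom C f \<in> Obj C"
    and Cod_in_Obj: "f \<in> Arr C \<Longrightarrow> Cod C f \<in> Obj C"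
    and Ident_in_hom: "A \<in> Obj C \<Longrightarrow> Ident C A \<in> hom_set C A A"
    and Comp_in_hom: "f \<in> hom_set C A B \<Longrightarrow> g \<in> hom_set C B D \<Longrightarrow> g \<cdot> f \<in> hom_set C A D"
    and Comp_Ident: "f \<in> hom_set C A B \<Longrightarrow> f \<cdot> Ident C A = f"
    and Ident_Comp: "f \<in> hom_set C A B \<Longrightarrow> Ident C B \<cdot> f = f"
    and Comp_assoc: "f \<in> hom_set C A B \<Longrightarrow> g \<in> hom_set C B D \<Longrightarrow> h \<in> hom_set C D E
                     \<Longrightarrow> (h \<cdot> g) \<cdot> f = h \<cdot> (g \<cdot> f)"

definition monic :: "('o, 'm, 'z) cat_scheme \<Rightarrow> 'm \<Rightarrow> bool" where
  "monic C f \<longleftrightarrow> f \<in> Arr C \<and>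
     (\<forall>A. \<forall>g \<in> hom_set C A (Dom C f). \<forall>h \<in> hom_set C A (Dom C f).
        f \<cdot>\<^bsub>C\<^esub> g = f \<cdot>\<^bsub>C\<^esub> h \<longrightarrow> g = h)"

definition epic :: "('o, 'm, 'z) cat_scheme \<Rightarrow> 'm \<Rightarrow> bool" where
  "epic C f \<longleftrightarrow> f \<in> Arr C \<and>
     (\<forall>B. \<forall>g \<in> hom_set C (Cod C f) B. \<forall>h \<in> hom_set C (Cod C f) B.
        g \<cdot>\<^bsub>C\<^esub> f = h \<cdot>\<^bsub>C\<^esub> f \<longrightarrow> g = h)"

definition zero_object :: "('o, 'm, 'z) cat_scheme \<Rightarrow> 'o \<Rightarrow> bool" where
  "zero_object C Z \<longleftrightarrow> Z \<in> Obj C \<and>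
     (\<forall>A \<in> Obj C. (\<exists>!f. f \<in> hom_set C A Z) \<and> (\<exists>!f. f \<in> hom_set C Z A))"

definition is_product ::
  "('o, 'm, 'z) cat_scheme \<Rightarrow> 'i set \<Rightarrow> ('i \<Rightarrow> 'o) \<Rightarrow> 'o \<Rightarrow> ('i \<Rightarrow> 'm) \<Rightarrow> bool" where
  "is_product C I X P \<pi> \<longleftrightarrow> P \<in> Obj C \<and> (\<forall>i\<in>I. \<pi> i \<in> hom_set C P (X i)) \<and>
     (\<forall>A \<in> Obj C. \<forall>f. (\<forall>i\<in>I. f i \<in> hom_set C A (X i)) \<longrightarrow>
        (\<exists>!h. h \<in> hom_set C A P \<and> (\<forall>i\<in>I. \<pi> i \<cdot>\<^bsub>C\<^esub> h = f i)))"

definition is_coproduct ::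
  "('o, 'm, 'z) cat_scheme \<Rightarrow> 'i set \<Rightarrow> ('i \<Rightarrow> 'o) \<Rightarrow> 'o \<Rightarrow> ('i \<Rightarrow> 'm) \<Rightarrow> bool" where
  "is_coproduct C I X S \<iota> \<longleftrightarrow> S \<in> Obj C \<and> (\<forall>i\<in>I. \<iota> i \<in> hom_set C (X i) S) \<and>
     (\<forall>A \<in> Obj C. \<forall>f. (\<forall>i\<in>I. f i \<in> hom_set C (X i) A) \<longrightarrow>
        (\<exists>!h. h \<in> hom_set C S A \<and> (\<forall>i\<in>I. h \<cdot>\<^bsub>C\<^esub> \<iota> i = f i)))"


section \<open>Abelian categories\<close>

record ('o, 'm) ab_cat = "('o, 'm) cat" +
  Plus :: "'m \<Rightarrow> 'm \<Rightarrow> 'm"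
  Zero :: "'o \<Rightarrow> 'o \<Rightarrow> 'm"

definition hom_group :: "('o, 'm, 'z) ab_cat_scheme \<Rightarrow> 'o \<Rightarrow> 'o \<Rightarrow> 'm monoid" where
  "hom_group C A B = \<lparr>carrier = hom_set C A B, mult = Plus C, one = Zero C A B\<rparr>"

locale preadditive_category = category C for C :: "('o, 'm, 'z) ab_cat_scheme" (structure) +
  assumes hom_comm_group: "A \<in> Obj C \<Longrightarrow> B \<in> Obj C \<Longrightarrow> comm_group (hom_group C A B)"
    and Comp_Plus: "f \<in> hom_set C A B \<Longrightarrow> g \<in> hom_set C B D \<Longrightarrow> h \<in> hom_set C B D
                    \<Longrightarrow> Plus C g h \<cdot> f = Plus C (g \<cdot> f) (h \<cdot> f)"
    and Plus_Comp: "f \<in> hom_set C A B \<Longrightarrow> g \<in> hom_set C A B \<Longrightarrow> h \<in> hom_set C B D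
                    \<Longrightarrow> h \<cdot> Plus C f g = Plus C (h \<cdot> f) (h \<cdot> g)"

definition is_biproduct ::
  "('o, 'm, 'z) ab_cat_scheme \<Rightarrow> 'o \<Rightarrow> 'o \<Rightarrow> 'o \<Rightarrow> 'm \<Rightarrow> 'm \<Rightarrow> 'm \<Rightarrow> 'm \<Rightarrow> bool" where
  "is_biproduct C A B S i j p q \<longleftrightarrow> S \<in> Obj C \<and>
     i \<in> hom_set C A S \<and> j \<in> hom_set C B S \<and> p \<in> hom_set C S A \<and> q \<in> hom_set C S B \<and>
     p \<cdot>\<^bsub>C\<^esub> i = Ident C A \<and> q \<cdot>\<^bsub>C\<^esub> j = Ident C B \<and>
     Plus C (i \<cdot>\<^bsub>C\<^esub> p) (j \<cdot>\<^bsub>C\<^esub> q) = Ident C S"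

definition is_kernel :: "('o, 'm, 'z) ab_cat_scheme \<Rightarrow> 'm \<Rightarrow> 'm \<Rightarrow> bool" where
  "is_kernel C f k \<longleftrightarrow> f \<in> Arr C \<and> k \<in> Arr C \<and> Cod C k = Dom C f \<and>
     f \<cdot>\<^bsub>C\<^esub> k = Zero C (Dom C k) (Cod C f) \<and>
     (\<forall>A \<in> Obj C. \<forall>g \<in> hom_set C A (Dom C f). f \<cdot>\<^bsub>C\<^esub> g = Zero C A (Cod C f) \<longrightarrow>
        (\<exists>!h. h \<in> hom_set C A (Dom C k) \<and> k \<cdot>\<^bsub>C\<^esub> h = g))"

definition is_cokernel :: "('o, 'm, 'z) ab_cat_scheme \<Rightarrow> 'm \<Rightarrow> 'm \<Rightarrow> bool" where
  "is_cokernel C f q \<longleftrightarrow> f \<in> Arr C \<and> q \<in> Arr C \<and> Dom C q = Cod C f \<and>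
     q \<cdot>\<^bsub>C\<^esub> f = Zero C (Dom C f) (Cod C q) \<and>
     (\<forall>B \<in> Obj C. \<forall>g \<in> hom_set C (Cod C f) B. g \<cdot>\<^bsub>C\<^esub> f = Zero C (Dom C f) B \<longrightarrow>
        (\<exists>!h. h \<in> hom_set C (Cod C q) B \<and> h \<cdot>\<^bsub>C\<^esub> q = g))"

locale abelian_category = preadditive_category C for C :: "('o, 'm, 'z) ab_cat_scheme" (structure) +
  assumes has_zero_object: "\<exists>Z. zero_object C Z"
    and has_biproducts: "A \<in> Obj C \<Longrightarrow> B \<in> Obj C \<Longrightarrow> \<exists>S i j p q. is_biproduct C A B S i j p q"
    and has_kernels: "f \<in> Arr C \<Longrightarrow> \<exists>k. is_kernel C f k"
    and has_cokernels: "f \<in> Arr C \<Longrightarrow> \<exists>q. is_cokernel C f q"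
    and monic_is_kernel: "monic C k \<Longrightarrow> \<exists>f. is_kernel C f k"
    and epic_is_cokernel: "epic C q \<Longrightarrow> \<exists>f. is_cokernel C f q"

text \<open>Kernels and images are determined up to isomorphism as subobjects; we pick representatives.\<close>

definition Ker :: "('o, 'm, 'z) ab_cat_scheme \<Rightarrow> 'm \<Rightarrow> 'm" where
  "Ker C f = (SOME k. is_kernel C f k)"

definition Coker :: "('o, 'm, 'z) ab_cat_scheme \<Rightarrow> 'm \<Rightarrow> 'm" where
  "Coker C f = (SOME q. is_cokernel C f q)"

definition Img :: "('o, 'm, 'z) ab_cat_scheme \<Rightarrow> 'm \<Rightarrow> 'm" where
  "Img C f = Ker C (Coker C f)"


section \<open>AB3 and AB3*\<close>

text \<open>
  "Arbitrary" products and coproducts are those indexed by small sets. Smallness has to be a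
  parameter: a category whose collection of arrows embeds into one of the admissible index sets
  and which has all products is a preorder (Freyd), so in an abelian one all objects would be zero.
  The parameter is a collection U of subsets of a type of indices, which contains the finite sets
  and is closed under passing to sets of smaller or equal cardinality. Examples are all sets of
  cardinality below a fixed infinite cardinal (a Grothendieck universe, in the intended reading), or all
  subsets of the index type. No closure under powersets or unions is needed.
  The families of endomorphisms in the Baer conditions below are indexed by sets from the same U;
  if the hom-sets are small, these give all sets of endomorphisms.
\<close>

definition index_universe :: "'l set set \<Rightarrow> bool" where
  "index_universe U \<longleftrightarrow> (\<forall>\<Lambda>. finite \<Lambda> \<longrightarrow> \<Lambda> \<in> U) \<and> (\<forall>\<Lambda>\<in>U. \<forall>\<Lambda>'. \<Lambda>' \<lesssim> \<Lambda> \<longrightarrow> \<Lambda>' \<in> U)"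

definition AB3 :: "'l set set \<Rightarrow> ('o, 'm, 'z) ab_cat_scheme \<Rightarrow> bool" where
  "AB3 U C \<longleftrightarrow> abelian_category C \<and>
     (\<forall>\<Lambda>\<in>U. \<forall>X. (\<forall>l\<in>\<Lambda>. X l \<in> Obj C) \<longrightarrow> (\<exists>S \<iota>. is_coproduct C \<Lambda> X S \<iota>))"

definition AB3_star :: "'l set set \<Rightarrow> ('o, 'm, 'z) ab_cat_scheme \<Rightarrow> bool" where
  "AB3_star U C \<longleftrightarrow> abelian_category C \<and>
     (\<forall>\<Lambda>\<in>U. \<forall>X. (\<forall>l\<in>\<Lambda>. X l \<in> Obj C) \<longrightarrow> (\<exists>P \<pi>. is_product C \<Lambda> X P \<pi>))"


section \<open>Subobjects\<close>

text \<open>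
  A subobject of M is represented by a monomorphism into M. Representatives are preordered by
  factorisation, and two of them denote the same subobject iff each factors through the other.
\<close>

definition subobject :: "('o, 'm, 'z) cat_scheme \<Rightarrow> 'o \<Rightarrow> 'm \<Rightarrow> bool" where
  "subobject C M k \<longleftrightarrow> monic C k \<and> Cod C k = M"

definition sub_le :: "('o, 'm, 'z) cat_scheme \<Rightarrow> 'm \<Rightarrow> 'm \<Rightarrow> bool" where
  "sub_le C k l \<longleftrightarrow> (\<exists>u \<in> hom_set C (Dom C k) (Dom C l). k = l \<cdot>\<^bsub>C\<^esub> u)"

definition sub_eq :: "('o, 'm, 'z) cat_scheme \<Rightarrow> 'm \<Rightarrow> 'm \<Rightarrow> bool" where
  "sub_eq C k l \<longleftrightarrow> sub_le C k l \<and> sub_le C l k"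

definition zero_subobject :: "('o, 'm, 'z) cat_scheme \<Rightarrow> 'o \<Rightarrow> 'm \<Rightarrow> bool" where
  "zero_subobject C M k \<longleftrightarrow> subobject C M k \<and> zero_object C (Dom C k)"

text \<open>The intersection of a set K of subobjects of M is its infimum, the sum its supremum.\<close>

definition is_intersection :: "('o, 'm, 'z) cat_scheme \<Rightarrow> 'o \<Rightarrow> 'm set \<Rightarrow> 'm \<Rightarrow> bool" where
  "is_intersection C M K n \<longleftrightarrow> subobject C M n \<and> (\<forall>k\<in>K. sub_le C n k) \<and>
     (\<forall>x. subobject C M x \<and> (\<forall>k\<in>K. sub_le C x k) \<longrightarrow> sub_le C x n)"

definition is_sum :: "('o, 'm, 'z) cat_scheme \<Rightarrow> 'o \<Rightarrow> 'm set \<Rightarrow> 'm \<Rightarrow> bool" where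
  "is_sum C M K s \<longleftrightarrow> subobject C M s \<and> (\<forall>k\<in>K. sub_le C k s) \<and>
     (\<forall>x. subobject C M x \<and> (\<forall>k\<in>K. sub_le C k x) \<longrightarrow> sub_le C s x)"

definition essential :: "('o, 'm, 'z) cat_scheme \<Rightarrow> 'o \<Rightarrow> 'm \<Rightarrow> bool" where
  "essential C B a \<longleftrightarrow> subobject C B a \<and>
     (\<forall>x. subobject C B x \<and> (\<exists>z. zero_subobject C B z \<and> is_intersection C B {a, x} z)
        \<longrightarrow> zero_subobject C B x)"

definition superfluous :: "('o, 'm, 'z) cat_scheme \<Rightarrow> 'o \<Rightarrow> 'm \<Rightarrow> bool" where
  "superfluous C B a \<longleftrightarrow> subobject C B a \<and>
     (\<forall>x. subobject C B x \<and> is_sum C B {a, x} (Ident C B) \<longrightarrow> sub_eq C x (Ident C B))"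

definition direct_summand :: "('o, 'm, 'z) ab_cat_scheme \<Rightarrow> 'o \<Rightarrow> 'm \<Rightarrow> bool" where
  "direct_summand C M k \<longleftrightarrow> subobject C M k \<and>
     (\<exists>L \<in> Obj C. \<exists>j p q. is_biproduct C (Dom C k) L M k j p q)"

definition fully_invariant :: "('o, 'm, 'z) cat_scheme \<Rightarrow> 'o \<Rightarrow> 'm \<Rightarrow> bool" where
  "fully_invariant C M k \<longleftrightarrow> subobject C M k \<and>
     (\<forall>h \<in> hom_set C M M. \<exists>\<alpha> \<in> hom_set C (Dom C k) (Dom C k). h \<cdot>\<^bsub>C\<^esub> k = k \<cdot>\<^bsub>C\<^esub> \<alpha>)"

definition essential_in :: "('o, 'm, 'z) cat_scheme \<Rightarrow> 'm \<Rightarrow> 'm \<Rightarrow> bool" where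
  "essential_in C n d \<longleftrightarrow>
     (\<exists>u \<in> hom_set C (Dom C n) (Dom C d). n = d \<cdot>\<^bsub>C\<^esub> u \<and> essential C (Dom C d) u)"

text \<open>
  Here u is the inclusion of K into L, q the projection from M to M/K, p the projection
  from L to L/K, and v the inclusion of L/K into M/K induced by l.
\<close>

definition lies_above :: "('o, 'm, 'z) ab_cat_scheme \<Rightarrow> 'o \<Rightarrow> 'm \<Rightarrow> 'm \<Rightarrow> bool" where
  "lies_above C M l k \<longleftrightarrow> subobject C M l \<and> subobject C M k \<and>
     (\<exists>u \<in> hom_set C (Dom C k) (Dom C l). \<exists>q p. \<exists>v \<in> hom_set C (Cod C p) (Cod C q).
        k = l \<cdot>\<^bsub>C\<^esub> u \<and> is_cokernel C k q \<and> is_cokernel C u p \<and>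
        v \<cdot>\<^bsub>C\<^esub> p = q \<cdot>\<^bsub>C\<^esub> l \<and> superfluous C (Cod C q) v)"


section \<open>Self-CS-Baer objects and their duals\<close>

definition self_CS_Baer :: "'l set set \<Rightarrow> ('o, 'm, 'z) ab_cat_scheme \<Rightarrow> 'o \<Rightarrow> bool" where
  "self_CS_Baer U C M \<longleftrightarrow> M \<in> Obj C \<and>
     (\<forall>\<Lambda>\<in>U. \<forall>f. (\<forall>l\<in>\<Lambda>. f l \<in> hom_set C M M) \<longrightarrow>
        (\<exists>n d. is_intersection C M ((\<lambda>l. Ker C (f l)) ` \<Lambda>) n \<and>
               direct_summand C M d \<and> essential_in C n d))"

definition strongly_self_CS_Baer :: "'l set set \<Rightarrow> ('o, 'm, 'z) ab_cat_scheme \<Rightarrow> 'o \<Rightarrow> bool" where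
  "strongly_self_CS_Baer U C M \<longleftrightarrow> M \<in> Obj C \<and>
     (\<forall>\<Lambda>\<in>U. \<forall>f. (\<forall>l\<in>\<Lambda>. f l \<in> hom_set C M M) \<longrightarrow>
        (\<exists>n d. is_intersection C M ((\<lambda>l. Ker C (f l)) ` \<Lambda>) n \<and>
               direct_summand C M d \<and> fully_invariant C M d \<and> essential_in C n d))"

definition dual_self_CS_Baer :: "'l set set \<Rightarrow> ('o, 'm, 'z) ab_cat_scheme \<Rightarrow> 'o \<Rightarrow> bool" where
  "dual_self_CS_Baer U C M \<longleftrightarrow> M \<in> Obj C \<and>
     (\<forall>\<Lambda>\<in>U. \<forall>f. (\<forall>l\<in>\<Lambda>. f l \<in> hom_set C M M) \<longrightarrow>
        (\<exists>s d. is_sum C M ((\<lambda>l. Img C (f l)) ` \<Lambda>) s \<and>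
               direct_summand C M d \<and> lies_above C M s d))"

definition dual_strongly_self_CS_Baer ::
  "'l set set \<Rightarrow> ('o, 'm, 'z) ab_cat_scheme \<Rightarrow> 'o \<Rightarrow> bool" where
  "dual_strongly_self_CS_Baer U C M \<longleftrightarrow> M \<in> Obj C \<and>
     (\<forall>\<Lambda>\<in>U. \<forall>f. (\<forall>l\<in>\<Lambda>. f l \<in> hom_set C M M) \<longrightarrow>
        (\<exists>s d. is_sum C M ((\<lambda>l. Img C (f l)) ` \<Lambda>) s \<and>
               direct_summand C M d \<and> fully_invariant C M d \<and> lies_above C M s d))"

definition pairwise_hom_zero :: "('o, 'm, 'z) ab_cat_scheme \<Rightarrow> 'i set \<Rightarrow> ('i \<Rightarrow> 'o) \<Rightarrow> bool" where
  "pairwise_hom_zero C I X \<longleftrightarrow>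
     (\<forall>i\<in>I. \<forall>j\<in>I. i \<noteq> j \<longrightarrow> hom_set C (X i) (X j) = {Zero C (X i) (X j)})"

end

theory Submission
  imports Defs
begin

text \<open>
  Writing the direct summand as the image of an idempotent e, the condition on a family of
  endomorphisms becomes a condition on e stated with arrows into M only. If there are no nonzero
  arrows between distinct summands, then all endomorphisms of M are diagonal and the condition can
  be checked componentwise; the one nontrivial point is that finite direct sums of essential
  subobjects are essential. In the strong case all direct summands of M turn out to be fully
  invariant, which forces the arrows between distinct summands to vanish. Part (2) is part (1) in
  the opposite category: there, the condition on e expresses that the sum of the images lies above
  the direct summand complementary to e.
\<close>

section \<open>Arrows in preadditive categories\<close>

text \<open>The definitions of \<open>essential_in\<close> and \<open>lies_above\<close> are not
  literal duals: the first speaks of subobjects and intersections, the second of images, sums and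
  induced arrows between quotients. \<open>CS_idempotent\<close> is where they meet. It represents
  the intersection of the kernels by all arrows \<open>y\<close> into M killed by every
  \<open>f l\<close>, and the subobjects of the image of \<open>e\<close> by the monomorphisms fixed
  by \<open>e\<close>. Each of the two conditions is translated into it separately, so the
  decomposition argument is carried out once. The complement appears in the dual because an
  inclusion in the opposite category is a projection onto a quotient, and the quotient M/K by a
  direct summand K is realised by a complement of K.\<close>

text \<open>As a simplification rule it reduces typing of arrows to equations for \<open>Dom\<close>
  and \<open>Cod\<close>; it is switched off where quantified hom-set hypotheses have to match
  literally.\<close>

lemma hom_set_iff [simp]: "f \<in> hom_set C A B \<longleftrightarrow> f \<in> Arr C \<and> Dom C f = A \<and> Cod C f = B"
  by (simp add: hom_set_def)

context category
begin

lemma Dom_Obj [simp]: "f \<in> Arr C \<Longrightarrow> Dom C f \<in> Obj C"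
  and Cod_Obj [simp]: "f \<in> Arr C \<Longrightarrow> Cod C f \<in> Obj C"
  by (rule Dom_in_Obj Cod_in_Obj, assumption)+

lemma Ident_arr [simp]:
  assumes "A \<in> Obj C"
  shows "Ident C A \<in> Arr C" "Dom C (Ident C A) = A" "Cod C (Ident C A) = A"
  using Ident_in_hom [OF assms] by simp_all

lemma Comp_arr [simp]:
  assumes "f \<in> Arr C" "g \<in> Arr C" "Dom C g = Cod C f"
  shows "g \<cdot> f \<in> Arr C" "Dom C (g \<cdot> f) = Dom C f" "Cod C (g \<cdot> f) = Cod C g"
  using Comp_in_hom [of f "Dom C f" "Cod C f" g "Cod C g"] assms by simp_all

lemma Comp_Ident_simp [simp]: "f \<in> Arr C \<Longrightarrow> Dom C f = A \<Longrightarrow> f \<cdot> Ident C A = f"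
  using Comp_Ident [of f A "Cod C f"] by simp

lemma Ident_Comp_simp [simp]: "f \<in> Arr C \<Longrightarrow> Cod C f = B \<Longrightarrow> Ident C B \<cdot> f = f"
  using Ident_Comp [of f "Dom C f" B] by simp

lemma assoc:
  "f \<in> Arr C \<Longrightarrow> g \<in> Arr C \<Longrightarrow> h \<in> Arr C \<Longrightarrow> Dom C g = Cod C f \<Longrightarrow> Dom C h = Cod C g
    \<Longrightarrow> (h \<cdot> g) \<cdot> f = h \<cdot> (g \<cdot> f)"
  using Comp_assoc [of f "Dom C f" "Cod C f" g "Cod C g" h "Cod C h"] by simp

text \<open>Composites are normalised by \<open>assoc\<close> to the right, which hides a known
  product \<open>h \<cdot> g\<close> inside \<open>h \<cdot> (g \<cdot> f)\<close>. This applies the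
  equation for the product there.\<close>

lemma reassoc:
  assumes "h \<cdot> g = k" "f \<in> Arr C" "g \<in> Arr C" "h \<in> Arr C" "Dom C g = Cod C f" "Dom C h = Cod C g"
  shows "h \<cdot> (g \<cdot> f) = k \<cdot> f"
  using assms assoc by metis

end

lemma monicD:
  assumes "monic C f"
  shows "f \<in> Arr C"
    "g \<in> Arr C \<Longrightarrow> h \<in> Arr C \<Longrightarrow> Cod C g = Dom C f \<Longrightarrow> Cod C h = Dom C f \<Longrightarrow> Dom C g = Dom C h
      \<Longrightarrow> f \<cdot>\<^bsub>C\<^esub> g = f \<cdot>\<^bsub>C\<^esub> h \<Longrightarrow> g = h"
  using assms by (auto simp: monic_def)

lemma epicD:
  assumes "epic C f"
  shows "f \<in> Arr C"
    "g \<in> Arr C \<Longrightarrow> h \<in> Arr C \<Longrightarrow> Dom C g = Cod C f \<Longrightarrow> Dom C h = Cod C f \<Longrightarrow> Cod C g = Cod C h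
      \<Longrightarrow> g \<cdot>\<^bsub>C\<^esub> f = h \<cdot>\<^bsub>C\<^esub> f \<Longrightarrow> g = h"
  using assms by (auto simp: epic_def)

section \<open>Additive structure of hom-sets\<close>

context preadditive_category
begin

lemma Zero_arr [simp]:
  assumes "A \<in> Obj C" "B \<in> Obj C"
  shows "Zero C A B \<in> Arr C" "Dom C (Zero C A B) = A" "Cod C (Zero C A B) = B"
proof -
  interpret comm_group "hom_group C A B" by (rule hom_comm_group [OF assms])
  have "Zero C A B \<in> hom_set C A B"
    using one_closed by (simp add: hom_group_def)
  then show "Zero C A B \<in> Arr C" "Dom C (Zero C A B) = A" "Cod C (Zero C A B) = B"
    by simp_all
qed

lemma Plus_arr [simp]:
  assumes "f \<in> Arr C" "g \<in> Arr C" "Dom C f = Dom C g" "Cod C f = Cod C g"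
  shows "Plus C f g \<in> Arr C" "Dom C (Plus C f g) = Dom C g" "Cod C (Plus C f g) = Cod C g"
proof -
  interpret comm_group "hom_group C (Dom C g) (Cod C g)" by (rule hom_comm_group) (use assms in auto)
  have "Plus C f g \<in> hom_set C (Dom C g) (Cod C g)"
    using m_closed [of f g] assms by (simp add: hom_group_def)
  then show "Plus C f g \<in> Arr C" "Dom C (Plus C f g) = Dom C g" "Cod C (Plus C f g) = Cod C g"
    by simp_all
qed

lemma Plus_Zero [simp]:
  assumes "f \<in> Arr C" "Dom C f = A" "Cod C f = B"
  shows "Plus C f (Zero C A B) = f" "Plus C (Zero C A B) f = f"
proof -
  interpret comm_group "hom_group C A B" by (rule hom_comm_group) (use assms in auto)
  show "Plus C f (Zero C A B) = f" "Plus C (Zero C A B) f = f"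
    using r_one [of f] l_one [of f] assms by (simp_all add: hom_group_def)
qed

lemma Plus_left_cancel:
  assumes "Plus C f g = Plus C f h" "f \<in> Arr C" "g \<in> Arr C" "h \<in> Arr C"
    "Dom C g = Dom C f" "Dom C h = Dom C f" "Cod C g = Cod C f" "Cod C h = Cod C f"
  shows "g = h"
proof -
  interpret comm_group "hom_group C (Dom C f) (Cod C f)" by (rule hom_comm_group) (use assms in auto)
  show ?thesis
    using right_cancel [of f g h] m_comm [of f g] m_comm [of f h] assms by (simp add: hom_group_def)
qed

lemma Plus_commute:
  assumes "f \<in> Arr C" "g \<in> Arr C" "Dom C g = Dom C f" "Cod C g = Cod C f"
  shows "Plus C f g = Plus C g f"
proof -
  interpret comm_group "hom_group C (Dom C f) (Cod C f)" by (rule hom_comm_group) (use assms in auto)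
  show ?thesis
    using m_comm [of f g] assms by (simp add: hom_group_def)
qed

text \<open>The record has no symbol for negatives, so differences enter only through this existence
  statement. The witness is -f + h, computed in the hom group.\<close>

lemma Plus_diff:
  assumes "f \<in> Arr C" "h \<in> Arr C" "Dom C f = Dom C h" "Cod C f = Cod C h"
  obtains g where "g \<in> Arr C" "Dom C g = Dom C h" "Cod C g = Cod C h" "Plus C f g = h"
proof -
  interpret comm_group "hom_group C (Dom C h) (Cod C h)" by (rule hom_comm_group) (use assms in auto)
  have f: "f \<in> carrier (hom_group C (Dom C h) (Cod C h))"
    and h: "h \<in> carrier (hom_group C (Dom C h) (Cod C h))"
    using assms by (simp_all add: hom_group_def)
  let ?g = "m_inv (hom_group C (Dom C h) (Cod C h)) f \<otimes>\<^bsub>hom_group C (Dom C h) (Cod C h)\<^esub> h"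
  have "?g \<in> carrier (hom_group C (Dom C h) (Cod C h))"
    using f h by simp
  moreover have "f \<otimes>\<^bsub>hom_group C (Dom C h) (Cod C h)\<^esub> ?g = h"
    using f h by (simp add: m_assoc [symmetric])
  ultimately show thesis
    using that [of ?g] by (simp add: hom_group_def)
qed

lemma Comp_Plus_distrib:
  "f \<in> Arr C \<Longrightarrow> g \<in> Arr C \<Longrightarrow> h \<in> Arr C \<Longrightarrow> Dom C g = Cod C f \<Longrightarrow> Dom C h = Cod C f
    \<Longrightarrow> Cod C g = Cod C h \<Longrightarrow> Plus C g h \<cdot> f = Plus C (g \<cdot> f) (h \<cdot> f)"
  using Comp_Plus [of f "Dom C f" "Cod C f" g "Cod C h" h] by simp

lemma Plus_Comp_distrib:
  "f \<in> Arr C \<Longrightarrow> g \<in> Arr C \<Longrightarrow> h \<in> Arr C \<Longrightarrow> Dom C f = Dom C g \<Longrightarrow> Dom C h = Cod C f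
    \<Longrightarrow> Dom C h = Cod C g \<Longrightarrow> h \<cdot> Plus C f g = Plus C (h \<cdot> f) (h \<cdot> g)"
  using Plus_Comp [of f "Dom C f" "Cod C f" g h "Cod C h"] by simp

text \<open>Bilinearity is axiomatised for \<open>Plus\<close> alone. That composition preserves
  zero follows from 0 + 0 = 0 by cancellation.\<close>

lemma Comp_Zero [simp]:
  assumes "f \<in> Arr C" "Dom C f = B" "A \<in> Obj C"
  shows "f \<cdot> Zero C A B = Zero C A (Cod C f)"
proof (rule Plus_left_cancel)
  have "Plus C (f \<cdot> Zero C A B) (f \<cdot> Zero C A B) = f \<cdot> Plus C (Zero C A B) (Zero C A B)"
    using assms by (subst Plus_Comp_distrib) auto
  also have "\<dots> = Plus C (f \<cdot> Zero C A B) (Zero C A (Cod C f))"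
    using assms by auto
  finally show "Plus C (f \<cdot> Zero C A B) (f \<cdot> Zero C A B) = Plus C (f \<cdot> Zero C A B) (Zero C A (Cod C f))" .
qed (use assms in auto)

lemma Zero_Comp [simp]:
  assumes "f \<in> Arr C" "Cod C f = A" "B \<in> Obj C"
  shows "Zero C A B \<cdot> f = Zero C (Dom C f) B"
proof (rule Plus_left_cancel)
  have "Plus C (Zero C A B \<cdot> f) (Zero C A B \<cdot> f) = Plus C (Zero C A B) (Zero C A B) \<cdot> f"
    using assms by (subst Comp_Plus_distrib) auto
  also have "\<dots> = Plus C (Zero C A B \<cdot> f) (Zero C (Dom C f) B)"
    using assms by auto
  finally show "Plus C (Zero C A B \<cdot> f) (Zero C A B \<cdot> f) = Plus C (Zero C A B \<cdot> f) (Zero C (Dom C f) B)" .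
qed (use assms in auto)

section \<open>Monomorphisms and idempotents\<close>

text \<open>By additivity it is enough to test against zero: the hypothesis is applied to the
  difference of two arrows that \<open>f\<close> identifies.\<close>

lemma monicI:
  assumes f: "f \<in> Arr C"
    and cancel: "\<And>A z. z \<in> Arr C \<Longrightarrow> Dom C z = A \<Longrightarrow> Cod C z = Dom C f
      \<Longrightarrow> f \<cdot> z = Zero C A (Cod C f) \<Longrightarrow> z = Zero C A (Dom C f)"
  shows "monic C f"
  unfolding monic_def
proof (intro conjI allI ballI impI)
  fix A g h
  assume gh: "g \<in> hom_set C A (Dom C f)" "h \<in> hom_set C A (Dom C f)" and eq: "f \<cdot> g = f \<cdot> h"
  obtain d where d: "d \<in> Arr C" "Dom C d = A" "Cod C d = Dom C f" "Plus C g d = h"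
    using gh Plus_diff [of g h] by auto
  have "Plus C (f \<cdot> g) (f \<cdot> d) = f \<cdot> Plus C g d"
    using gh d f by (subst Plus_Comp_distrib) auto
  also have "\<dots> = Plus C (f \<cdot> g) (Zero C A (Cod C f))"
    using gh d f eq by auto
  finally have "f \<cdot> d = Zero C A (Cod C f)"
    by (rule Plus_left_cancel) (use gh d f in auto)
  then have "d = Zero C A (Dom C f)"
    using cancel d by simp
  then show "g = h"
    using d gh by auto
qed (rule f)

lemma monic_Comp_eq_Zero:
  assumes "monic C f" "z \<in> Arr C" "Cod C z = Dom C f" "f \<cdot> z = Zero C (Dom C z) (Cod C f)"
  shows "z = Zero C (Dom C z) (Dom C f)"
  by (rule monicD(2) [OF assms(1)]) (use assms monicD(1) [OF assms(1)] in auto)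

lemma epic_Comp_eq_Zero:
  assumes "epic C f" "z \<in> Arr C" "Dom C z = Cod C f" "z \<cdot> f = Zero C (Dom C f) (Cod C z)"
  shows "z = Zero C (Cod C f) (Cod C z)"
  by (rule epicD(2) [OF assms(1)]) (use assms epicD(1) [OF assms(1)] in auto)

lemma monic_Comp:
  assumes "monic C f" "monic C g" "Dom C g = Cod C f"
  shows "monic C (g \<cdot> f)"
proof (rule monicI)
  fix A z
  assume z: "z \<in> Arr C" "Dom C z = A" "Cod C z = Dom C (g \<cdot> f)"
    "g \<cdot> f \<cdot> z = Zero C A (Cod C (g \<cdot> f))"
  note [simp] = monicD(1) [OF assms(1)] monicD(1) [OF assms(2)]
  have "g \<cdot> (f \<cdot> z) = Zero C A (Cod C g)"
    using z assms by (simp add: assoc)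
  then have "f \<cdot> z = Zero C A (Dom C g)"
    using z assms monic_Comp_eq_Zero [of g "f \<cdot> z"] by simp
  then show "z = Zero C A (Dom C (g \<cdot> f))"
    using z assms monic_Comp_eq_Zero [of f z] by simp
qed (use assms in \<open>auto dest!: monicD(1)\<close>)

lemma monic_right_factor:
  assumes "monic C (g \<cdot> f)" "f \<in> Arr C" "g \<in> Arr C" "Dom C g = Cod C f"
  shows "monic C f"
proof (rule monicI)
  fix A z
  assume z: "z \<in> Arr C" "Dom C z = A" "Cod C z = Dom C f" "f \<cdot> z = Zero C A (Cod C f)"
  have "(g \<cdot> f) \<cdot> z = Zero C A (Cod C (g \<cdot> f))"
    using z assms by (auto simp: assoc)
  then show "z = Zero C A (Dom C f)"
    using z assms monic_Comp_eq_Zero [of "g \<cdot> f" z] by simp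
qed (rule assms(2))

lemma split_monic:
  assumes "p \<cdot> d = Ident C D" "D \<in> Obj C" "d \<in> Arr C" "p \<in> Arr C" "Dom C p = Cod C d" "Dom C d = D"
  shows "monic C d"
proof (rule monic_right_factor)
  show "monic C (p \<cdot> d)"
    using assms by (intro monicI) auto
qed (use assms in auto)

text \<open>\<open>c\<close> is the identity minus \<open>e\<close>. The equivalences make the image
  of \<open>e\<close> the kernel of \<open>c\<close>, and with the last two equations they replace
  calculations with differences.\<close>

lemma complement:
  assumes e: "e \<in> hom_set C M M" "e \<cdot> e = e"
  obtains c where "c \<in> hom_set C M M" "Plus C e c = Ident C M" "c \<cdot> c = c"
    "e \<cdot> c = Zero C M M" "c \<cdot> e = Zero C M M"
    "\<And>y. y \<in> Arr C \<Longrightarrow> Cod C y = M \<Longrightarrow> e \<cdot> y = y \<longleftrightarrow> c \<cdot> y = Zero C (Dom C y) M"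
    "\<And>y. y \<in> Arr C \<Longrightarrow> Dom C y = M \<Longrightarrow> y \<cdot> e = y \<longleftrightarrow> y \<cdot> c = Zero C M (Cod C y)"
    "\<And>y. y \<in> Arr C \<Longrightarrow> Cod C y = M \<Longrightarrow> Plus C (e \<cdot> y) (c \<cdot> y) = y"
    "\<And>y. y \<in> Arr C \<Longrightarrow> Dom C y = M \<Longrightarrow> Plus C (y \<cdot> e) (y \<cdot> c) = y"
proof -
  have M: "M \<in> Obj C"
    using e by auto
  obtain c where c: "c \<in> Arr C" "Dom C c = M" "Cod C c = M" "Plus C e c = Ident C M"
    using e M Plus_diff [of e "Ident C M"] by auto
  have 1: "Plus C (e \<cdot> y) (c \<cdot> y) = y" if "y \<in> Arr C" "Cod C y = M" for y
    using that e c Comp_Plus_distrib [of y e c] by simp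
  have 2: "Plus C (y \<cdot> e) (y \<cdot> c) = y" if "y \<in> Arr C" "Dom C y = M" for y
    using that e c Plus_Comp_distrib [of e c y] by simp
  have 3: "e \<cdot> y = y \<longleftrightarrow> c \<cdot> y = Zero C (Dom C y) M" if y: "y \<in> Arr C" "Cod C y = M" for y
  proof
    assume "e \<cdot> y = y"
    then have "Plus C y (c \<cdot> y) = Plus C y (Zero C (Dom C y) M)"
      using 1 [OF y] y by simp
    then show "c \<cdot> y = Zero C (Dom C y) M"
      by (rule Plus_left_cancel) (use y c M in auto)
  next
    assume "c \<cdot> y = Zero C (Dom C y) M"
    then show "e \<cdot> y = y"
      using 1 [OF y] y e by simp
  qed
  have 4: "y \<cdot> e = y \<longleftrightarrow> y \<cdot> c = Zero C M (Cod C y)" if y: "y \<in> Arr C" "Dom C y = M" for y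
  proof
    assume "y \<cdot> e = y"
    then have "Plus C y (y \<cdot> c) = Plus C y (Zero C M (Cod C y))"
      using 2 [OF y] y by simp
    then show "y \<cdot> c = Zero C M (Cod C y)"
      by (rule Plus_left_cancel) (use y c M in auto)
  next
    assume "y \<cdot> c = Zero C M (Cod C y)"
    then show "y \<cdot> e = y"
      using 2 [OF y] y e by simp
  qed
  have ce: "c \<cdot> e = Zero C M M" and ec: "e \<cdot> c = Zero C M M"
    using 3 [of e] 4 [of e] e by auto
  have "c \<cdot> c = c"
    using 1 [of c] c M ec by simp
  then show thesis
    using that [of c] c ce ec 1 2 3 4 by simp
qed

end

section \<open>Kernels, cokernels and idempotents in abelian categories\<close>

context abelian_category
begin

lemma kernel_Ker: "f \<in> Arr C \<Longrightarrow> is_kernel C f (Ker C f)"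
  unfolding Ker_def by (rule someI_ex) (rule has_kernels)

lemma cokernel_Coker: "f \<in> Arr C \<Longrightarrow> is_cokernel C f (Coker C f)"
  unfolding Coker_def by (rule someI_ex) (rule has_cokernels)

lemma kernelD:
  assumes "is_kernel C f k"
  shows "f \<in> Arr C" "k \<in> Arr C" "Cod C k = Dom C f" "f \<cdot> k = Zero C (Dom C k) (Cod C f)"
  using assms by (auto simp: is_kernel_def)

lemma kernel_factor:
  assumes "is_kernel C f k" "g \<in> Arr C" "Cod C g = Dom C f" "f \<cdot> g = Zero C (Dom C g) (Cod C f)"
  obtains h where "h \<in> Arr C" "Dom C h = Dom C g" "Cod C h = Dom C k" "k \<cdot> h = g"
proof -
  have "\<exists>!h. h \<in> hom_set C (Dom C g) (Dom C k) \<and> k \<cdot> h = g"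
    using assms(1) bspec [of "Obj C" _ "Dom C g"] bspec [of "hom_set C (Dom C g) (Dom C f)" _ g] assms(2-)
    unfolding is_kernel_def by simp
  then show thesis
    using that by (metis hom_set_iff)
qed

lemma kernel_monic:
  assumes "is_kernel C f k"
  shows "monic C k"
proof (rule monicI)
  note k = kernelD [OF assms]
  fix A z
  assume z: "z \<in> Arr C" "Dom C z = A" "Cod C z = Dom C k" "k \<cdot> z = Zero C A (Cod C k)"
  have A: "A \<in> Obj C"
    using z by auto
  have "\<exists>!h. h \<in> hom_set C A (Dom C k) \<and> k \<cdot> h = Zero C A (Dom C f)"
  proof -
    have "\<forall>A \<in> Obj C. \<forall>g \<in> hom_set C A (Dom C f). f \<cdot> g = Zero C A (Cod C f) \<longrightarrow>
        (\<exists>!h. h \<in> hom_set C A (Dom C k) \<and> k \<cdot> h = g)"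
      using assms by (simp add: is_kernel_def)
    moreover have "Zero C A (Dom C f) \<in> hom_set C A (Dom C f)"
      "f \<cdot> Zero C A (Dom C f) = Zero C A (Cod C f)"
      using A k by simp_all
    ultimately show ?thesis
      using A by blast
  qed
  moreover have "z \<in> hom_set C A (Dom C k) \<and> k \<cdot> z = Zero C A (Dom C f)"
    using z k by simp
  moreover have "Zero C A (Dom C k) \<in> hom_set C A (Dom C k) \<and> k \<cdot> Zero C A (Dom C k) = Zero C A (Dom C f)"
    using A k by simp
  ultimately show "z = Zero C A (Dom C k)"
    by blast
qed (rule kernelD [OF assms])

lemma cokernelD:
  assumes "is_cokernel C f q"
  shows "f \<in> Arr C" "q \<in> Arr C" "Dom C q = Cod C f" "q \<cdot> f = Zero C (Dom C f) (Cod C q)"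
  using assms by (auto simp: is_cokernel_def)

lemma cokernel_factor:
  assumes "is_cokernel C f q" "g \<in> Arr C" "Dom C g = Cod C f" "g \<cdot> f = Zero C (Dom C f) (Cod C g)"
  obtains h where "h \<in> Arr C" "Dom C h = Cod C q" "Cod C h = Cod C g" "h \<cdot> q = g"
proof -
  have "\<exists>!h. h \<in> hom_set C (Cod C q) (Cod C g) \<and> h \<cdot> q = g"
    using assms(1) bspec [of "Obj C" _ "Cod C g"] bspec [of "hom_set C (Cod C f) (Cod C g)" _ g] assms(2-)
    unfolding is_cokernel_def by simp
  then show thesis
    using that by (metis hom_set_iff)
qed

text \<open>A monomorphism is the kernel of some arrow, and hence of its cokernel.\<close>

lemma monic_kernel_Coker:
  assumes k: "monic C k"
  shows "is_kernel C (Coker C k) k"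
proof -
  obtain f where f: "is_kernel C f k"
    using monic_is_kernel [OF k] by blast
  have q: "is_cokernel C k (Coker C k)"
    using k by (intro cokernel_Coker monicD)
  note [simp] = kernelD [OF f] cokernelD [OF q]
  obtain h where h: "h \<in> Arr C" "Dom C h = Cod C (Coker C k)" "Cod C h = Cod C f" "h \<cdot> Coker C k = f"
    by (rule cokernel_factor [OF q, of f]) simp_all
  show ?thesis
    unfolding is_kernel_def
  proof (intro conjI ballI impI)
    fix A g
    assume g: "g \<in> hom_set C A (Dom C (Coker C k))" "Coker C k \<cdot> g = Zero C A (Cod C (Coker C k))"
    have "f \<cdot> g = h \<cdot> (Coker C k \<cdot> g)"
      using g(1) h by (simp flip: assoc)
    also have "\<dots> = Zero C A (Cod C f)"
      using g h Comp_Zero [of h "Cod C (Coker C k)" A] Dom_Obj [of g] by simp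
    finally obtain u where u: "u \<in> Arr C" "Dom C u = A" "Cod C u = Dom C k" "k \<cdot> u = g"
      using kernel_factor [OF f, of g] g by auto
    then show "\<exists>!h. h \<in> hom_set C A (Dom C k) \<and> k \<cdot> h = g"
      by (intro ex1I [of _ u]) (auto intro: monicD(2) [OF k])
  qed simp_all
qed

text \<open>The kernel of the complement \<open>c\<close> consists of what \<open>e\<close> fixes.
  Hence \<open>e\<close> factors through it, and the factor is a retraction because a kernel is
  monic.\<close>

lemma split_idempotent:
  assumes e: "e \<in> hom_set C M M" "e \<cdot> e = e"
  obtains D d p where "d \<in> hom_set C D M" "p \<in> hom_set C M D" "p \<cdot> d = Ident C D" "d \<cdot> p = e"
proof -
  obtain c where c: "c \<in> hom_set C M M" "c \<cdot> e = Zero C M M"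
    "\<And>y. y \<in> Arr C \<Longrightarrow> Cod C y = M \<Longrightarrow> e \<cdot> y = y \<longleftrightarrow> c \<cdot> y = Zero C (Dom C y) M"
    using complement [OF e] by metis
  have d: "is_kernel C c (Ker C c)"
    using c by (intro kernel_Ker) simp
  let ?d = "Ker C c"
  note [simp] = kernelD(2-4) [OF d]
  obtain p where p: "p \<in> Arr C" "Dom C p = M" "Cod C p = Dom C ?d" "?d \<cdot> p = e"
    by (rule kernel_factor [OF d, of e]) (use e c in auto)
  have "?d \<cdot> (p \<cdot> ?d) = e \<cdot> ?d"
    using p c by (simp flip: assoc)
  also have "\<dots> = ?d \<cdot> Ident C (Dom C ?d)"
    using c(1) c(3) [of ?d] by simp
  finally have "p \<cdot> ?d = Ident C (Dom C ?d)"
    by (rule monicD(2) [OF kernel_monic [OF d], rotated -1]) (use p c in auto)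
  then show thesis
    using that [of ?d "Dom C ?d" p] p c by simp
qed

section \<open>Zero objects and zero subobjects\<close>

text \<open>A monomorphism that is zero kills the identity of its domain, so this identity is zero
  and every arrow into or out of the domain is zero.\<close>

lemma zero_object_domI:
  assumes "monic C x" "x = Zero C (Dom C x) (Cod C x)"
  shows "zero_object C (Dom C x)"
proof -
  have X: "x \<in> Arr C" "Dom C x \<in> Obj C"
    using monicD(1) [OF assms(1)] by simp_all
  have "x \<cdot> Ident C (Dom C x) = Zero C (Dom C x) (Cod C x)"
    using X assms(2) by simp
  then have id: "Ident C (Dom C x) = Zero C (Dom C x) (Dom C x)"
    using monic_Comp_eq_Zero [OF assms(1), of "Ident C (Dom C x)"] X by simp
  show ?thesis
    unfolding zero_object_def
  proof (intro conjI ballI)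
    fix A
    assume A: "A \<in> Obj C"
    have "f = Zero C A (Dom C x)" if "f \<in> hom_set C A (Dom C x)" for f
      using that Ident_Comp_simp [of f "Dom C x"] X id by auto
    moreover have "f = Zero C (Dom C x) A" if "f \<in> hom_set C (Dom C x) A" for f
      using that Comp_Ident_simp [of f "Dom C x"] X id by auto
    ultimately show "\<exists>!f. f \<in> hom_set C A (Dom C x)" "\<exists>!f. f \<in> hom_set C (Dom C x) A"
      using A X Zero_arr by (metis hom_set_iff)+
  qed (use X in auto)
qed

text \<open>Trades the zero object of the definition for an equation between arrows, the form that
  is stable under composition and usable in both clauses of \<open>CS_idempotent\<close>.\<close>

lemma zero_subobject_iff:
  "zero_subobject C B x \<longleftrightarrow> subobject C B x \<and> x = Zero C (Dom C x) B"
proof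
  assume x: "zero_subobject C B x"
  then have arr: "x \<in> Arr C" "Cod C x = B"
    by (auto simp: zero_subobject_def subobject_def dest: monicD(1))
  then have "\<exists>!f. f \<in> hom_set C (Dom C x) B"
    using x Cod_Obj by (metis zero_subobject_def zero_object_def)
  moreover have "x \<in> hom_set C (Dom C x) B" "Zero C (Dom C x) B \<in> hom_set C (Dom C x) B"
    using arr by auto
  ultimately show "subobject C B x \<and> x = Zero C (Dom C x) B"
    using x by (metis zero_subobject_def)
next
  assume "subobject C B x \<and> x = Zero C (Dom C x) B"
  then show "zero_subobject C B x"
    using zero_object_domI [of x] by (auto simp: zero_subobject_def subobject_def)
qed

lemma zero_subobject_exists:
  assumes "B \<in> Obj C"
  obtains z where "zero_subobject C B z"
proof -
  obtain Z where Z: "zero_object C Z"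
    using has_zero_object by blast
  then have "Z \<in> Obj C"
    by (simp add: zero_object_def)
  moreover have "monic C (Zero C Z B)"
    unfolding monic_def using Z calculation assms
    by (auto simp: zero_object_def) (metis Dom_Obj hom_set_iff)
  ultimately show thesis
    using that [of "Zero C Z B"] Z assms by (simp add: zero_subobject_def subobject_def)
qed

lemma zero_subobject_le:
  assumes "subobject C B x" "subobject C B y" "x = Zero C (Dom C x) B"
  shows "sub_le C x y"
  unfolding sub_le_def
proof
  have "x \<in> Arr C" "y \<in> Arr C" "Cod C y = B"
    using assms by (auto simp: subobject_def dest: monicD(1))
  then show "Zero C (Dom C x) (Dom C y) \<in> hom_set C (Dom C x) (Dom C y)"
    "x = y \<cdot> Zero C (Dom C x) (Dom C y)"
    using assms(3) by auto
qed

end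

section \<open>Idempotents of self-CS-Baer objects\<close>

text \<open>
  Splitting e = d p with p d the identity, this says that the intersection of the kernels of the
  f l is essential in the direct summand d. Stated with arrows into M instead of subobjects, it
  carries over literally to the opposite category.
\<close>

definition CS_idempotent ::
  "('o, 'm, 'z) ab_cat_scheme \<Rightarrow> 'o \<Rightarrow> 'l set \<Rightarrow> ('l \<Rightarrow> 'm) \<Rightarrow> 'm \<Rightarrow> bool" where
  "CS_idempotent C M \<Lambda> f e \<longleftrightarrow> e \<in> hom_set C M M \<and> e \<cdot>\<^bsub>C\<^esub> e = e \<and>
     (\<forall>y\<in>Arr C. Cod C y = M \<longrightarrow> (\<forall>l\<in>\<Lambda>. f l \<cdot>\<^bsub>C\<^esub> y = Zero C (Dom C y) M) \<longrightarrow> e \<cdot>\<^bsub>C\<^esub> y = y) \<and>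
     (\<forall>x. monic C x \<longrightarrow> Cod C x = M \<longrightarrow> e \<cdot>\<^bsub>C\<^esub> x = x \<longrightarrow>
        (\<forall>y\<in>Arr C. Cod C y = Dom C x \<longrightarrow>
           (\<forall>l\<in>\<Lambda>. f l \<cdot>\<^bsub>C\<^esub> (x \<cdot>\<^bsub>C\<^esub> y) = Zero C (Dom C y) M) \<longrightarrow> x \<cdot>\<^bsub>C\<^esub> y = Zero C (Dom C y) M) \<longrightarrow>
        x = Zero C (Dom C x) M)"

definition CS_Baer_idem :: "'l set set \<Rightarrow> ('o, 'm, 'z) ab_cat_scheme \<Rightarrow> 'o \<Rightarrow> bool" where
  "CS_Baer_idem U C M \<longleftrightarrow>
     (\<forall>\<Lambda>\<in>U. \<forall>f. (\<forall>l\<in>\<Lambda>. f l \<in> hom_set C M M) \<longrightarrow> (\<exists>e. CS_idempotent C M \<Lambda> f e))"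

text \<open>The equation for \<open>h\<close> says that \<open>h\<close> maps the image of
  \<open>e\<close> into itself. Read in the opposite category it becomes
  \<open>e \<cdot> h = e \<cdot> h \<cdot> e\<close>: \<open>h\<close> preserves the kernel of
  \<open>e\<close>, that is, the image of the complementary idempotent.\<close>

definition strongly_CS_Baer_idem :: "'l set set \<Rightarrow> ('o, 'm, 'z) ab_cat_scheme \<Rightarrow> 'o \<Rightarrow> bool" where
  "strongly_CS_Baer_idem U C M \<longleftrightarrow>
     (\<forall>\<Lambda>\<in>U. \<forall>f. (\<forall>l\<in>\<Lambda>. f l \<in> hom_set C M M) \<longrightarrow>
        (\<exists>e. CS_idempotent C M \<Lambda> f e \<and> (\<forall>h\<in>hom_set C M M. h \<cdot>\<^bsub>C\<^esub> e = e \<cdot>\<^bsub>C\<^esub> (h \<cdot>\<^bsub>C\<^esub> e))))"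

text \<open>The fifth rule puts the joint kernel of the \<open>f l\<close> inside the image of
  \<open>e\<close>. The sixth is essentiality there: \<open>x\<close> is a subobject of the image of
  \<open>e\<close>, and its premise on \<open>y\<close> says that \<open>x\<close> meets the joint
  kernel only in zero.\<close>

lemma CS_idempotentD:
  assumes "CS_idempotent C M \<Lambda> f e"
  shows "e \<in> Arr C" "Dom C e = M" "Cod C e = M" "e \<cdot>\<^bsub>C\<^esub> e = e"
    "\<And>y. y \<in> Arr C \<Longrightarrow> Cod C y = M \<Longrightarrow> (\<And>l. l \<in> \<Lambda> \<Longrightarrow> f l \<cdot>\<^bsub>C\<^esub> y = Zero C (Dom C y) M) \<Longrightarrow> e \<cdot>\<^bsub>C\<^esub> y = y"
    "\<And>x. monic C x \<Longrightarrow> Cod C x = M \<Longrightarrow> e \<cdot>\<^bsub>C\<^esub> x = x \<Longrightarrow>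
      (\<And>y. y \<in> Arr C \<Longrightarrow> Cod C y = Dom C x \<Longrightarrow>
        (\<And>l. l \<in> \<Lambda> \<Longrightarrow> f l \<cdot>\<^bsub>C\<^esub> (x \<cdot>\<^bsub>C\<^esub> y) = Zero C (Dom C y) M) \<Longrightarrow>
        x \<cdot>\<^bsub>C\<^esub> y = Zero C (Dom C y) M) \<Longrightarrow>
      x = Zero C (Dom C x) M"
  using assms by (simp_all add: CS_idempotent_def)

lemma CS_idempotentI:
  assumes "e \<in> Arr C" "Dom C e = M" "Cod C e = M" "e \<cdot>\<^bsub>C\<^esub> e = e"
    "\<And>y. y \<in> Arr C \<Longrightarrow> Cod C y = M \<Longrightarrow> (\<And>l. l \<in> \<Lambda> \<Longrightarrow> f l \<cdot>\<^bsub>C\<^esub> y = Zero C (Dom C y) M) \<Longrightarrow> e \<cdot>\<^bsub>C\<^esub> y = y"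
    "\<And>x. monic C x \<Longrightarrow> Cod C x = M \<Longrightarrow> e \<cdot>\<^bsub>C\<^esub> x = x \<Longrightarrow>
      (\<And>y. y \<in> Arr C \<Longrightarrow> Cod C y = Dom C x \<Longrightarrow>
        (\<And>l. l \<in> \<Lambda> \<Longrightarrow> f l \<cdot>\<^bsub>C\<^esub> (x \<cdot>\<^bsub>C\<^esub> y) = Zero C (Dom C y) M) \<Longrightarrow>
        x \<cdot>\<^bsub>C\<^esub> y = Zero C (Dom C y) M) \<Longrightarrow>
      x = Zero C (Dom C x) M"
  shows "CS_idempotent C M \<Lambda> f e"
  unfolding CS_idempotent_def using assms by auto

text \<open>The \<open>f l\<close> are the components of one arrow into a product of copies of Y,
  and the kernel of that arrow is the joint kernel. This is the place where products are used.
  Domain and codomain are kept apart because the lemma is also applied to families restricted along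
  a monomorphism.\<close>

lemma (in abelian_category) joint_kernel:
  assumes "AB3_star U C" "\<Lambda> \<in> U" "X \<in> Obj C" "Y \<in> Obj C"
    and f: "\<And>l. l \<in> \<Lambda> \<Longrightarrow> f l \<in> hom_set C X Y"
  obtains k where "monic C k" "k \<in> Arr C" "Cod C k = X" "\<And>l. l \<in> \<Lambda> \<Longrightarrow> f l \<cdot> k = Zero C (Dom C k) Y"
    "\<And>y. y \<in> Arr C \<Longrightarrow> Cod C y = X \<Longrightarrow> (\<And>l. l \<in> \<Lambda> \<Longrightarrow> f l \<cdot> y = Zero C (Dom C y) Y)
      \<Longrightarrow> \<exists>h\<in>Arr C. Dom C h = Dom C y \<and> Cod C h = Dom C k \<and> k \<cdot> h = y"
proof -
  obtain P \<pi> where P: "is_product C \<Lambda> (\<lambda>_. Y) P \<pi>"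
    using assms unfolding AB3_star_def by meson
  then have \<pi> [simp]: "\<pi> l \<in> Arr C" "Dom C (\<pi> l) = P" "Cod C (\<pi> l) = Y" if "l \<in> \<Lambda>" for l
    using that by (simp_all add: is_product_def)
  have [simp]: "P \<in> Obj C"
    using P by (simp add: is_product_def)
  have univ: "\<exists>!h. h \<in> hom_set C A P \<and> (\<forall>l\<in>\<Lambda>. \<pi> l \<cdot> h = g l)"
    if "A \<in> Obj C" "\<And>l. l \<in> \<Lambda> \<Longrightarrow> g l \<in> hom_set C A Y" for A g
    using P that unfolding is_product_def by blast
  obtain h where h [simp]: "h \<in> Arr C" "Dom C h = X" "Cod C h = P" and \<pi>h: "\<And>l. l \<in> \<Lambda> \<Longrightarrow> \<pi> l \<cdot> h = f l"
    using univ [of X f] assms f by (metis hom_set_iff)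
  let ?k = "Ker C h"
  have k: "is_kernel C h ?k"
    by (rule kernel_Ker) simp
  note [simp] = kernelD(2,3) [OF k]
  have "f l \<cdot> ?k = Zero C (Dom C ?k) Y" if "l \<in> \<Lambda>" for l
    using that kernelD(4) [OF k] by (simp add: assoc flip: \<pi>h)
  moreover have "\<exists>u\<in>Arr C. Dom C u = Dom C y \<and> Cod C u = Dom C ?k \<and> ?k \<cdot> u = y"
    if y: "y \<in> Arr C" "Cod C y = X" "\<And>l. l \<in> \<Lambda> \<Longrightarrow> f l \<cdot> y = Zero C (Dom C y) Y" for y
  proof -
    have Y: "Dom C y \<in> Obj C"
      using y by simp
    have "\<pi> l \<cdot> (h \<cdot> y) = Zero C (Dom C y) Y" if "l \<in> \<Lambda>" for l
      using that y by (simp add: \<pi>h flip: assoc)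
    moreover have "\<pi> l \<cdot> Zero C (Dom C y) P = Zero C (Dom C y) Y" if "l \<in> \<Lambda>" for l
      using that y by simp
    moreover have "h \<cdot> y \<in> hom_set C (Dom C y) P" "Zero C (Dom C y) P \<in> hom_set C (Dom C y) P"
      using y by simp_all
    moreover have "\<exists>!u. u \<in> hom_set C (Dom C y) P \<and> (\<forall>l\<in>\<Lambda>. \<pi> l \<cdot> u = Zero C (Dom C y) Y)"
      by (rule univ [of "Dom C y" "\<lambda>_. Zero C (Dom C y) Y"]) (use Y assms(4) in auto)
    ultimately have "h \<cdot> y = Zero C (Dom C y) P"
      by blast
    then show ?thesis
      using kernel_factor [OF k, of y] y by (metis h(2,3))
  qed
  ultimately show thesis
    using that [of ?k] kernel_monic [OF k] by simp
qed

section \<open>Finite direct sums\<close>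

text \<open>Instead of asking that the sum of all \<open>\<iota> i \<cdot> \<pi> i\<close> be the
  identity, the axioms ask for joint cancellation of the injections and of the projections. No
  indexed sums have to be formed, and the axioms are symmetric under exchanging
  \<open>\<iota>\<close> and \<open>\<pi>\<close>, so the opposite category satisfies them
  too.\<close>

locale biproduct_system = abelian_category C for C :: "('o, 'm, 'z) ab_cat_scheme" (structure) +
  fixes I :: "'i set" and N :: "'i \<Rightarrow> 'o" and M :: 'o and \<iota> :: "'i \<Rightarrow> 'm" and \<pi> :: "'i \<Rightarrow> 'm"
  assumes finite_I: "finite I"
    and M_Obj [simp]: "M \<in> Obj C"
    and inj: "i \<in> I \<Longrightarrow> \<iota> i \<in> hom_set C (N i) M"
    and proj: "i \<in> I \<Longrightarrow> \<pi> i \<in> hom_set C M (N i)"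
    and proj_inj [simp]: "i \<in> I \<Longrightarrow> \<pi> i \<cdot> \<iota> i = Ident C (N i)"
    and proj_inj_Zero: "i \<in> I \<Longrightarrow> j \<in> I \<Longrightarrow> i \<noteq> j \<Longrightarrow> \<pi> i \<cdot> \<iota> j = Zero C (N j) (N i)"
    and inj_jointly_epic: "g \<in> hom_set C M A \<Longrightarrow> h \<in> hom_set C M A
      \<Longrightarrow> (\<And>i. i \<in> I \<Longrightarrow> g \<cdot> \<iota> i = h \<cdot> \<iota> i) \<Longrightarrow> g = h"
    and proj_jointly_monic: "g \<in> hom_set C A M \<Longrightarrow> h \<in> hom_set C A M
      \<Longrightarrow> (\<And>i. i \<in> I \<Longrightarrow> \<pi> i \<cdot> g = \<pi> i \<cdot> h) \<Longrightarrow> g = h"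
begin

lemma inj_arr [simp]:
  assumes "i \<in> I"
  shows "\<iota> i \<in> Arr C" "Dom C (\<iota> i) = N i" "Cod C (\<iota> i) = M"
  using inj [OF assms] by simp_all

lemma proj_arr [simp]:
  assumes "i \<in> I"
  shows "\<pi> i \<in> Arr C" "Dom C (\<pi> i) = M" "Cod C (\<pi> i) = N i"
  using proj [OF assms] by simp_all

lemma N_Obj [simp]: "i \<in> I \<Longrightarrow> N i \<in> Obj C"
  using inj_arr Dom_Obj by metis

lemma proj_inj_Comp [simp]:
  assumes "i \<in> I" "g \<in> Arr C" "Cod C g = N i"
  shows "\<pi> i \<cdot> (\<iota> i \<cdot> g) = g"
  using assms reassoc [OF proj_inj [OF assms(1)], of g] by simp

text \<open>The arrow is the sum of the \<open>\<iota> i \<cdot> g i\<close>, built one summand at a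
  time. Requiring zero components outside \<open>J\<close> ensures that adding the summand at
  \<open>j\<close> puts exactly \<open>g j\<close> there.\<close>

lemma tuple_exists:
  assumes A: "A \<in> Obj C" and g: "\<And>i. i \<in> I \<Longrightarrow> g i \<in> hom_set C A (N i)"
  obtains h where "h \<in> hom_set C A M" "\<And>i. i \<in> I \<Longrightarrow> \<pi> i \<cdot> h = g i"
proof -
  have "\<exists>h\<in>hom_set C A M. (\<forall>i\<in>J. \<pi> i \<cdot> h = g i) \<and> (\<forall>i\<in>I-J. \<pi> i \<cdot> h = Zero C A (N i))" if "J \<subseteq> I" for J
    using finite_subset [OF that finite_I] that
  proof (induction J)
    case empty
    show ?case
      by (rule bexI [of _ "Zero C A M"]) (use A in auto)
  next
    case (insert j J)
    then obtain h where h [simp]: "h \<in> Arr C" "Dom C h = A" "Cod C h = M" and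
      hJ: "\<And>i. i \<in> J \<Longrightarrow> \<pi> i \<cdot> h = g i" "\<And>i. i \<in> I \<Longrightarrow> i \<notin> J \<Longrightarrow> \<pi> i \<cdot> h = Zero C A (N i)"
      by auto
    have [simp]: "g i \<in> Arr C" "Dom C (g i) = A" "Cod C (g i) = N i" if "i \<in> I" for i
      using g [OF that] by simp_all
    have [simp]: "j \<in> I" "j \<notin> J"
      using insert by auto
    let ?h = "Plus C h (\<iota> j \<cdot> g j)"
    have "\<pi> i \<cdot> ?h = Plus C (\<pi> i \<cdot> h) (\<pi> i \<cdot> (\<iota> j \<cdot> g j))" if "i \<in> I" for i
      using that by (simp add: Plus_Comp_distrib)
    moreover have "\<pi> i \<cdot> (\<iota> j \<cdot> g j) = Zero C A (N i)" if "i \<in> I" "i \<noteq> j" for i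
      using that reassoc [OF proj_inj_Zero [of i j], of "g j"] by simp
    ultimately have "\<pi> i \<cdot> ?h = (if i = j then g j else \<pi> i \<cdot> h)" if "i \<in> I" for i
      using that hJ(2) [of j] A by simp
    then show ?case
      using hJ insert.prems by (intro bexI [of _ ?h]) auto
  qed
  from this [of I] show thesis
    using that by auto
qed

lemma diagonal_exists:
  assumes e: "\<And>i. i \<in> I \<Longrightarrow> e i \<in> hom_set C (N i) (N i)"
  obtains h where "h \<in> hom_set C M M" "\<And>i. i \<in> I \<Longrightarrow> \<pi> i \<cdot> h = e i \<cdot> \<pi> i"
  by (rule tuple_exists [of M "\<lambda>i. e i \<cdot> \<pi> i"]) (use e in auto)

section \<open>No nonzero arrows between distinct summands\<close>

context
  assumes hom_zero: "pairwise_hom_zero C I N"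
begin

lemma off_diagonal_Zero:
  "i \<in> I \<Longrightarrow> j \<in> I \<Longrightarrow> i \<noteq> j \<Longrightarrow> h \<in> Arr C \<Longrightarrow> Dom C h = N i \<Longrightarrow> Cod C h = N j
    \<Longrightarrow> h = Zero C (N i) (N j)"
  using hom_zero unfolding pairwise_hom_zero_def by (metis hom_set_iff singletonD)

text \<open>The matrix of \<open>h\<close> is diagonal. Both sides are compared on each injection:
  the off-diagonal entries vanish and the diagonal ones agree.\<close>

lemma proj_endo:
  assumes h: "h \<in> hom_set C M M" and i: "i \<in> I"
  shows "\<pi> i \<cdot> h = \<pi> i \<cdot> (h \<cdot> \<iota> i) \<cdot> \<pi> i"
proof (rule inj_jointly_epic)
  fix j
  assume j: "j \<in> I"
  show "\<pi> i \<cdot> h \<cdot> \<iota> j = \<pi> i \<cdot> (h \<cdot> \<iota> i) \<cdot> \<pi> i \<cdot> \<iota> j"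
  proof (cases "i = j")
    case True
    then show ?thesis
      using h i by (simp add: assoc)
  next
    case False
    then have "\<pi> i \<cdot> (h \<cdot> \<iota> j) = Zero C (N j) (N i)"
      using h i j by (intro off_diagonal_Zero) auto
    then show ?thesis
      using False h i j by (simp add: assoc proj_inj_Zero)
  qed
qed (use h i in auto)

text \<open>Companion of \<open>proj_endo\<close> for columns in place of rows, checked after each
  projection.\<close>

lemma endo_inj:
  assumes h: "h \<in> hom_set C M M" and i: "i \<in> I"
  shows "h \<cdot> \<iota> i = \<iota> i \<cdot> (\<pi> i \<cdot> (h \<cdot> \<iota> i))"
proof (rule proj_jointly_monic)
  fix j
  assume j: "j \<in> I"
  show "\<pi> j \<cdot> (h \<cdot> \<iota> i) = \<pi> j \<cdot> (\<iota> i \<cdot> (\<pi> i \<cdot> (h \<cdot> \<iota> i)))"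
  proof (cases "i = j")
    case True
    then show ?thesis
      using h i by simp
  next
    case False
    then have "\<pi> j \<cdot> (h \<cdot> \<iota> i) = Zero C (N i) (N j)"
      using h i j by (intro off_diagonal_Zero) auto
    then show ?thesis
      using False h i j reassoc [OF proj_inj_Zero [of j i], of "\<pi> i \<cdot> (h \<cdot> \<iota> i)"] by simp
  qed
qed (use h i in auto)

lemma endo_eqI:
  assumes "g \<in> hom_set C M M" "h \<in> hom_set C M M"
    and "\<And>i. i \<in> I \<Longrightarrow> \<pi> i \<cdot> (g \<cdot> \<iota> i) = \<pi> i \<cdot> (h \<cdot> \<iota> i)"
  shows "g = h"
  by (rule proj_jointly_monic) (use assms proj_endo in auto)

lemma CS_idempotent_direct_sum:
  assumes AB: "AB3_star U C" "\<Lambda> \<in> U"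
    and f: "\<And>l. l \<in> \<Lambda> \<Longrightarrow> f l \<in> hom_set C M M"
    and e: "\<And>i. i \<in> I \<Longrightarrow> CS_idempotent C (N i) \<Lambda> (\<lambda>l. \<pi> i \<cdot> (f l \<cdot> \<iota> i)) (e i)"
    and h: "h \<in> hom_set C M M" "\<And>i. i \<in> I \<Longrightarrow> \<pi> i \<cdot> h = e i \<cdot> \<pi> i"
  shows "CS_idempotent C M \<Lambda> f h"
proof (rule CS_idempotentI)
  show [simp]: "h \<in> Arr C" "Dom C h = M" "Cod C h = M"
    using h by simp_all
  have [simp]: "f l \<in> Arr C" "Dom C (f l) = M" "Cod C (f l) = M" if "l \<in> \<Lambda>" for l
    using f that by simp_all
  note e_arr [simp] = CS_idempotentD(1-3) [OF e]
  define F where "F i l = \<pi> i \<cdot> (f l \<cdot> \<iota> i)" for i l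
  have F [simp]: "F i l \<in> Arr C" "Dom C (F i l) = N i" "Cod C (F i l) = N i" if "i \<in> I" "l \<in> \<Lambda>" for i l
    using that by (simp_all add: F_def)
  have proj_h: "\<pi> i \<cdot> (h \<cdot> y) = e i \<cdot> (\<pi> i \<cdot> y)" if "i \<in> I" "y \<in> Arr C" "Cod C y = M" for i y
    using that h(2) [of i] by (simp flip: assoc)
  \<comment> \<open>Diagonality of \<open>f l\<close> enters here: a component of
    \<open>f l \<cdot> y\<close> depends only on the same component of \<open>y\<close>.\<close>
  have proj_f: "\<pi> i \<cdot> (f l \<cdot> y) = F i l \<cdot> (\<pi> i \<cdot> y)"
    if "i \<in> I" "l \<in> \<Lambda>" "y \<in> Arr C" "Cod C y = M" for i l y
    using that proj_endo [OF f, of l i] by (simp add: F_def flip: assoc)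
  show "h \<cdot> h = h"
  proof (rule proj_jointly_monic)
    fix i assume i: "i \<in> I"
    show "\<pi> i \<cdot> (h \<cdot> h) = \<pi> i \<cdot> h"
      using i h(2) [OF i] reassoc [OF CS_idempotentD(4) [OF e [OF i]], of "\<pi> i"] by (simp add: proj_h)
  qed auto
  show "h \<cdot> y = y"
    if y: "y \<in> Arr C" "Cod C y = M" "\<And>l. l \<in> \<Lambda> \<Longrightarrow> f l \<cdot> y = Zero C (Dom C y) M" for y
  proof (rule proj_jointly_monic)
    fix i assume i: "i \<in> I"
    have "e i \<cdot> (\<pi> i \<cdot> y) = \<pi> i \<cdot> y"
    proof (rule CS_idempotentD(5) [OF e [OF i]], goal_cases)
      case (3 l)
      then show ?case
        using proj_f [of i l y] y i by (simp flip: F_def)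
    qed (use y i in auto)
    then show "\<pi> i \<cdot> (h \<cdot> y) = \<pi> i \<cdot> y"
      using i y by (simp add: proj_h)
  qed (use y in auto)
  \<comment> \<open>Induction on J: restricting x to the subobject on which the components at j vanish removes j
    from the condition, so this subobject is zero; then x is already monic after projection to N j.\<close>
  have ess: "x = Zero C (Dom C x) M"
    if "J \<subseteq> I" "monic C x" "Cod C x = M" "h \<cdot> x = x"
      "\<And>y. y \<in> Arr C \<Longrightarrow> Cod C y = Dom C x \<Longrightarrow>
        (\<And>i l. i \<in> J \<Longrightarrow> l \<in> \<Lambda> \<Longrightarrow> F i l \<cdot> (\<pi> i \<cdot> (x \<cdot> y)) = Zero C (Dom C y) (N i)) \<Longrightarrow>
        x \<cdot> y = Zero C (Dom C y) M" for J x
    using finite_subset [OF that(1) finite_I] that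
  proof (induction J arbitrary: x)
    \<comment> \<open>With \<open>J\<close> empty nothing is required of \<open>y\<close>, so it may
      be the identity.\<close>
    case empty
    then show ?case
      using empty.prems(5) [of "Ident C (Dom C x)"] monicD(1) [of C x] by simp
  next
    case (insert j J)
    note x_arr [simp] = monicD(1) [OF insert.prems(2)] insert.prems(3)
    have [simp]: "j \<in> I"
      using insert by auto
    have "F j l \<cdot> (\<pi> j \<cdot> x) \<in> hom_set C (Dom C x) (N j)" if "l \<in> \<Lambda>" for l
      using that by simp
    then obtain k where k: "monic C k" "k \<in> Arr C" "Cod C k = Dom C x"
      "\<And>l. l \<in> \<Lambda> \<Longrightarrow> F j l \<cdot> (\<pi> j \<cdot> x) \<cdot> k = Zero C (Dom C k) (N j)"
      "\<And>y. y \<in> Arr C \<Longrightarrow> Cod C y = Dom C x \<Longrightarrow>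
        (\<And>l. l \<in> \<Lambda> \<Longrightarrow> F j l \<cdot> (\<pi> j \<cdot> x) \<cdot> y = Zero C (Dom C y) (N j))
        \<Longrightarrow> \<exists>u\<in>Arr C. Dom C u = Dom C y \<and> Cod C u = Dom C k \<and> k \<cdot> u = y"
      by (rule joint_kernel [OF AB, rotated 2]) auto
    have "x \<cdot> k = Zero C (Dom C (x \<cdot> k)) M"
    proof (rule insert.IH)
      show "h \<cdot> (x \<cdot> k) = x \<cdot> k"
        using k insert.prems(4) by (simp flip: assoc)
      fix y
      assume y: "y \<in> Arr C" "Cod C y = Dom C (x \<cdot> k)"
        "\<And>i l. i \<in> J \<Longrightarrow> l \<in> \<Lambda> \<Longrightarrow> F i l \<cdot> (\<pi> i \<cdot> (x \<cdot> k \<cdot> y)) = Zero C (Dom C y) (N i)"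
      have "x \<cdot> (k \<cdot> y) = Zero C (Dom C (k \<cdot> y)) M"
      proof (rule insert.prems(5))
        fix i l
        assume i: "i \<in> insert j J" and l: "l \<in> \<Lambda>"
        have "F j l \<cdot> (\<pi> j \<cdot> x) \<cdot> k \<cdot> y = Zero C (Dom C y) (N j)"
          using k(4) [OF l] y k(2,3) by simp
        then show "F i l \<cdot> (\<pi> i \<cdot> (x \<cdot> (k \<cdot> y))) = Zero C (Dom C (k \<cdot> y)) (N i)"
          using i l y k(2,3) insert.prems(1) by (auto simp: assoc)
      qed (use y k in auto)
      then show "x \<cdot> k \<cdot> y = Zero C (Dom C y) M"
        using y k by (simp add: assoc)
    qed (use insert.prems k monic_Comp in auto)
    then have k0: "k = Zero C (Dom C k) (Dom C x)"
      using monic_Comp_eq_Zero [OF insert.prems(2), of k] k by simp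
    \<comment> \<open>Since the joint kernel \<open>k\<close> is zero, this serves three purposes:
      it makes \<open>\<pi> j \<cdot> x\<close> monic, it gives the premise of essentiality in
      \<open>N j\<close>, and, with the identity for \<open>y\<close>, it deduces that
      \<open>x\<close> is zero from the vanishing of \<open>\<pi> j \<cdot> x\<close>.\<close>
    have zero: "y = Zero C (Dom C y) (Dom C x)"
      if y: "y \<in> Arr C" "Cod C y = Dom C x"
        "\<And>l. l \<in> \<Lambda> \<Longrightarrow> F j l \<cdot> (\<pi> j \<cdot> (x \<cdot> y)) = Zero C (Dom C y) (N j)" for y
    proof -
      obtain u where u: "u \<in> Arr C" "Dom C u = Dom C y" "Cod C u = Dom C k" "k \<cdot> u = y"
        using k(5) [of y] y by (auto simp: assoc)
      have "Zero C (Dom C k) (Dom C x) \<cdot> u = Zero C (Dom C y) (Dom C x)"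
        using u by simp
      then show ?thesis
        using k0 u(4) by simp
    qed
    have "\<pi> j \<cdot> x = Zero C (Dom C (\<pi> j \<cdot> x)) (N j)"
    proof (rule CS_idempotentD(6) [OF e])
      show "monic C (\<pi> j \<cdot> x)"
      proof (rule monicI)
        fix A z
        assume "z \<in> Arr C" "Dom C z = A" "Cod C z = Dom C (\<pi> j \<cdot> x)"
          "\<pi> j \<cdot> x \<cdot> z = Zero C A (Cod C (\<pi> j \<cdot> x))"
        then show "z = Zero C A (Dom C (\<pi> j \<cdot> x))"
          using zero [of z] by (auto simp: assoc)
      qed auto
      show "e j \<cdot> (\<pi> j \<cdot> x) = \<pi> j \<cdot> x"
        using insert.prems(4) proj_h [of j x] by simp
      fix y
      assume y: "y \<in> Arr C" "Cod C y = Dom C (\<pi> j \<cdot> x)"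
        "\<And>l. l \<in> \<Lambda> \<Longrightarrow> \<pi> j \<cdot> (f l \<cdot> \<iota> j) \<cdot> (\<pi> j \<cdot> x \<cdot> y) = Zero C (Dom C y) (N j)"
      then have "y = Zero C (Dom C y) (Dom C x)"
        by (intro zero) (auto simp: assoc F_def)
      then show "\<pi> j \<cdot> x \<cdot> y = Zero C (Dom C y) (N j)"
        using y(1) Comp_Zero [of "\<pi> j \<cdot> x" "Dom C x" "Dom C y"] by simp
    qed auto
    then have "Ident C (Dom C x) = Zero C (Dom C x) (Dom C x)"
      using zero [of "Ident C (Dom C x)"] by simp
    then show ?case
      using Comp_Ident_simp [of x "Dom C x"] by simp
  qed
  show "x = Zero C (Dom C x) M"
    if x: "monic C x" "Cod C x = M" "h \<cdot> x = x"
      "\<And>y. y \<in> Arr C \<Longrightarrow> Cod C y = Dom C x \<Longrightarrow>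
        (\<And>l. l \<in> \<Lambda> \<Longrightarrow> f l \<cdot> (x \<cdot> y) = Zero C (Dom C y) M) \<Longrightarrow> x \<cdot> y = Zero C (Dom C y) M" for x
  proof (rule ess [OF subset_refl x(1-3)])
    note [simp] = monicD(1) [OF x(1)] x(2)
    fix y
    assume y: "y \<in> Arr C" "Cod C y = Dom C x"
      "\<And>i l. i \<in> I \<Longrightarrow> l \<in> \<Lambda> \<Longrightarrow> F i l \<cdot> (\<pi> i \<cdot> (x \<cdot> y)) = Zero C (Dom C y) (N i)"
    show "x \<cdot> y = Zero C (Dom C y) M"
    proof (rule x(4) [OF y(1,2)], rule proj_jointly_monic)
      fix l i
      assume "l \<in> \<Lambda>" "i \<in> I"
      then show "\<pi> i \<cdot> (f l \<cdot> (x \<cdot> y)) = \<pi> i \<cdot> Zero C (Dom C y) M"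
        using y by (simp add: proj_f)
    qed (use y in auto)
  qed
qed

text \<open>The \<open>g l\<close> are extended by zero to M. As no nonzero arrow leads from
  \<open>N i\<close> to another summand, \<open>e\<close> maps \<open>N i\<close> into itself; so
  its corner at i is idempotent, and both clauses can be tested on arrows composed with
  \<open>\<iota> i\<close>.\<close>

lemma CS_idempotent_component:
  assumes i [simp]: "i \<in> I"
    and g: "\<And>l. l \<in> \<Lambda> \<Longrightarrow> g l \<in> hom_set C (N i) (N i)"
    and e: "CS_idempotent C M \<Lambda> (\<lambda>l. \<iota> i \<cdot> (g l \<cdot> \<pi> i)) e"
  shows "CS_idempotent C (N i) \<Lambda> g (\<pi> i \<cdot> (e \<cdot> \<iota> i))"
proof (rule CS_idempotentI)
  note [simp] = CS_idempotentD(1-3) [OF e]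
  have [simp]: "g l \<in> Arr C" "Dom C (g l) = N i" "Cod C (g l) = N i" if "l \<in> \<Lambda>" for l
    using g that by simp_all
  let ?e = "\<pi> i \<cdot> (e \<cdot> \<iota> i)"
  have e\<iota>: "e \<cdot> (\<iota> i \<cdot> y) = \<iota> i \<cdot> (?e \<cdot> y)" if "y \<in> Arr C" "Cod C y = N i" for y
  proof -
    have "e \<cdot> (\<iota> i \<cdot> y) = \<iota> i \<cdot> ?e \<cdot> y"
      using that endo_inj [of e i] by (intro reassoc) auto
    also have "\<dots> = \<iota> i \<cdot> (?e \<cdot> y)"
      using that by (intro assoc) auto
    finally show ?thesis .
  qed
  have f\<iota>: "\<iota> i \<cdot> (g l \<cdot> \<pi> i) \<cdot> (\<iota> i \<cdot> y) = \<iota> i \<cdot> (g l \<cdot> y)"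
    if "l \<in> \<Lambda>" "y \<in> Arr C" "Cod C y = N i" for l y
    using that by (simp add: assoc)
  show "?e \<in> Arr C" "Dom C ?e = N i" "Cod C ?e = N i"
    by simp_all
  have "?e \<cdot> ?e = \<pi> i \<cdot> (e \<cdot> (\<iota> i \<cdot> ?e))"
    by (simp add: assoc)
  also have "\<dots> = \<pi> i \<cdot> (e \<cdot> (e \<cdot> \<iota> i))"
    using endo_inj [of e i] by simp
  also have "\<dots> = ?e"
    using reassoc [OF CS_idempotentD(4) [OF e], of "\<iota> i"] by simp
  finally show "?e \<cdot> ?e = ?e" .
  show "?e \<cdot> y = y"
    if y: "y \<in> Arr C" "Cod C y = N i" "\<And>l. l \<in> \<Lambda> \<Longrightarrow> g l \<cdot> y = Zero C (Dom C y) (N i)" for y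
  proof -
    have "e \<cdot> (\<iota> i \<cdot> y) = \<iota> i \<cdot> y"
      by (rule CS_idempotentD(5) [OF e]) (use y in \<open>auto simp: f\<iota>\<close>)
    then show ?thesis
      using y by (simp add: assoc)
  qed
  show "x = Zero C (Dom C x) (N i)"
    if x: "monic C x" "Cod C x = N i" "?e \<cdot> x = x"
      "\<And>y. y \<in> Arr C \<Longrightarrow> Cod C y = Dom C x \<Longrightarrow>
        (\<And>l. l \<in> \<Lambda> \<Longrightarrow> g l \<cdot> (x \<cdot> y) = Zero C (Dom C y) (N i)) \<Longrightarrow>
        x \<cdot> y = Zero C (Dom C y) (N i)" for x
  proof -
    note [simp] = monicD(1) [OF x(1)] x(2)
    have \<iota>: "monic C (\<iota> i)"
      by (rule split_monic [OF proj_inj [OF i]]) auto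
    have "\<iota> i \<cdot> x = Zero C (Dom C (\<iota> i \<cdot> x)) M"
    proof (rule CS_idempotentD(6) [OF e])
      show "monic C (\<iota> i \<cdot> x)"
        using \<iota> x by (intro monic_Comp) auto
      show "e \<cdot> (\<iota> i \<cdot> x) = \<iota> i \<cdot> x"
        using x(3) by (simp add: e\<iota>)
      fix y
      assume y: "y \<in> Arr C" "Cod C y = Dom C (\<iota> i \<cdot> x)"
        "\<And>l. l \<in> \<Lambda> \<Longrightarrow> \<iota> i \<cdot> (g l \<cdot> \<pi> i) \<cdot> (\<iota> i \<cdot> x \<cdot> y) = Zero C (Dom C y) M"
      have "x \<cdot> y = Zero C (Dom C y) (N i)"
      proof (rule x(4))
        fix l assume l: "l \<in> \<Lambda>"
        then have "\<iota> i \<cdot> (g l \<cdot> (x \<cdot> y)) = Zero C (Dom C y) M"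
          using y(1,2) y(3) [OF l] by (simp add: assoc)
        then show "g l \<cdot> (x \<cdot> y) = Zero C (Dom C y) (N i)"
          using monic_Comp_eq_Zero [OF \<iota>, of "g l \<cdot> (x \<cdot> y)"] y(1,2) l by simp
      qed (use y in auto)
      then show "\<iota> i \<cdot> x \<cdot> y = Zero C (Dom C y) M"
        using y by (simp add: assoc)
    qed auto
    then show ?thesis
      using monic_Comp_eq_Zero [OF \<iota>, of x] by simp
  qed
qed

theorem CS_Baer_idem_direct_sum:
  assumes AB: "AB3_star U C"
  shows "CS_Baer_idem U C M \<longleftrightarrow> (\<forall>i\<in>I. CS_Baer_idem U C (N i))"
proof (intro iffI ballI)
  fix i
  assume M: "CS_Baer_idem U C M" and i: "i \<in> I"
  show "CS_Baer_idem U C (N i)"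
    unfolding CS_Baer_idem_def
  proof (intro ballI allI impI)
    fix \<Lambda> g
    assume \<Lambda>: "\<Lambda> \<in> U" and g: "\<forall>l\<in>\<Lambda>. g l \<in> hom_set C (N i) (N i)"
    then have "\<forall>l\<in>\<Lambda>. \<iota> i \<cdot> (g l \<cdot> \<pi> i) \<in> hom_set C M M"
      using i by simp
    then obtain e where "CS_idempotent C M \<Lambda> (\<lambda>l. \<iota> i \<cdot> (g l \<cdot> \<pi> i)) e"
      using M \<Lambda> unfolding CS_Baer_idem_def by meson
    then show "\<exists>e. CS_idempotent C (N i) \<Lambda> g e"
      using CS_idempotent_component [OF i, of \<Lambda> g e] g by blast
  qed
next
  assume N: "\<forall>i\<in>I. CS_Baer_idem U C (N i)"
  show "CS_Baer_idem U C M"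
    unfolding CS_Baer_idem_def
  proof (intro ballI allI impI)
    fix \<Lambda> f
    assume \<Lambda>: "\<Lambda> \<in> U" and f: "\<forall>l\<in>\<Lambda>. f l \<in> hom_set C M M"
    have "\<exists>e. CS_idempotent C (N i) \<Lambda> (\<lambda>l. \<pi> i \<cdot> (f l \<cdot> \<iota> i)) e" if "i \<in> I" for i
      using N \<Lambda> f that unfolding CS_Baer_idem_def by simp
    then obtain e where e: "\<And>i. i \<in> I \<Longrightarrow> CS_idempotent C (N i) \<Lambda> (\<lambda>l. \<pi> i \<cdot> (f l \<cdot> \<iota> i)) (e i)"
      by metis
    obtain h where "h \<in> hom_set C M M" "\<And>i. i \<in> I \<Longrightarrow> \<pi> i \<cdot> h = e i \<cdot> \<pi> i"
      using diagonal_exists [of e] CS_idempotentD(1-3) [OF e] by (metis hom_set_iff)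
    then show "\<exists>e. CS_idempotent C M \<Lambda> f e"
      using CS_idempotent_direct_sum [OF AB \<Lambda> _ e] f by blast
  qed
qed

text \<open>The idempotents are those of the plain case, and only invariance has to be carried over.
  Towards \<open>N i\<close>, an endomorphism is extended by zero and the equation is cut down to
  the corner. Towards M, all endomorphisms are diagonal, so the equation is compared entry by
  entry.\<close>

lemma strongly_CS_Baer_idem_direct_sum_if_hom_zero:
  assumes AB: "AB3_star U C"
  shows "strongly_CS_Baer_idem U C M \<longleftrightarrow> (\<forall>i\<in>I. strongly_CS_Baer_idem U C (N i))"
proof (intro iffI ballI)
  fix i
  assume M: "strongly_CS_Baer_idem U C M" and i [simp]: "i \<in> I"
  show "strongly_CS_Baer_idem U C (N i)"
    unfolding strongly_CS_Baer_idem_def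
  proof (intro ballI allI impI)
    fix \<Lambda> g
    assume \<Lambda>: "\<Lambda> \<in> U" and g: "\<forall>l\<in>\<Lambda>. g l \<in> hom_set C (N i) (N i)"
    then have "\<forall>l\<in>\<Lambda>. \<iota> i \<cdot> (g l \<cdot> \<pi> i) \<in> hom_set C M M"
      by simp
    then obtain e where e: "CS_idempotent C M \<Lambda> (\<lambda>l. \<iota> i \<cdot> (g l \<cdot> \<pi> i)) e"
      and inv: "\<And>h. h \<in> hom_set C M M \<Longrightarrow> h \<cdot> e = e \<cdot> (h \<cdot> e)"
      using M \<Lambda> unfolding strongly_CS_Baer_idem_def by meson
    note [simp] = CS_idempotentD(1-3) [OF e]
    let ?e = "\<pi> i \<cdot> (e \<cdot> \<iota> i)"
    have "h \<cdot> ?e = ?e \<cdot> (h \<cdot> ?e)" if h: "h \<in> hom_set C (N i) (N i)" for h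
    proof -
      have [simp]: "h \<in> Arr C" "Dom C h = N i" "Cod C h = N i"
        using h by simp_all
      let ?h = "\<iota> i \<cdot> (h \<cdot> \<pi> i)"
      have "?h \<cdot> e \<cdot> \<iota> i = e \<cdot> (?h \<cdot> e) \<cdot> \<iota> i"
        using inv [of ?h] by simp
      then have "\<pi> i \<cdot> (?h \<cdot> e \<cdot> \<iota> i) = \<pi> i \<cdot> (e \<cdot> (?h \<cdot> e) \<cdot> \<iota> i)"
        by simp
      then show ?thesis
        by (simp add: assoc)
    qed
    then show "\<exists>e. CS_idempotent C (N i) \<Lambda> g e \<and> (\<forall>h\<in>hom_set C (N i) (N i). h \<cdot> e = e \<cdot> (h \<cdot> e))"
      using CS_idempotent_component [OF i, of \<Lambda> g e] g e by blast
  qed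
next
  assume N: "\<forall>i\<in>I. strongly_CS_Baer_idem U C (N i)"
  show "strongly_CS_Baer_idem U C M"
    unfolding strongly_CS_Baer_idem_def
  proof (intro ballI allI impI)
    fix \<Lambda> f
    assume \<Lambda>: "\<Lambda> \<in> U" and f: "\<forall>l\<in>\<Lambda>. f l \<in> hom_set C M M"
    have "\<exists>e. CS_idempotent C (N i) \<Lambda> (\<lambda>l. \<pi> i \<cdot> (f l \<cdot> \<iota> i)) e \<and>
        (\<forall>h\<in>hom_set C (N i) (N i). h \<cdot> e = e \<cdot> (h \<cdot> e))" if "i \<in> I" for i
      using N \<Lambda> f that unfolding strongly_CS_Baer_idem_def by simp
    then obtain e where e: "\<And>i. i \<in> I \<Longrightarrow> CS_idempotent C (N i) \<Lambda> (\<lambda>l. \<pi> i \<cdot> (f l \<cdot> \<iota> i)) (e i)"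
      and inv: "\<And>i h. i \<in> I \<Longrightarrow> h \<in> hom_set C (N i) (N i) \<Longrightarrow> h \<cdot> e i = e i \<cdot> (h \<cdot> e i)"
      by metis
    note [simp] = CS_idempotentD(1-3) [OF e]
    obtain k where k: "k \<in> hom_set C M M" and proj_k: "\<And>i. i \<in> I \<Longrightarrow> \<pi> i \<cdot> k = e i \<cdot> \<pi> i"
      using diagonal_exists [of e] CS_idempotentD(1-3) [OF e] by (metis hom_set_iff)
    have [simp]: "k \<in> Arr C" "Dom C k = M" "Cod C k = M"
      using k by simp_all
    have "h \<cdot> k = k \<cdot> (h \<cdot> k)" if h: "h \<in> hom_set C M M" for h
    proof (rule endo_eqI)
      fix i
      assume i [simp]: "i \<in> I"
      have [simp]: "h \<in> Arr C" "Dom C h = M" "Cod C h = M"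
        using h by simp_all
      let ?h = "\<pi> i \<cdot> (h \<cdot> \<iota> i)"
      have \<pi>h: "\<pi> i \<cdot> (h \<cdot> y) = ?h \<cdot> (\<pi> i \<cdot> y)" if "y \<in> Arr C" "Cod C y = M" for y
        using that proj_endo [OF h i] reassoc [OF refl, of y h "\<pi> i"] by (simp add: assoc)
      have \<pi>k: "\<pi> i \<cdot> (k \<cdot> y) = e i \<cdot> (\<pi> i \<cdot> y)" if "y \<in> Arr C" "Cod C y = M" for y
        using that proj_k [OF i] reassoc [OF proj_k [OF i], of y] by (simp add: assoc)
      have "\<pi> i \<cdot> (h \<cdot> (k \<cdot> \<iota> i)) = ?h \<cdot> e i"
        by (subst \<pi>h) (simp_all add: \<pi>k)
      moreover have "\<pi> i \<cdot> (k \<cdot> (h \<cdot> (k \<cdot> \<iota> i))) = e i \<cdot> (?h \<cdot> e i)"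
        by (subst \<pi>k, simp, simp, subst \<pi>h) (simp_all add: \<pi>k)
      ultimately show "\<pi> i \<cdot> (h \<cdot> k \<cdot> \<iota> i) = \<pi> i \<cdot> (k \<cdot> (h \<cdot> k) \<cdot> \<iota> i)"
        using inv [of i ?h] by (simp add: assoc)
    qed (use h in auto)
    then show "\<exists>e. CS_idempotent C M \<Lambda> f e \<and> (\<forall>h\<in>hom_set C M M. h \<cdot> e = e \<cdot> (h \<cdot> e))"
      using CS_idempotent_direct_sum [OF AB \<Lambda> _ e k proj_k] f by blast
  qed
qed

end

text \<open>
  The kernel of the complement of the idempotent \<iota> i \<cdot> \<pi> i is N i, which is essential in a fully
  invariant direct summand. A direct summand has no proper essential extension in M, so N i itself
  is fully invariant.
\<close>

lemma strongly_CS_Baer_idem_imp_hom_zero: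
  fixes U :: "'l set set"
  assumes U: "index_universe U" and M: "strongly_CS_Baer_idem U C M"
  shows "pairwise_hom_zero C I N"
  unfolding pairwise_hom_zero_def
proof (intro ballI impI)
  fix i j
  assume i [simp]: "i \<in> I" and j [simp]: "j \<in> I" and ij: "i \<noteq> j"
  let ?\<epsilon> = "\<iota> i \<cdot> \<pi> i"
  have \<epsilon>: "?\<epsilon> \<in> hom_set C M M" "?\<epsilon> \<cdot> ?\<epsilon> = ?\<epsilon>"
    by (simp_all add: assoc)
  obtain f where f: "f \<in> hom_set C M M" "f \<cdot> f = f" "?\<epsilon> \<cdot> f = Zero C M M" "f \<cdot> ?\<epsilon> = Zero C M M"
    "\<And>y. y \<in> Arr C \<Longrightarrow> Cod C y = M \<Longrightarrow> ?\<epsilon> \<cdot> y = y \<longleftrightarrow> f \<cdot> y = Zero C (Dom C y) M"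
    "\<And>y. y \<in> Arr C \<Longrightarrow> Cod C y = M \<Longrightarrow> Plus C (?\<epsilon> \<cdot> y) (f \<cdot> y) = y"
    "\<And>y. y \<in> Arr C \<Longrightarrow> Dom C y = M \<Longrightarrow> Plus C (y \<cdot> ?\<epsilon>) (y \<cdot> f) = y"
    by (rule complement [OF \<epsilon>]) blast
  have [simp]: "f \<in> Arr C" "Dom C f = M" "Cod C f = M"
    using f by simp_all
  \<comment> \<open>A family with the single member \<open>f\<close>; \<open>undefined\<close>
    stands for some index, and finite index sets lie in \<open>U\<close>.\<close>
  have "{undefined :: 'l} \<in> U"
    using U by (simp add: index_universe_def)
  then obtain e where e: "CS_idempotent C M {undefined :: 'l} (\<lambda>_. f) e"
    and inv: "\<And>h. h \<in> hom_set C M M \<Longrightarrow> h \<cdot> e = e \<cdot> (h \<cdot> e)"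
    using M [unfolded strongly_CS_Baer_idem_def, rule_format, of "{undefined :: 'l}" "\<lambda>_. f"] f(1) by blast
  note [simp] = CS_idempotentD(1-3) [OF e]
  have ee: "e \<cdot> e = e"
    by (rule CS_idempotentD(4) [OF e])
  have "f \<cdot> \<iota> i = Zero C (N i) M"
    using f(5) [of "\<iota> i"] by (simp add: assoc)
  then have e\<iota>: "e \<cdot> \<iota> i = \<iota> i"
    by (intro CS_idempotentD(5) [OF e]) auto
  then have e\<epsilon>: "e \<cdot> ?\<epsilon> = ?\<epsilon>"
    by (simp flip: assoc)
  \<comment> \<open>Because \<open>e\<close> fixes \<open>?\<epsilon>\<close>, the image of
    \<open>e\<close> is the direct sum of \<open>N i\<close> and the image of \<open>?t\<close>. The
    aim is to show that this second part is zero.\<close>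
  let ?t = "f \<cdot> e"
  have "f \<cdot> (Plus C (e \<cdot> ?\<epsilon>) (e \<cdot> f)) = f \<cdot> e"
    by (subst f(7)) auto
  moreover have "f \<cdot> (Plus C (e \<cdot> ?\<epsilon>) (e \<cdot> f)) = f \<cdot> (e \<cdot> f)"
    using e\<epsilon> f(4) by (subst Plus_Comp_distrib) simp_all
  ultimately have fef: "f \<cdot> (e \<cdot> f) = f \<cdot> e"
    by simp
  have tt: "?t \<cdot> ?t = ?t"
    using reassoc [OF fef, of e] ee by (simp add: assoc)
  have et: "e \<cdot> ?t = ?t"
  proof (rule Plus_left_cancel)
    have "Plus C (?\<epsilon> \<cdot> e) (e \<cdot> ?t) = Plus C (e \<cdot> ?\<epsilon> \<cdot> e) (e \<cdot> f \<cdot> e)"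
      by (subst e\<epsilon>) (simp add: assoc)
    also have "\<dots> = Plus C (e \<cdot> ?\<epsilon>) (e \<cdot> f) \<cdot> e"
      by (rule Comp_Plus_distrib [symmetric]) simp_all
    also have "\<dots> = e"
      using f(7) [of e] ee by simp
    also have "\<dots> = Plus C (?\<epsilon> \<cdot> e) ?t"
      by (rule f(6) [symmetric]) simp_all
    finally show "Plus C (?\<epsilon> \<cdot> e) (e \<cdot> ?t) = Plus C (?\<epsilon> \<cdot> e) ?t" .
  qed simp_all
  obtain X d p where dp: "d \<in> hom_set C X M" "p \<in> hom_set C M X" "p \<cdot> d = Ident C X" "d \<cdot> p = ?t"
    using split_idempotent [OF _ tt, of M] by auto
  have [simp]: "d \<in> Arr C" "Dom C d = X" "Cod C d = M" "p \<in> Arr C" "Dom C p = M" "Cod C p = X" "X \<in> Obj C"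
    using dp Dom_Obj [of d] by simp_all
  have td: "?t \<cdot> d = d"
    using dp(3) by (simp add: assoc flip: dp(4))
  have \<epsilon>t: "?\<epsilon> \<cdot> ?t = Zero C M M"
    using reassoc [OF f(3), of e] by simp
  \<comment> \<open>The image \<open>d\<close> of \<open>?t\<close> lies in the image of
    \<open>e\<close>. An arrow into it that \<open>f\<close> kills is fixed by
    \<open>?\<epsilon>\<close>, but \<open>?\<epsilon>\<close> also kills \<open>d\<close>; so
    \<open>d\<close> meets \<open>N i\<close> in zero and essentiality applies.\<close>
  have "d = Zero C (Dom C d) M"
  proof (rule CS_idempotentD(6) [OF e])
    show "monic C d"
      by (rule split_monic [OF dp(3)]) auto
    show "e \<cdot> d = d"
      using td reassoc [OF et, of d] by simp
    fix y
    assume y: "y \<in> Arr C" "Cod C y = Dom C d" and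
      "\<And>l. l \<in> {undefined :: 'l} \<Longrightarrow> f \<cdot> (d \<cdot> y) = Zero C (Dom C y) M"
    then have "?\<epsilon> \<cdot> (d \<cdot> y) = d \<cdot> y"
      using f(5) [of "d \<cdot> y"] y by simp
    moreover have "?\<epsilon> \<cdot> d = Zero C X M"
      using reassoc [OF \<epsilon>t, of d] td by simp
    then have "?\<epsilon> \<cdot> (d \<cdot> y) = Zero C (Dom C y) M"
      using reassoc [of ?\<epsilon> d _ y] y by simp
    ultimately show "d \<cdot> y = Zero C (Dom C y) M"
      by simp
  qed simp
  then have "?t = Zero C M M"
    using dp(4) Zero_Comp [of p X M] by simp
  then have \<epsilon>e: "?\<epsilon> \<cdot> e = e"
    using f(5) [of e] by simp
  \<comment> \<open>Extended by zero, \<open>g\<close> becomes an endomorphism of M. Full invariance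
    puts \<open>\<iota> j \<cdot> g\<close> into the image of \<open>e\<close>, hence into
    \<open>N i\<close>, on which \<open>\<pi> j\<close> vanishes.\<close>
  have "g = Zero C (N i) (N j)" if g: "g \<in> hom_set C (N i) (N j)" for g
  proof -
    have [simp]: "g \<in> Arr C" "Dom C g = N i" "Cod C g = N j"
      using g by simp_all
    let ?h = "\<iota> j \<cdot> (g \<cdot> \<pi> i)"
    have "?h \<cdot> (e \<cdot> \<iota> i) = e \<cdot> (?h \<cdot> (e \<cdot> \<iota> i))"
    proof -
      have "?h \<cdot> e \<cdot> \<iota> i = e \<cdot> (?h \<cdot> e) \<cdot> \<iota> i"
        using inv [of ?h] by simp
      then show ?thesis
        by (simp add: assoc)
    qed
    then have "\<iota> j \<cdot> g = e \<cdot> (\<iota> j \<cdot> g)"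
      by (simp add: e\<iota> assoc)
    also have "\<dots> = ?\<epsilon> \<cdot> (e \<cdot> (\<iota> j \<cdot> g))"
      using reassoc [OF \<epsilon>e, of "\<iota> j \<cdot> g"] by simp
    finally have "\<pi> j \<cdot> (\<iota> j \<cdot> g) = \<pi> j \<cdot> (?\<epsilon> \<cdot> (e \<cdot> (\<iota> j \<cdot> g)))"
      by simp
    also have "\<dots> = Zero C (N i) (N j)"
      using reassoc [OF proj_inj_Zero [of j i], of "\<pi> i \<cdot> (e \<cdot> (\<iota> j \<cdot> g))"] ij by (simp add: assoc)
    finally show ?thesis
      by simp
  qed
  then show "hom_set C (N i) (N j) = {Zero C (N i) (N j)}"
    by auto
qed

theorem strongly_CS_Baer_idem_direct_sum:
  assumes "index_universe U" "AB3_star U C"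
  shows "strongly_CS_Baer_idem U C M \<longleftrightarrow>
    (\<forall>i\<in>I. strongly_CS_Baer_idem U C (N i)) \<and> pairwise_hom_zero C I N"
  using strongly_CS_Baer_idem_imp_hom_zero [OF assms(1)]
    strongly_CS_Baer_idem_direct_sum_if_hom_zero [OF _ assms(2)] by blast

end

section \<open>Self-CS-Baer objects\<close>

context abelian_category
begin

section \<open>Direct summands, the order on subobjects and full invariance as equations\<close>

lemma direct_summandD:
  assumes "direct_summand C M d"
  obtains p where "d \<in> Arr C" "Cod C d = M" "p \<in> hom_set C M (Dom C d)" "p \<cdot> d = Ident C (Dom C d)"
  using assms monicD(1) [of C d] unfolding direct_summand_def subobject_def is_biproduct_def by metis

text \<open>A retraction already provides the complementary summand: split the idempotent
  complementary to \<open>d \<cdot> p\<close>. The given \<open>p\<close> is kept as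
  projection.\<close>

lemma idempotent_direct_summand:
  assumes d: "d \<in> hom_set C D M" and p: "p \<in> hom_set C M D" "p \<cdot> d = Ident C D"
  obtains L j q where "direct_summand C M d" "is_biproduct C D L M d j p q"
proof -
  have [simp]: "d \<in> Arr C" "Dom C d = D" "Cod C d = M" "p \<in> Arr C" "Dom C p = M" "Cod C p = D"
    "M \<in> Obj C" "D \<in> Obj C"
    using d p Dom_Obj [of d] Cod_Obj [of d] by simp_all
  have "d \<cdot> p \<in> hom_set C M M" "d \<cdot> p \<cdot> (d \<cdot> p) = d \<cdot> p"
    using reassoc [OF p(2), of p] by (simp_all add: assoc)
  then obtain c where c: "c \<in> hom_set C M M" "Plus C (d \<cdot> p) c = Ident C M" "c \<cdot> c = c"
    using complement [of "d \<cdot> p" M] by metis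
  obtain L j q where jq: "j \<in> hom_set C L M" "q \<in> hom_set C M L" "q \<cdot> j = Ident C L" "j \<cdot> q = c"
    using split_idempotent [OF c(1,3)] by metis
  have b: "is_biproduct C D L M d j p q"
    using d p c jq by (simp add: is_biproduct_def)
  moreover have "monic C d"
    by (rule split_monic [OF p(2)]) auto
  moreover have "L \<in> Obj C"
    using jq Dom_Obj [of j] by simp
  ultimately have "direct_summand C M d"
    by (auto simp: direct_summand_def subobject_def)
  with b show thesis
    using that by blast
qed

lemma subobject_arr:
  assumes "subobject C M k"
  shows "k \<in> Arr C" "Cod C k = M" "monic C k" "M \<in> Obj C"
  using assms monicD(1) [of C k] Cod_Obj [of k] by (auto simp: subobject_def)

text \<open>Translates the order on subobjects into an equation. It reaches every subobject, since a
  monomorphism is the kernel of its cokernel.\<close>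

lemma sub_le_kernel_iff:
  assumes "is_kernel C f k" "x \<in> Arr C" "Cod C x = Dom C f"
  shows "sub_le C x k \<longleftrightarrow> f \<cdot> x = Zero C (Dom C x) (Cod C f)"
proof
  note k [simp] = kernelD [OF assms(1)]
  {
    assume "sub_le C x k"
    then obtain u where u: "u \<in> Arr C" "Dom C u = Dom C x" "Cod C u = Dom C k" "x = k \<cdot> u"
      by (auto simp: sub_le_def)
    then show "f \<cdot> x = Zero C (Dom C x) (Cod C f)"
      using reassoc [OF k(4), of u] by simp
  }
  assume "f \<cdot> x = Zero C (Dom C x) (Cod C f)"
  then obtain u where "u \<in> Arr C" "Dom C u = Dom C x" "Cod C u = Dom C k" "k \<cdot> u = x"
    using kernel_factor [OF assms] by blast
  then show "sub_le C x k"
    by (auto simp: sub_le_def)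
qed

text \<open>A restriction of \<open>h\<close> to \<open>D\<close>, if there is one, must be
  \<open>p \<cdot> (h \<cdot> d)\<close>. Its existence is therefore an equation, which can be
  written with the idempotent alone.\<close>

lemma fully_invariant_iff:
  assumes "d \<in> hom_set C D M" "p \<in> hom_set C M D" "p \<cdot> d = Ident C D"
  shows "fully_invariant C M d \<longleftrightarrow> (\<forall>h\<in>hom_set C M M. h \<cdot> (d \<cdot> p) = d \<cdot> p \<cdot> (h \<cdot> (d \<cdot> p)))"
proof -
  have [simp]: "d \<in> Arr C" "Dom C d = D" "Cod C d = M" "p \<in> Arr C" "Dom C p = M" "Cod C p = D"
    "M \<in> Obj C" "D \<in> Obj C"
    using assms Dom_Obj [of d] Cod_Obj [of d] by simp_all
  have sub: "subobject C M d"
    using split_monic [OF assms(3)] by (simp add: subobject_def)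
  show ?thesis
  proof
    assume inv: "fully_invariant C M d"
    show "\<forall>h\<in>hom_set C M M. h \<cdot> (d \<cdot> p) = d \<cdot> p \<cdot> (h \<cdot> (d \<cdot> p))"
    proof
      fix h
      assume h: "h \<in> hom_set C M M"
      then obtain \<alpha> where "\<alpha> \<in> hom_set C D D" and \<alpha>d: "h \<cdot> d = d \<cdot> \<alpha>"
        using inv unfolding fully_invariant_def \<open>Dom C d = D\<close> by blast
      then have \<alpha> [simp]: "\<alpha> \<in> Arr C" "Dom C \<alpha> = D" "Cod C \<alpha> = D"
        by simp_all
      have 1: "h \<cdot> (d \<cdot> p) = d \<cdot> (\<alpha> \<cdot> p)"
        using reassoc [OF \<alpha>d, of p] h by (simp add: assoc)
      show "h \<cdot> (d \<cdot> p) = d \<cdot> p \<cdot> (h \<cdot> (d \<cdot> p))"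
        unfolding 1 using reassoc [OF assms(3), of "\<alpha> \<cdot> p"] by (simp add: assoc)
    qed
  next
    assume inv: "\<forall>h\<in>hom_set C M M. h \<cdot> (d \<cdot> p) = d \<cdot> p \<cdot> (h \<cdot> (d \<cdot> p))"
    show "fully_invariant C M d"
      unfolding fully_invariant_def
    proof (intro conjI ballI sub)
      fix h
      assume h: "h \<in> hom_set C M M"
      then have "h \<cdot> (d \<cdot> p) \<cdot> d = d \<cdot> p \<cdot> (h \<cdot> (d \<cdot> p)) \<cdot> d"
        using inv by simp
      then have "h \<cdot> d = d \<cdot> (p \<cdot> (h \<cdot> d))"
        using h assms(3) by (simp add: assoc)
      then show "\<exists>\<alpha>\<in>hom_set C (Dom C d) (Dom C d). h \<cdot> d = d \<cdot> \<alpha>"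
        using h by (intro bexI [of _ "p \<cdot> (h \<cdot> d)"]) auto
    qed
  qed
qed

text \<open>Not only monomorphisms but all arrows factor through an intersection of kernels: pass to the image.\<close>

lemma intersection_Ker:
  assumes n: "is_intersection C M ((\<lambda>l. Ker C (f l)) ` \<Lambda>) n"
    and f: "\<And>l. l \<in> \<Lambda> \<Longrightarrow> f l \<in> hom_set C M M"
  shows "l \<in> \<Lambda> \<Longrightarrow> f l \<cdot> n = Zero C (Dom C n) M"
    and "y \<in> Arr C \<Longrightarrow> Cod C y = M \<Longrightarrow> (\<And>l. l \<in> \<Lambda> \<Longrightarrow> f l \<cdot> y = Zero C (Dom C y) M)
      \<Longrightarrow> \<exists>u\<in>Arr C. Dom C u = Dom C y \<and> Cod C u = Dom C n \<and> n \<cdot> u = y"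
proof -
  note [simp] = subobject_arr(1,2) [of M n]
  have sub [simp]: "subobject C M n"
    using n by (simp add: is_intersection_def)
  have f_arr [simp]: "f l \<in> Arr C" "Dom C (f l) = M" "Cod C (f l) = M" if "l \<in> \<Lambda>" for l
    using f that by simp_all
  show "f l \<cdot> n = Zero C (Dom C n) M" if "l \<in> \<Lambda>" for l
    using that n sub_le_kernel_iff [OF kernel_Ker, of "f l" n] by (simp add: is_intersection_def)
  assume y: "y \<in> Arr C" "Cod C y = M" "\<And>l. l \<in> \<Lambda> \<Longrightarrow> f l \<cdot> y = Zero C (Dom C y) M"
  note q = cokernel_Coker [OF y(1)]
  note [simp] = cokernelD(2,3) [OF q]
  have r: "is_kernel C (Coker C y) (Ker C (Coker C y))"
    by (rule kernel_Ker) simp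
  let ?r = "Ker C (Coker C y)"
  note [simp] = kernelD(2,3) [OF r]
  \<comment> \<open>As \<open>f l\<close> kills \<open>y\<close>, it factors through the cokernel of
    \<open>y\<close> and so kills the image \<open>?r\<close> as well.\<close>
  have "sub_le C ?r (Ker C (f l))" if l: "l \<in> \<Lambda>" for l
  proof -
    obtain t where t: "t \<in> Arr C" "Dom C t = Cod C (Coker C y)" "Cod C t = M" "t \<cdot> Coker C y = f l"
      by (rule cokernel_factor [OF q, of "f l"]) (use l y in auto)
    have "f l \<cdot> ?r = t \<cdot> (Coker C y \<cdot> ?r)"
      using t y by (simp flip: assoc)
    then have "f l \<cdot> ?r = Zero C (Dom C ?r) M"
      using t y kernelD(4) [OF r] by simp
    then show ?thesis
      using sub_le_kernel_iff [OF kernel_Ker, of "f l" ?r] l y by simp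
  qed
  then have "sub_le C ?r n"
    using n kernel_monic [OF r] y by (auto simp: is_intersection_def subobject_def)
  then obtain u where u: "u \<in> Arr C" "Dom C u = Dom C ?r" "Cod C u = Dom C n" "?r = n \<cdot> u"
    by (auto simp: sub_le_def)
  obtain v where v: "v \<in> Arr C" "Dom C v = Dom C y" "Cod C v = Dom C ?r" "?r \<cdot> v = y"
    by (rule kernel_factor [OF r, of y]) (use y cokernelD(4) [OF q] in auto)
  have "n \<cdot> (u \<cdot> v) = ?r \<cdot> v"
    using u v y by (simp add: assoc)
  with u v show "\<exists>u\<in>Arr C. Dom C u = Dom C y \<and> Cod C u = Dom C n \<and> n \<cdot> u = y"
    by (intro bexI [of _ "u \<cdot> v"]) simp_all
qed

section \<open>Essential extensions and idempotents\<close>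

text \<open>A monomorphism \<open>x\<close> fixed by \<open>d \<cdot> p\<close> is the same as the
  subobject \<open>p \<cdot> x\<close> of \<open>D\<close>. So \<open>essential\<close> applies to
  it once its intersection with the part \<open>u\<close> of \<open>D\<close> given by the joint
  kernel is known to be zero.\<close>

lemma essential_CS_idempotent:
  assumes f: "\<And>l. l \<in> \<Lambda> \<Longrightarrow> f l \<in> hom_set C M M"
    and n: "is_intersection C M ((\<lambda>l. Ker C (f l)) ` \<Lambda>) n" "essential_in C n d"
    and d: "d \<in> hom_set C D M" and p: "p \<in> hom_set C M D" "p \<cdot> d = Ident C D"
  shows "CS_idempotent C M \<Lambda> f (d \<cdot> p)"
proof (rule CS_idempotentI)
  have [simp]: "d \<in> Arr C" "Dom C d = D" "Cod C d = M" "p \<in> Arr C" "Dom C p = M" "Cod C p = D"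
    "M \<in> Obj C" "D \<in> Obj C"
    using d p Dom_Obj [of d] Cod_Obj [of d] by simp_all
  have [simp]: "f l \<in> Arr C" "Dom C (f l) = M" "Cod C (f l) = M" if "l \<in> \<Lambda>" for l
    using f that by simp_all
  have pd [simp]: "p \<cdot> (d \<cdot> y) = y" if "y \<in> Arr C" "Cod C y = D" for y
    using that reassoc [OF p(2), of y] by simp
  have mono: "monic C d"
    by (rule split_monic [OF p(2)]) auto
  have "subobject C M n"
    using n by (simp add: is_intersection_def)
  note [simp] = subobject_arr(1,2) [OF this]
  obtain u where u: "u \<in> Arr C" "Dom C u = Dom C n" "Cod C u = D" and nu: "n = d \<cdot> u"
    and ess: "essential C D u"
    using n(2) by (auto simp: essential_in_def)
  show "d \<cdot> p \<in> Arr C" "Dom C (d \<cdot> p) = M" "Cod C (d \<cdot> p) = M" "d \<cdot> p \<cdot> (d \<cdot> p) = d \<cdot> p"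
    by (simp_all add: assoc)
  show "d \<cdot> p \<cdot> y = y"
    if y: "y \<in> Arr C" "Cod C y = M" "\<And>l. l \<in> \<Lambda> \<Longrightarrow> f l \<cdot> y = Zero C (Dom C y) M" for y
  proof -
    obtain v where v: "v \<in> Arr C" "Cod C v = Dom C n" "n \<cdot> v = y"
      using intersection_Ker(2) [OF n(1) f y] by auto
    have "d \<cdot> p \<cdot> (d \<cdot> u \<cdot> v) = d \<cdot> u \<cdot> v"
      using u v(1,2) by (simp add: assoc)
    then show ?thesis
      using v(3) nu by simp
  qed
  show "x = Zero C (Dom C x) M"
    if x: "monic C x" "Cod C x = M" "d \<cdot> p \<cdot> x = x"
      "\<And>y. y \<in> Arr C \<Longrightarrow> Cod C y = Dom C x \<Longrightarrow>
        (\<And>l. l \<in> \<Lambda> \<Longrightarrow> f l \<cdot> (x \<cdot> y) = Zero C (Dom C y) M) \<Longrightarrow> x \<cdot> y = Zero C (Dom C y) M" for x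
  proof -
    note [simp] = monicD(1) [OF x(1)] x(2)
    have dpx: "d \<cdot> (p \<cdot> x) = x"
      using x(3) by (simp add: assoc)
    have sub: "subobject C D (p \<cdot> x)"
      using monic_right_factor [of d "p \<cdot> x"] x(1) dpx by (simp add: subobject_def)
    obtain z where z: "zero_subobject C D z"
      using zero_subobject_exists [of D] by auto
    have zsub: "subobject C D z" "z = Zero C (Dom C z) D"
      using z by (simp_all add: zero_subobject_iff)
    have usub: "subobject C D u"
      using ess by (simp add: essential_def)
    \<comment> \<open>After \<open>d\<close>, a common lower bound \<open>w\<close> of
      \<open>u\<close> and \<open>p \<cdot> x\<close> factors both through \<open>n\<close> and
      through \<open>x\<close>. Through \<open>n\<close> it is killed by all \<open>f l\<close>, so
      the premise on \<open>x\<close> makes it zero.\<close>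
    have "is_intersection C D {u, p \<cdot> x} z"
      unfolding is_intersection_def
    proof (intro conjI allI impI ballI zsub)
      fix w
      assume "subobject C D w \<and> (\<forall>k\<in>{u, p \<cdot> x}. sub_le C w k)"
      then have w: "subobject C D w" "sub_le C w u" "sub_le C w (p \<cdot> x)"
        by auto
      note [simp] = subobject_arr(1,2) [OF w(1)]
      obtain a where a: "a \<in> Arr C" "Dom C a = Dom C w" "Cod C a = Dom C n" "w = u \<cdot> a"
        using w(2) u by (auto simp: sub_le_def)
      obtain b where b: "b \<in> Arr C" "Dom C b = Dom C w" "Cod C b = Dom C x" "w = p \<cdot> x \<cdot> b"
        using w(3) by (auto simp: sub_le_def)
      have dw1: "d \<cdot> w = n \<cdot> a"
        unfolding a(4) nu using a(1,3) u by (simp add: assoc)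
      have dw2: "d \<cdot> w = x \<cdot> b"
        unfolding b(4) using b(1,3) reassoc [OF dpx, of b] by (simp add: assoc)
      have "d \<cdot> w = Zero C (Dom C b) M"
        unfolding dw2
      proof (rule x(4))
        fix l assume l: "l \<in> \<Lambda>"
        then have "f l \<cdot> (n \<cdot> a) = Zero C (Dom C b) M"
          using reassoc [OF intersection_Ker(1) [OF n(1) f, of l], of a] a(1-3) b(2) by simp
        then show "f l \<cdot> (x \<cdot> b) = Zero C (Dom C b) M"
          using dw1 dw2 by simp
      qed (use b in auto)
      then have "w = Zero C (Dom C w) D"
        using monic_Comp_eq_Zero [OF mono, of w] b(2) by simp
      then show "sub_le C w z"
        by (rule zero_subobject_le [OF w(1) zsub(1)])
    next
      fix k
      assume "k \<in> {u, p \<cdot> x}"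
      then show "sub_le C z k"
        using zero_subobject_le [OF zsub(1) _ zsub(2)] usub sub by blast
    qed
    then have "zero_subobject C D (p \<cdot> x)"
      using ess sub z unfolding essential_def by blast
    then have "p \<cdot> x = Zero C (Dom C x) D"
      by (simp add: zero_subobject_iff)
    then show ?thesis
      using dpx Comp_Zero [of d D "Dom C x"] by simp
  qed
qed

lemma CS_idempotent_essential:
  assumes AB: "AB3_star U C" "\<Lambda> \<in> U"
    and f: "\<And>l. l \<in> \<Lambda> \<Longrightarrow> f l \<in> hom_set C M M"
    and d: "d \<in> hom_set C D M" and p: "p \<in> hom_set C M D" "p \<cdot> d = Ident C D"
    and e: "CS_idempotent C M \<Lambda> f (d \<cdot> p)"
  obtains n where "is_intersection C M ((\<lambda>l. Ker C (f l)) ` \<Lambda>) n" "essential_in C n d"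
proof -
  have [simp]: "d \<in> Arr C" "Dom C d = D" "Cod C d = M" "p \<in> Arr C" "Dom C p = M" "Cod C p = D"
    "M \<in> Obj C" "D \<in> Obj C"
    using d p Dom_Obj [of d] Cod_Obj [of d] by simp_all
  have [simp]: "f l \<in> Arr C" "Dom C (f l) = M" "Cod C (f l) = M" if "l \<in> \<Lambda>" for l
    using f that by simp_all
  have pd [simp]: "p \<cdot> (d \<cdot> y) = y" if "y \<in> Arr C" "Cod C y = D" for y
    using that reassoc [OF p(2), of y] by simp
  have mono: "monic C d"
    by (rule split_monic [OF p(2)]) auto
  obtain n where n: "monic C n" "n \<in> Arr C" "Cod C n = M"
    "\<And>l. l \<in> \<Lambda> \<Longrightarrow> f l \<cdot> n = Zero C (Dom C n) M"
    "\<And>y. y \<in> Arr C \<Longrightarrow> Cod C y = M \<Longrightarrow> (\<And>l. l \<in> \<Lambda> \<Longrightarrow> f l \<cdot> y = Zero C (Dom C y) M)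
      \<Longrightarrow> \<exists>h\<in>Arr C. Dom C h = Dom C y \<and> Cod C h = Dom C n \<and> n \<cdot> h = y"
    by (rule joint_kernel [OF AB, where X = M and Y = M and f = f]) (use f in auto)
  note [simp] = n(2,3)
  have int: "is_intersection C M ((\<lambda>l. Ker C (f l)) ` \<Lambda>) n"
    unfolding is_intersection_def
  proof (intro conjI ballI allI impI)
    show "subobject C M n"
      using n by (simp add: subobject_def)
    fix k
    assume "k \<in> (\<lambda>l. Ker C (f l)) ` \<Lambda>"
    then show "sub_le C n k"
      using n(4) sub_le_kernel_iff [OF kernel_Ker, of _ n] by auto
  next
    fix x
    assume x: "subobject C M x \<and> (\<forall>k\<in>(\<lambda>l. Ker C (f l)) ` \<Lambda>. sub_le C x k)"
    then have [simp]: "x \<in> Arr C" "Cod C x = M"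
      using subobject_arr by blast+
    have "f l \<cdot> x = Zero C (Dom C x) M" if "l \<in> \<Lambda>" for l
      using x that sub_le_kernel_iff [OF kernel_Ker, of "f l" x] by simp
    then obtain h where "h \<in> Arr C" "Dom C h = Dom C x" "Cod C h = Dom C n" "n \<cdot> h = x"
      using n(5) [of x] by auto
    then show "sub_le C x n"
      unfolding sub_le_def by (intro bexI [of _ h]) simp_all
  qed
  have "d \<cdot> p \<cdot> n = n"
    by (rule CS_idempotentD(5) [OF e]) (use n(4) in auto)
  then have dpn: "d \<cdot> (p \<cdot> n) = n"
    by (simp add: assoc)
  let ?u = "p \<cdot> n"
  have "essential C D ?u"
    unfolding essential_def
  proof (intro conjI allI impI)
    show "subobject C D ?u"
      using monic_right_factor [of d ?u] n(1) dpn by (simp add: subobject_def)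
    fix x
    assume "subobject C D x \<and> (\<exists>z. zero_subobject C D z \<and> is_intersection C D {?u, x} z)"
    then obtain z where x: "subobject C D x" and z: "zero_subobject C D z" "is_intersection C D {?u, x} z"
      by blast
    note x_arr [simp] = subobject_arr(1,2) [OF x]
    \<comment> \<open>\<open>k\<close> cuts out the part of \<open>x\<close> that \<open>d\<close>
      sends into the joint kernel. Then \<open>x \<cdot> k\<close> lies below both \<open>?u\<close>
      and \<open>x\<close>, hence below their zero intersection.\<close>
    have "f l \<cdot> (d \<cdot> x) \<in> hom_set C (Dom C x) M" if "l \<in> \<Lambda>" for l
      using that by simp
    then obtain k where k: "monic C k" "k \<in> Arr C" "Cod C k = Dom C x"
      "\<And>l. l \<in> \<Lambda> \<Longrightarrow> f l \<cdot> (d \<cdot> x) \<cdot> k = Zero C (Dom C k) M"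
      "\<And>y. y \<in> Arr C \<Longrightarrow> Cod C y = Dom C x \<Longrightarrow>
        (\<And>l. l \<in> \<Lambda> \<Longrightarrow> f l \<cdot> (d \<cdot> x) \<cdot> y = Zero C (Dom C y) M)
        \<Longrightarrow> \<exists>h\<in>Arr C. Dom C h = Dom C y \<and> Cod C h = Dom C k \<and> k \<cdot> h = y"
      by (rule joint_kernel [OF AB, rotated 2]) auto
    have "\<exists>a\<in>Arr C. Dom C a = Dom C (d \<cdot> (x \<cdot> k)) \<and> Cod C a = Dom C n \<and> n \<cdot> a = d \<cdot> (x \<cdot> k)"
      by (rule n(5)) (use k(2-4) in \<open>auto simp: assoc\<close>)
    then obtain a where a: "a \<in> Arr C" "Dom C a = Dom C k" "Cod C a = Dom C n" "n \<cdot> a = d \<cdot> (x \<cdot> k)"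
      using k by auto
    have ua: "x \<cdot> k = p \<cdot> n \<cdot> a"
      using a k by (simp add: assoc)
    have sub: "subobject C D (x \<cdot> k)"
      using k x monic_Comp [of k x] by (simp add: subobject_def)
    moreover have "sub_le C (x \<cdot> k) ?u"
      unfolding sub_le_def using a(1-3) k(2,3) ua by (intro bexI [of _ a]) simp_all
    moreover have "sub_le C (x \<cdot> k) x"
      unfolding sub_le_def using k(2,3) by (intro bexI [of _ k]) simp_all
    ultimately have "sub_le C (x \<cdot> k) z"
      using z(2) by (auto simp: is_intersection_def)
    then obtain b where b: "b \<in> Arr C" "Dom C b = Dom C k" "Cod C b = Dom C z" "x \<cdot> k = z \<cdot> b"
      using k by (auto simp: sub_le_def)
    have "z = Zero C (Dom C z) D"
      using z(1) by (simp add: zero_subobject_iff)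
    then have xk: "x \<cdot> k = Zero C (Dom C k) D"
      using b Zero_Comp [of b "Dom C z" D] by simp
    have "d \<cdot> x = Zero C (Dom C (d \<cdot> x)) M"
    proof (rule CS_idempotentD(6) [OF e])
      show "monic C (d \<cdot> x)"
        using mono x by (intro monic_Comp) (auto simp: subobject_def)
      fix y
      assume y: "y \<in> Arr C" "Cod C y = Dom C (d \<cdot> x)"
        "\<And>l. l \<in> \<Lambda> \<Longrightarrow> f l \<cdot> (d \<cdot> x \<cdot> y) = Zero C (Dom C y) M"
      have "\<exists>h\<in>Arr C. Dom C h = Dom C y \<and> Cod C h = Dom C k \<and> k \<cdot> h = y"
        by (rule k(5)) (use y in \<open>auto simp: assoc\<close>)
      then obtain h where h: "h \<in> Arr C" "Dom C h = Dom C y" "Cod C h = Dom C k" "k \<cdot> h = y"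
        by blast
      have "x \<cdot> y = Zero C (Dom C y) D"
        using reassoc [OF xk, of h] h k by simp
      then show "d \<cdot> x \<cdot> y = Zero C (Dom C y) M"
        using y by (simp add: assoc)
    qed (auto simp: assoc)
    then have "x = Zero C (Dom C x) D"
      using monic_Comp_eq_Zero [OF mono, of x] by simp
    then show "zero_subobject C D x"
      using x by (simp add: zero_subobject_iff)
  qed
  then have "essential_in C n d"
    using dpn by (auto simp: essential_in_def intro!: bexI [of _ ?u])
  with int show thesis
    using that by blast
qed

lemma CS_summand_iff:
  assumes AB: "AB3_star U C" "\<Lambda> \<in> U" and f: "\<forall>l\<in>\<Lambda>. f l \<in> hom_set C M M"
  shows "(\<exists>n d. is_intersection C M ((\<lambda>l. Ker C (f l)) ` \<Lambda>) n \<and> direct_summand C M d \<and> essential_in C n d)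
      \<longleftrightarrow> (\<exists>e. CS_idempotent C M \<Lambda> f e)" (is "?A \<longleftrightarrow> ?A'")
    and "(\<exists>n d. is_intersection C M ((\<lambda>l. Ker C (f l)) ` \<Lambda>) n \<and> direct_summand C M d \<and>
        fully_invariant C M d \<and> essential_in C n d)
      \<longleftrightarrow> (\<exists>e. CS_idempotent C M \<Lambda> f e \<and> (\<forall>h\<in>hom_set C M M. h \<cdot> e = e \<cdot> (h \<cdot> e)))" (is "?B \<longleftrightarrow> ?B'")
proof -
  \<comment> \<open>Full invariance is carried along as an implication, so that \<open>1\<close> and
    \<open>2\<close> yield both the plain and the strong equivalence.\<close>
  have 1: "\<exists>e. CS_idempotent C M \<Lambda> f e \<and>
      (fully_invariant C M d \<longrightarrow> (\<forall>h\<in>hom_set C M M. h \<cdot> e = e \<cdot> (h \<cdot> e)))"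
    if n: "is_intersection C M ((\<lambda>l. Ker C (f l)) ` \<Lambda>) n" and d: "direct_summand C M d"
      and nd: "essential_in C n d" for n d
  proof -
    obtain p where p: "d \<in> hom_set C (Dom C d) M" "p \<in> hom_set C M (Dom C d)" "p \<cdot> d = Ident C (Dom C d)"
      using direct_summandD [OF d] by (metis hom_set_iff)
    have "CS_idempotent C M \<Lambda> f (d \<cdot> p)"
      using f by (intro essential_CS_idempotent [OF _ n nd p]) auto
    then show ?thesis
      using fully_invariant_iff [OF p] by blast
  qed
  have 2: "\<exists>n d. is_intersection C M ((\<lambda>l. Ker C (f l)) ` \<Lambda>) n \<and> direct_summand C M d \<and>
      essential_in C n d \<and> ((\<forall>h\<in>hom_set C M M. h \<cdot> e = e \<cdot> (h \<cdot> e)) \<longrightarrow> fully_invariant C M d)"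
    if e: "CS_idempotent C M \<Lambda> f e" for e
  proof -
    have "e \<in> hom_set C M M" "e \<cdot> e = e"
      using CS_idempotentD(1-4) [OF e] by simp_all
    then obtain D d p where p: "d \<in> hom_set C D M" "p \<in> hom_set C M D" "p \<cdot> d = Ident C D" "d \<cdot> p = e"
      by (rule split_idempotent) blast
    have "direct_summand C M d"
      by (rule idempotent_direct_summand [OF p(1-3)])
    moreover obtain n where "is_intersection C M ((\<lambda>l. Ker C (f l)) ` \<Lambda>) n" "essential_in C n d"
      using CS_idempotent_essential [OF AB _ p(1-3)] f e p(4) by blast
    ultimately show ?thesis
      using fully_invariant_iff [OF p(1-3)] p(4) by blast
  qed
  show "?A \<longleftrightarrow> ?A'" "?B \<longleftrightarrow> ?B'"
    using 1 2 by blast+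
qed

lemma self_CS_Baer_iff:
  assumes "AB3_star U C" "M \<in> Obj C"
  shows "self_CS_Baer U C M \<longleftrightarrow> CS_Baer_idem U C M"
    and "strongly_self_CS_Baer U C M \<longleftrightarrow> strongly_CS_Baer_idem U C M"
  unfolding self_CS_Baer_def CS_Baer_idem_def strongly_self_CS_Baer_def strongly_CS_Baer_idem_def
  using assms(2) CS_summand_iff [OF assms(1)] by (simp_all cong: ball_cong imp_cong)

end

section \<open>The opposite category\<close>

definition op_cat :: "('o, 'm, 'z) ab_cat_scheme \<Rightarrow> ('o, 'm) ab_cat" where
  "op_cat C = \<lparr>Obj = Obj C, Arr = Arr C, Dom = Cod C, Cod = Dom C, Ident = Ident C,
     Comp = (\<lambda>f g. g \<cdot>\<^bsub>C\<^esub> f), Plus = Plus C, Zero = (\<lambda>A B. Zero C B A)\<rparr>"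

lemma op_cat_simps [simp]:
  "Obj (op_cat C) = Obj C" "Arr (op_cat C) = Arr C" "Dom (op_cat C) = Cod C" "Cod (op_cat C) = Dom C"
  "Ident (op_cat C) = Ident C" "f \<cdot>\<^bsub>op_cat C\<^esub> g = g \<cdot>\<^bsub>C\<^esub> f"
  "Plus (op_cat C) = Plus C" "Zero (op_cat C) A B = Zero C B A"
  by (simp_all add: op_cat_def)

lemma hom_set_op [simp]: "hom_set (op_cat C) A B = hom_set C B A"
  by (auto simp: hom_set_def)

lemma monic_op [simp]: "monic (op_cat C) f = epic C f"
  and epic_op [simp]: "epic (op_cat C) f = monic C f"
  by (simp_all add: monic_def epic_def)

lemma is_kernel_op [simp]: "is_kernel (op_cat C) f k = is_cokernel C f k"
  and is_cokernel_op [simp]: "is_cokernel (op_cat C) f k = is_kernel C f k"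
  by (simp_all add: is_kernel_def is_cokernel_def)

text \<open>The predicates under the choice operator coincide, so the chosen representatives are
  equal and not merely isomorphic.\<close>

lemma Coker_op [simp]: "Coker (op_cat C) f = Ker C f"
  by (simp add: Coker_def Ker_def)

lemma zero_object_op [simp]: "zero_object (op_cat C) Z = zero_object C Z"
  by (auto simp: zero_object_def)

lemma is_product_op [simp]: "is_product (op_cat C) \<Lambda> X P \<pi> = is_coproduct C \<Lambda> X P \<pi>"
  by (simp add: is_product_def is_coproduct_def)

lemma is_biproduct_op [simp]: "is_biproduct (op_cat C) A B S i j p q = is_biproduct C A B S p q i j"
  by (auto simp: is_biproduct_def)

lemma pairwise_hom_zero_op [simp]: "pairwise_hom_zero (op_cat C) I N = pairwise_hom_zero C I N"
  by (auto simp: pairwise_hom_zero_def)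

context abelian_category
begin

lemma abelian_op: "abelian_category (op_cat C)"
proof (intro abelian_category.intro preadditive_category.intro category.intro
    preadditive_category_axioms.intro abelian_category_axioms.intro)
  fix A B
  assume AB: "A \<in> Obj (op_cat C)" "B \<in> Obj (op_cat C)"
  then show "comm_group (hom_group (op_cat C) A B)"
    using hom_comm_group [of B A] by (simp add: hom_group_def)
  obtain S i j p q where "is_biproduct C A B S i j p q"
    using AB has_biproducts by (metis op_cat_simps(1))
  then show "\<exists>S i j p q. is_biproduct (op_cat C) A B S i j p q"
    unfolding is_biproduct_op by blast
qed (auto simp: Comp_Plus_distrib Plus_Comp_distrib assoc has_zero_object has_kernels has_cokernels
    monic_is_kernel epic_is_cokernel)

lemma AB3_op: "AB3 U C \<Longrightarrow> AB3_star U (op_cat C)"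
  using abelian_op by (simp add: AB3_def AB3_star_def)

section \<open>Dual forms of the basic lemmas\<close>

lemma cokernel_epic: "is_cokernel C f q \<Longrightarrow> epic C q"
  using abelian_category.kernel_monic [OF abelian_op, of f q] by simp

lemma epic_cokernel_Ker: "epic C q \<Longrightarrow> is_cokernel C (Ker C q) q"
  using abelian_category.monic_kernel_Coker [OF abelian_op, of q] by simp

lemma epic_Comp:
  assumes "epic C f" "epic C g" "Dom C g = Cod C f"
  shows "epic C (g \<cdot> f)"
proof -
  interpret op: abelian_category "op_cat C" by (rule abelian_op)
  show ?thesis
    using op.monic_Comp [of g f] assms by simp
qed

lemma epic_left_factor:
  assumes "epic C (g \<cdot> f)" "f \<in> Arr C" "g \<in> Arr C" "Dom C g = Cod C f"
  shows "epic C g"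
proof -
  interpret op: abelian_category "op_cat C" by (rule abelian_op)
  show ?thesis
    using op.monic_right_factor [of f g] assms by simp
qed

lemma split_epic:
  assumes "p \<cdot> d = Ident C D" "D \<in> Obj C" "d \<in> Arr C" "p \<in> Arr C" "Dom C p = Cod C d" "Dom C d = D"
  shows "epic C p"
proof -
  interpret op: abelian_category "op_cat C" by (rule abelian_op)
  have "Cod C p = D"
    using assms Comp_arr(3) [of d p] Ident_arr(3) [of D] by simp
  then show ?thesis
    using op.split_monic [of d p D] assms by simp
qed

lemma joint_cokernel:
  assumes "AB3 U C" "\<Lambda> \<in> U" "X \<in> Obj C" "Y \<in> Obj C"
    and f: "\<And>l. l \<in> \<Lambda> \<Longrightarrow> f l \<in> hom_set C X Y"
  obtains q where "epic C q" "q \<in> Arr C" "Dom C q = Y" "\<And>l. l \<in> \<Lambda> \<Longrightarrow> q \<cdot> f l = Zero C X (Cod C q)"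
    "\<And>y. y \<in> Arr C \<Longrightarrow> Dom C y = Y \<Longrightarrow> (\<And>l. l \<in> \<Lambda> \<Longrightarrow> y \<cdot> f l = Zero C X (Cod C y))
      \<Longrightarrow> \<exists>h\<in>Arr C. Dom C h = Cod C q \<and> Cod C h = Cod C y \<and> h \<cdot> q = y"
proof -
  interpret op: abelian_category "op_cat C" by (rule abelian_op)
  obtain q where "monic (op_cat C) q" "q \<in> Arr (op_cat C)" "Cod (op_cat C) q = Y"
    "\<And>l. l \<in> \<Lambda> \<Longrightarrow> f l \<cdot>\<^bsub>op_cat C\<^esub> q = Zero (op_cat C) (Dom (op_cat C) q) X"
    "\<And>y. y \<in> Arr (op_cat C) \<Longrightarrow> Cod (op_cat C) y = Y \<Longrightarrow>
      (\<And>l. l \<in> \<Lambda> \<Longrightarrow> f l \<cdot>\<^bsub>op_cat C\<^esub> y = Zero (op_cat C) (Dom (op_cat C) y) X)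
      \<Longrightarrow> \<exists>h\<in>Arr (op_cat C). Dom (op_cat C) h = Dom (op_cat C) y \<and>
        Cod (op_cat C) h = Dom (op_cat C) q \<and> q \<cdot>\<^bsub>op_cat C\<^esub> h = y"
    by (rule op.joint_kernel [OF AB3_op [OF assms(1)] assms(2), where X = Y and Y = X and f = f])
      (use assms in \<open>simp_all del: hom_set_iff\<close>)
  then show thesis
    using that [of q] unfolding op_cat_simps monic_op by (metis (no_types))
qed

text \<open>The universal property yields the projections and the cancellation of injections. For
  the projections to be jointly monic, arrows into M must be determined by their components; this
  holds because the identity is the sum of the \<open>\<iota> i \<cdot> \<pi> i\<close>, and the
  induction records for each partial sum \<open>s\<close> that \<open>s \<cdot> g\<close> depends
  only on the components of \<open>g\<close>.\<close>

lemma coproduct_biproduct_system: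
  assumes I: "finite I" and N: "\<forall>i\<in>I. N i \<in> Obj C" and M: "is_coproduct C I N M \<iota>"
  obtains \<pi> where "biproduct_system C I N M \<iota> \<pi>"
proof -
  have [simp]: "M \<in> Obj C"
    using M by (simp add: is_coproduct_def)
  have [simp]: "N i \<in> Obj C" "\<iota> i \<in> Arr C" "Dom C (\<iota> i) = N i" "Cod C (\<iota> i) = M" if "i \<in> I" for i
    using M N that by (simp_all add: is_coproduct_def)
  have univ: "\<exists>!h. h \<in> hom_set C M A \<and> (\<forall>i\<in>I. h \<cdot> \<iota> i = f i)"
    if "A \<in> Obj C" "\<And>i. i \<in> I \<Longrightarrow> f i \<in> hom_set C (N i) A" for A f
    using M that unfolding is_coproduct_def by blast
  have epi: "g = h" if "g \<in> hom_set C M A" "h \<in> hom_set C M A" "\<And>i. i \<in> I \<Longrightarrow> g \<cdot> \<iota> i = h \<cdot> \<iota> i" for g h A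
  proof -
    have "\<exists>!k. k \<in> hom_set C M A \<and> (\<forall>i\<in>I. k \<cdot> \<iota> i = h \<cdot> \<iota> i)"
      by (rule univ) (use that in auto)
    then show ?thesis
      using that by blast
  qed
  have "\<exists>p. p \<in> hom_set C M (N i) \<and> p \<cdot> \<iota> i = Ident C (N i) \<and>
      (\<forall>j\<in>I. i \<noteq> j \<longrightarrow> p \<cdot> \<iota> j = Zero C (N j) (N i))" if i: "i \<in> I" for i
    using univ [of "N i" "\<lambda>j. if j = i then Ident C (N i) else Zero C (N j) (N i)"] i
    by (auto simp del: hom_set_iff) (metis hom_set_iff Ident_arr Zero_arr \<open>\<And>i. i \<in> I \<Longrightarrow> N i \<in> Obj C\<close>)
  then obtain \<pi> where \<pi>: "\<And>i. i \<in> I \<Longrightarrow> \<pi> i \<in> hom_set C M (N i)"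
    "\<And>i. i \<in> I \<Longrightarrow> \<pi> i \<cdot> \<iota> i = Ident C (N i)"
    "\<And>i j. i \<in> I \<Longrightarrow> j \<in> I \<Longrightarrow> i \<noteq> j \<Longrightarrow> \<pi> i \<cdot> \<iota> j = Zero C (N j) (N i)"
    by metis
  have [simp]: "\<pi> i \<in> Arr C" "Dom C (\<pi> i) = M" "Cod C (\<pi> i) = N i" if "i \<in> I" for i
    using \<pi>(1) [OF that] by simp_all
  \<comment> \<open>For J = I, the arrow s is the sum of all \<iota> i \<cdot> \<pi> i, and it is the identity.\<close>
  have "\<exists>s\<in>hom_set C M M. (\<forall>i\<in>J. s \<cdot> \<iota> i = \<iota> i) \<and> (\<forall>i\<in>I-J. s \<cdot> \<iota> i = Zero C (N i) M) \<and>
      (\<forall>A. \<forall>g\<in>hom_set C A M. \<forall>h\<in>hom_set C A M. (\<forall>i\<in>I. \<pi> i \<cdot> g = \<pi> i \<cdot> h) \<longrightarrow> s \<cdot> g = s \<cdot> h)"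
    if "J \<subseteq> I" for J
    using finite_subset [OF that I] that
  proof (induction J)
    case empty
    show ?case
      by (rule bexI [of _ "Zero C M M"]) auto
  next
    case (insert j J)
    then obtain s where s: "s \<in> hom_set C M M" "\<And>i. i \<in> J \<Longrightarrow> s \<cdot> \<iota> i = \<iota> i"
      "\<And>i. i \<in> I \<Longrightarrow> i \<notin> J \<Longrightarrow> s \<cdot> \<iota> i = Zero C (N i) M"
      "\<And>A g h. g \<in> hom_set C A M \<Longrightarrow> h \<in> hom_set C A M \<Longrightarrow> (\<And>i. i \<in> I \<Longrightarrow> \<pi> i \<cdot> g = \<pi> i \<cdot> h)
        \<Longrightarrow> s \<cdot> g = s \<cdot> h"
      by (metis DiffI insert_subset)
    have [simp]: "s \<in> Arr C" "Dom C s = M" "Cod C s = M" "j \<in> I" "j \<notin> J"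
      using s insert by auto
    let ?s = "Plus C s (\<iota> j \<cdot> \<pi> j)"
    have "?s \<cdot> \<iota> i = Plus C (s \<cdot> \<iota> i) (\<iota> j \<cdot> (\<pi> j \<cdot> \<iota> i))" if "i \<in> I" for i
      using that by (simp add: Comp_Plus_distrib assoc)
    then have *: "?s \<cdot> \<iota> i = (if i = j then \<iota> i else s \<cdot> \<iota> i)" if "i \<in> I" for i
      using that s(3) [of j] \<pi>(2) [of j] \<pi>(3) [of j i] by simp
    have "?s \<cdot> g = ?s \<cdot> h"
      if gh: "g \<in> hom_set C A M" "h \<in> hom_set C A M" "\<And>i. i \<in> I \<Longrightarrow> \<pi> i \<cdot> g = \<pi> i \<cdot> h" for A g h
      using gh(1,2) s(4) [OF gh] gh(3) [of j] by (simp add: Comp_Plus_distrib assoc)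
    then have "\<forall>A. \<forall>g\<in>hom_set C A M. \<forall>h\<in>hom_set C A M. (\<forall>i\<in>I. \<pi> i \<cdot> g = \<pi> i \<cdot> h) \<longrightarrow> ?s \<cdot> g = ?s \<cdot> h"
      by blast
    moreover have "\<forall>i\<in>insert j J. ?s \<cdot> \<iota> i = \<iota> i" "\<forall>i\<in>I - insert j J. ?s \<cdot> \<iota> i = Zero C (N i) M"
      using * s(2,3) insert.prems by auto
    moreover have "?s \<in> hom_set C M M"
      by simp
    ultimately show ?case
      by blast
  qed
  from this [OF subset_refl] obtain s where s: "s \<in> hom_set C M M" "\<And>i. i \<in> I \<Longrightarrow> s \<cdot> \<iota> i = \<iota> i"
    "\<And>A g h. g \<in> hom_set C A M \<Longrightarrow> h \<in> hom_set C A M \<Longrightarrow> (\<And>i. i \<in> I \<Longrightarrow> \<pi> i \<cdot> g = \<pi> i \<cdot> h) \<Longrightarrow> s \<cdot> g = s \<cdot> h"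
    by blast
  have "s = Ident C M"
    by (rule epi) (use s(1,2) in auto)
  then have mono: "g = h"
    if "g \<in> hom_set C A M" "h \<in> hom_set C A M" "\<And>i. i \<in> I \<Longrightarrow> \<pi> i \<cdot> g = \<pi> i \<cdot> h" for A g h
    using s(3) [OF that] that(1,2) by simp
  have \<iota>: "\<iota> i \<in> hom_set C (N i) M" if "i \<in> I" for i
    using that by simp
  have "biproduct_system C I N M \<iota> \<pi>"
    by unfold_locales (use I \<pi>(2,3) epi mono in \<open>auto simp del: hom_set_iff intro: \<pi>(1) \<iota>\<close>)
  then show thesis
    by (rule that)
qed

end

lemma biproduct_system_op:
  assumes "biproduct_system C I N M \<iota> \<pi>"
  shows "biproduct_system (op_cat C) I N M \<pi> \<iota>"
proof -
  interpret biproduct_system C I N M \<iota> \<pi> by (rule assms)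
  interpret op: abelian_category "op_cat C" by (rule abelian_op)
  show ?thesis
    by unfold_locales
      (auto simp: finite_I proj_inj_Zero simp del: hom_set_iff
        intro: inj proj inj_jointly_epic proj_jointly_monic)
qed

section \<open>Dual self-CS-Baer objects\<close>

text \<open>In terms of C: whatever kills all \<open>f l\<close> kills the kernel of
  \<open>e\<close>, so this kernel lies in the sum of the images. An epimorphism \<open>x\<close>
  with \<open>x \<cdot> e = x\<close> is a quotient of M by a subobject containing the kernel of
  \<open>e\<close>; the last clause says that such a subobject is all of M as soon as it generates M
  together with the images.\<close>

lemma CS_idempotent_op:
  "CS_idempotent (op_cat C) M \<Lambda> f e \<longleftrightarrow> e \<in> hom_set C M M \<and> e \<cdot>\<^bsub>C\<^esub> e = e \<and>
     (\<forall>y\<in>Arr C. Dom C y = M \<longrightarrow> (\<forall>l\<in>\<Lambda>. y \<cdot>\<^bsub>C\<^esub> f l = Zero C M (Cod C y)) \<longrightarrow> y \<cdot>\<^bsub>C\<^esub> e = y) \<and>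
     (\<forall>x. epic C x \<longrightarrow> Dom C x = M \<longrightarrow> x \<cdot>\<^bsub>C\<^esub> e = x \<longrightarrow>
        (\<forall>y\<in>Arr C. Dom C y = Cod C x \<longrightarrow>
           (\<forall>l\<in>\<Lambda>. y \<cdot>\<^bsub>C\<^esub> x \<cdot>\<^bsub>C\<^esub> f l = Zero C M (Cod C y)) \<longrightarrow> y \<cdot>\<^bsub>C\<^esub> x = Zero C M (Cod C y)) \<longrightarrow>
        x = Zero C M (Cod C x))"
  unfolding CS_idempotent_def op_cat_simps hom_set_op monic_op ..

context abelian_category
begin

section \<open>Biproducts of two objects\<close>

text \<open>\<open>is_biproduct\<close> does not list the orthogonality relations. They follow from
  its sum equation: expanding \<open>d\<close> gives d = d + j q d, so j q d vanishes, and applying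
  \<open>q\<close> gives q d = 0; likewise for \<open>p \<cdot> j\<close>.\<close>

lemma biproduct_props:
  assumes b: "is_biproduct C D L M d j p q"
  shows "d \<in> Arr C" "Dom C d = D" "Cod C d = M" "j \<in> Arr C" "Dom C j = L" "Cod C j = M"
    "p \<in> Arr C" "Dom C p = M" "Cod C p = D" "q \<in> Arr C" "Dom C q = M" "Cod C q = L"
    "D \<in> Obj C" "L \<in> Obj C" "M \<in> Obj C"
    "p \<cdot> d = Ident C D" "q \<cdot> j = Ident C L" "q \<cdot> d = Zero C D L" "p \<cdot> j = Zero C L D"
    "y \<in> Arr C \<Longrightarrow> Dom C y = M \<Longrightarrow> y \<cdot> (j \<cdot> q) = y \<longleftrightarrow> y \<cdot> d = Zero C D (Cod C y)"
    "y \<in> Arr C \<Longrightarrow> Cod C y = M \<Longrightarrow> d \<cdot> (p \<cdot> y) = y \<longleftrightarrow> q \<cdot> y = Zero C (Dom C y) L"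
proof -
  show arr [simp]: "d \<in> Arr C" "Dom C d = D" "Cod C d = M" "j \<in> Arr C" "Dom C j = L" "Cod C j = M"
    "p \<in> Arr C" "Dom C p = M" "Cod C p = D" "q \<in> Arr C" "Dom C q = M" "Cod C q = L"
    and pd: "p \<cdot> d = Ident C D" and qj: "q \<cdot> j = Ident C L"
    using b by (simp_all add: is_biproduct_def)
  show obj [simp]: "D \<in> Obj C" "L \<in> Obj C" "M \<in> Obj C"
    using Dom_Obj [of d] Dom_Obj [of j] Cod_Obj [of d] by simp_all
  have sum: "Plus C (d \<cdot> p) (j \<cdot> q) = Ident C M"
    using b by (simp add: is_biproduct_def)
  have left: "Plus C (y \<cdot> (d \<cdot> p)) (y \<cdot> (j \<cdot> q)) = y" if "y \<in> Arr C" "Dom C y = M" for y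
    using that sum Plus_Comp_distrib [of "d \<cdot> p" "j \<cdot> q" y] by simp
  have right: "Plus C (d \<cdot> (p \<cdot> y)) (j \<cdot> (q \<cdot> y)) = y" if "y \<in> Arr C" "Cod C y = M" for y
    using that sum Comp_Plus_distrib [of y "d \<cdot> p" "j \<cdot> q"] by (simp add: assoc)
  have "Plus C d (j \<cdot> (q \<cdot> d)) = Plus C d (Zero C D M)"
    using right [of d] pd by simp
  then have "j \<cdot> (q \<cdot> d) = Zero C D M"
    by (rule Plus_left_cancel) auto
  then have "q \<cdot> (j \<cdot> (q \<cdot> d)) = Zero C D L"
    by simp
  then show qd: "q \<cdot> d = Zero C D L"
    using reassoc [OF qj, of "q \<cdot> d"] by simp
  have "Plus C j (d \<cdot> (p \<cdot> j)) = Plus C j (Zero C L M)"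
    using right [of j] qj Plus_commute [of j "d \<cdot> (p \<cdot> j)"] by simp
  then have "d \<cdot> (p \<cdot> j) = Zero C L M"
    by (rule Plus_left_cancel) auto
  then have "p \<cdot> (d \<cdot> (p \<cdot> j)) = Zero C L D"
    by simp
  then show "p \<cdot> j = Zero C L D"
    using reassoc [OF pd, of "p \<cdot> j"] by simp
  show "y \<cdot> (j \<cdot> q) = y \<longleftrightarrow> y \<cdot> d = Zero C D (Cod C y)" if y: "y \<in> Arr C" "Dom C y = M"
  proof
    assume "y \<cdot> (j \<cdot> q) = y"
    then have "y \<cdot> d = y \<cdot> (j \<cdot> q) \<cdot> d"
      by simp
    then show "y \<cdot> d = Zero C D (Cod C y)"
      using y by (simp add: assoc qd)
  next
    assume "y \<cdot> d = Zero C D (Cod C y)"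
    then have "y \<cdot> (d \<cdot> p) = Zero C M (Cod C y)"
      using y reassoc [of y d _ p] by simp
    then show "y \<cdot> (j \<cdot> q) = y"
      using left [OF y] y by simp
  qed
  show "d \<cdot> (p \<cdot> y) = y \<longleftrightarrow> q \<cdot> y = Zero C (Dom C y) L" if y: "y \<in> Arr C" "Cod C y = M"
  proof
    assume "d \<cdot> (p \<cdot> y) = y"
    then have "q \<cdot> y = q \<cdot> (d \<cdot> (p \<cdot> y))"
      by simp
    then show "q \<cdot> y = Zero C (Dom C y) L"
      using y reassoc [OF qd, of "p \<cdot> y"] by simp
  next
    assume "q \<cdot> y = Zero C (Dom C y) L"
    then show "d \<cdot> (p \<cdot> y) = y"
      using right [OF y] y by simp
  qed
qed

lemma biproduct_cokernel:
  assumes b: "is_biproduct C D L M d j p q"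
  shows "is_cokernel C d q"
proof -
  note [simp] = biproduct_props(1-15,18) [OF b]
  have epi: "epic C q"
    by (rule split_epic [OF biproduct_props(17) [OF b]]) auto
  show ?thesis
    unfolding is_cokernel_def
  proof (intro conjI ballI impI)
    fix B g
    assume g: "g \<in> hom_set C (Cod C d) B" "g \<cdot> d = Zero C (Dom C d) B"
    then have "g \<cdot> j \<cdot> q = g"
      using biproduct_props(20) [OF b, of g] by (simp add: assoc)
    moreover have "h = h'"
      if "h \<in> hom_set C (Cod C q) B" "h' \<in> hom_set C (Cod C q) B" "h \<cdot> q = h' \<cdot> q" for h h'
      by (rule epicD(2) [OF epi]) (use that in simp_all)
    moreover have "g \<cdot> j \<in> hom_set C (Cod C q) B"
      using g by simp
    ultimately show "\<exists>!h. h \<in> hom_set C (Cod C q) B \<and> h \<cdot> q = g"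
      by metis
  qed auto
qed

lemma biproduct_commute: "is_biproduct C D L M d j p q \<Longrightarrow> is_biproduct C L D M j d q p"
  using Plus_commute [of "d \<cdot> p" "j \<cdot> q"] by (simp add: is_biproduct_def)

text \<open>Both sides say that the block \<open>q \<cdot> (h \<cdot> d)\<close> of \<open>h\<close>
  from \<open>D\<close> to the complement is zero. The right side refers only to the idempotent of
  the complement, as needed in the opposite category.\<close>

lemma biproduct_fully_invariant_iff:
  assumes b: "is_biproduct C D L M d j p q"
  shows "fully_invariant C M d \<longleftrightarrow> (\<forall>h\<in>hom_set C M M. j \<cdot> q \<cdot> h = j \<cdot> q \<cdot> h \<cdot> (j \<cdot> q))"
proof -
  note [simp] = biproduct_props(1-15) [OF b]
  have sub: "subobject C M d"
    using split_monic [OF biproduct_props(16) [OF b]] by (simp add: subobject_def)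
  have mono: "monic C j"
    by (rule split_monic [OF biproduct_props(17) [OF b]]) auto
  have "(\<exists>\<alpha>\<in>hom_set C (Dom C d) (Dom C d). h \<cdot> d = d \<cdot> \<alpha>) \<longleftrightarrow> j \<cdot> q \<cdot> h = j \<cdot> q \<cdot> h \<cdot> (j \<cdot> q)"
    if h: "h \<in> hom_set C M M" for h
  proof -
    have [simp]: "h \<in> Arr C" "Dom C h = M" "Cod C h = M"
      using h by simp_all
    have "(\<exists>\<alpha>\<in>hom_set C (Dom C d) (Dom C d). h \<cdot> d = d \<cdot> \<alpha>) \<longleftrightarrow> q \<cdot> (h \<cdot> d) = Zero C D L"
    proof
      assume "\<exists>\<alpha>\<in>hom_set C (Dom C d) (Dom C d). h \<cdot> d = d \<cdot> \<alpha>"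
      then obtain \<alpha> where "\<alpha> \<in> Arr C" "Dom C \<alpha> = D" "Cod C \<alpha> = D" "h \<cdot> d = d \<cdot> \<alpha>"
        by auto
      then show "q \<cdot> (h \<cdot> d) = Zero C D L"
        using reassoc [OF biproduct_props(18) [OF b], of \<alpha>] by simp
    next
      assume "q \<cdot> (h \<cdot> d) = Zero C D L"
      then have "d \<cdot> (p \<cdot> (h \<cdot> d)) = h \<cdot> d"
        using biproduct_props(21) [OF b, of "h \<cdot> d"] by simp
      then show "\<exists>\<alpha>\<in>hom_set C (Dom C d) (Dom C d). h \<cdot> d = d \<cdot> \<alpha>"
        by (intro bexI [of _ "p \<cdot> (h \<cdot> d)"]) simp_all
    qed
    also have "\<dots> \<longleftrightarrow> j \<cdot> q \<cdot> h \<cdot> d = Zero C D M"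
      using monic_Comp_eq_Zero [OF mono, of "q \<cdot> (h \<cdot> d)"] by (auto simp: assoc)
    also have "\<dots> \<longleftrightarrow> j \<cdot> q \<cdot> h = j \<cdot> q \<cdot> h \<cdot> (j \<cdot> q)"
      using biproduct_props(20) [OF b, of "j \<cdot> q \<cdot> h"] by auto
    finally show ?thesis .
  qed
  then show ?thesis
    using sub by (simp add: fully_invariant_def del: hom_set_iff)
qed

section \<open>Images and their sums\<close>

lemma Img_kernel: "f \<in> Arr C \<Longrightarrow> is_kernel C (Coker C f) (Img C f)"
  unfolding Img_def by (intro kernel_Ker cokernelD(2) [OF cokernel_Coker])

lemma Img_arr [simp]:
  assumes "f \<in> Arr C"
  shows "Img C f \<in> Arr C" "Cod C (Img C f) = Cod C f"
  using kernelD(2,3) [OF Img_kernel [OF assms]] cokernelD(3) [OF cokernel_Coker [OF assms]] by simp_all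

text \<open>\<open>f\<close> factors through its image, which gives one direction. Conversely an
  arrow killing \<open>f\<close> factors through the cokernel of \<open>f\<close>, and that cokernel
  kills the image.\<close>

lemma Comp_Img_eq_Zero_iff:
  assumes f: "f \<in> Arr C" and y: "y \<in> Arr C" "Dom C y = Cod C f"
  shows "y \<cdot> Img C f = Zero C (Dom C (Img C f)) (Cod C y) \<longleftrightarrow> y \<cdot> f = Zero C (Dom C f) (Cod C y)"
proof
  note c = cokernelD [OF cokernel_Coker [OF f]]
  note k = kernelD [OF Img_kernel [OF f]]
  note [simp] = f y c(1-3) k(2,3)
  obtain u where u: "u \<in> Arr C" "Dom C u = Dom C f" "Cod C u = Dom C (Img C f)" "Img C f \<cdot> u = f"
    by (rule kernel_factor [OF Img_kernel [OF f], of f]) (use c(4) in simp_all)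
  assume y0: "y \<cdot> Img C f = Zero C (Dom C (Img C f)) (Cod C y)"
  have "y \<cdot> (Img C f \<cdot> u) = Zero C (Dom C f) (Cod C y)"
    using reassoc [OF y0, of u] u(1-3) by simp
  then show "y \<cdot> f = Zero C (Dom C f) (Cod C y)"
    by (simp add: u(4))
next
  note c = cokernelD [OF cokernel_Coker [OF f]]
  note k = kernelD [OF Img_kernel [OF f]]
  note [simp] = f y c(1-3) k(2,3)
  assume "y \<cdot> f = Zero C (Dom C f) (Cod C y)"
  then obtain t where t: "t \<in> Arr C" "Dom C t = Cod C (Coker C f)" "Cod C t = Cod C y" "t \<cdot> Coker C f = y"
    using cokernel_factor [OF cokernel_Coker [OF f] y] by blast
  have "y \<cdot> Img C f = t \<cdot> (Coker C f \<cdot> Img C f)"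
    using reassoc [OF t(4), of "Img C f"] t(1,2) by simp
  then show "y \<cdot> Img C f = Zero C (Dom C (Img C f)) (Cod C y)"
    using t k(4) by simp
qed

text \<open>Killing the sum means that the sum lies below \<open>Ker C y\<close>. For a supremum
  this can be tested on each image separately.\<close>

lemma Comp_sum_Img_eq_Zero_iff:
  assumes s: "is_sum C M ((\<lambda>l. Img C (f l)) ` \<Lambda>) s"
    and f: "\<And>l. l \<in> \<Lambda> \<Longrightarrow> f l \<in> hom_set C M M"
    and y: "y \<in> Arr C" "Dom C y = M"
  shows "y \<cdot> s = Zero C (Dom C s) (Cod C y) \<longleftrightarrow> (\<forall>l\<in>\<Lambda>. y \<cdot> f l = Zero C M (Cod C y))"
proof -
  have "subobject C M s"
    using s by (simp add: is_sum_def)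
  note [simp] = y subobject_arr(1,2) [OF this]
  have [simp]: "f l \<in> Arr C" "Dom C (f l) = M" "Cod C (f l) = M" if "l \<in> \<Lambda>" for l
    using f that by simp_all
  show ?thesis
  proof
    assume ys: "y \<cdot> s = Zero C (Dom C s) (Cod C y)"
    show "\<forall>l\<in>\<Lambda>. y \<cdot> f l = Zero C M (Cod C y)"
    proof
      fix l
      assume l: "l \<in> \<Lambda>"
      then have "sub_le C (Img C (f l)) s"
        using s by (auto simp: is_sum_def)
      then obtain u where u: "u \<in> hom_set C (Dom C (Img C (f l))) (Dom C s)" and us: "Img C (f l) = s \<cdot> u"
        unfolding sub_le_def by blast
      have "y \<cdot> Img C (f l) = Zero C (Dom C (Img C (f l))) (Cod C y)"
        unfolding us using reassoc [OF ys, of u] u by simp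
      then show "y \<cdot> f l = Zero C M (Cod C y)"
        using Comp_Img_eq_Zero_iff [of "f l" y] l by simp
    qed
  next
    assume yf: "\<forall>l\<in>\<Lambda>. y \<cdot> f l = Zero C M (Cod C y)"
    note k = kernel_Ker [OF y(1)]
    have "sub_le C (Img C (f l)) (Ker C y)" if "l \<in> \<Lambda>" for l
      using that yf sub_le_kernel_iff [OF k, of "Img C (f l)"] Comp_Img_eq_Zero_iff [of "f l" y] by simp
    moreover have "subobject C M (Ker C y)"
      using kernel_monic [OF k] kernelD(3) [OF k] by (simp add: subobject_def)
    ultimately have "sub_le C s (Ker C y)"
      using s by (auto simp: is_sum_def)
    then show "y \<cdot> s = Zero C (Dom C s) (Cod C y)"
      using sub_le_kernel_iff [OF k, of s] by simp
  qed
qed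

text \<open>The sum is the kernel of the joint cokernel \<open>q\<close> of the \<open>f l\<close>.
  It is the least upper bound: if \<open>x\<close> contains all images, the cokernel of
  \<open>x\<close> kills every \<open>f l\<close>, so it factors through \<open>q\<close> and kills
  the kernel of \<open>q\<close>.\<close>

lemma sum_Img_exists:
  assumes AB: "AB3 U C" "\<Lambda> \<in> U" and M: "M \<in> Obj C"
    and f: "\<And>l. l \<in> \<Lambda> \<Longrightarrow> f l \<in> hom_set C M M"
  obtains s where "is_sum C M ((\<lambda>l. Img C (f l)) ` \<Lambda>) s"
proof -
  have [simp]: "f l \<in> Arr C" "Dom C (f l) = M" "Cod C (f l) = M" if "l \<in> \<Lambda>" for l
    using f that by simp_all
  obtain q where q: "epic C q" "q \<in> Arr C" "Dom C q = M" "\<And>l. l \<in> \<Lambda> \<Longrightarrow> q \<cdot> f l = Zero C M (Cod C q)"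
    "\<And>y. y \<in> Arr C \<Longrightarrow> Dom C y = M \<Longrightarrow> (\<And>l. l \<in> \<Lambda> \<Longrightarrow> y \<cdot> f l = Zero C M (Cod C y))
      \<Longrightarrow> \<exists>h\<in>Arr C. Dom C h = Cod C q \<and> Cod C h = Cod C y \<and> h \<cdot> q = y"
    by (rule joint_cokernel [OF AB M M, where f = f]) (use f in blast)+
  note [simp] = q(2,3)
  note k = kernel_Ker [OF q(2)]
  note [simp] = kernelD(2,3) [OF k]
  have "is_sum C M ((\<lambda>l. Img C (f l)) ` \<Lambda>) (Ker C q)"
    unfolding is_sum_def
  proof (intro conjI ballI allI impI)
    show "subobject C M (Ker C q)"
      using kernel_monic [OF k] by (simp add: subobject_def)
    fix i
    assume "i \<in> (\<lambda>l. Img C (f l)) ` \<Lambda>"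
    then obtain l where l: "l \<in> \<Lambda>" "i = Img C (f l)"
      by blast
    then show "sub_le C i (Ker C q)"
      using q(4) sub_le_kernel_iff [OF k, of i] Comp_Img_eq_Zero_iff [of "f l" q] by simp
  next
    fix x
    assume x: "subobject C M x \<and> (\<forall>k\<in>(\<lambda>l. Img C (f l)) ` \<Lambda>. sub_le C k x)"
    then have "subobject C M x"
      by blast
    note x_arr = subobject_arr(1-3) [OF this]
    note xk = monic_kernel_Coker [OF x_arr(3)]
    note xc = cokernelD [OF cokernel_Coker [OF x_arr(1)]]
    note [simp] = x_arr(1,2) xc(1-3)
    have "Coker C x \<cdot> f l = Zero C M (Cod C (Coker C x))" if "l \<in> \<Lambda>" for l
      using that x sub_le_kernel_iff [OF xk, of "Img C (f l)"] Comp_Img_eq_Zero_iff [of "f l" "Coker C x"]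
      by simp
    then obtain h where h: "h \<in> Arr C" "Dom C h = Cod C q" "Cod C h = Cod C (Coker C x)" "h \<cdot> q = Coker C x"
      using q(5) [of "Coker C x"] by auto
    have "Coker C x \<cdot> Ker C q = h \<cdot> (q \<cdot> Ker C q)"
      using reassoc [OF h(4), of "Ker C q"] h(1,2) by simp
    then have "Coker C x \<cdot> Ker C q = Zero C (Dom C (Ker C q)) (Cod C (Coker C x))"
      using kernelD(4) [OF k] h by simp
    then show "sub_le C (Ker C q) x"
      using sub_le_kernel_iff [OF xk, of "Ker C q"] by simp
  qed
  then show thesis
    by (rule that)
qed

text \<open>An arrow killing both subobjects has a kernel that is an upper bound of them. Conversely
  an upper bound \<open>w\<close> is the kernel of its cokernel, and this cokernel kills
  both.\<close>

lemma is_sum_Ident_iff: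
  assumes v: "subobject C B v" and x: "subobject C B x"
  shows "is_sum C B {v, x} (Ident C B) \<longleftrightarrow>
    (\<forall>y\<in>Arr C. Dom C y = B \<longrightarrow> y \<cdot> v = Zero C (Dom C v) (Cod C y) \<longrightarrow>
      y \<cdot> x = Zero C (Dom C x) (Cod C y) \<longrightarrow> y = Zero C B (Cod C y))"
    (is "_ \<longleftrightarrow> ?R")
proof
  note [simp] = subobject_arr(1,2,4) [OF v] subobject_arr(1,2) [OF x]
  assume sum: "is_sum C B {v, x} (Ident C B)"
  show ?R
  proof (intro ballI impI)
    fix y
    assume y: "y \<in> Arr C" "Dom C y = B" "y \<cdot> v = Zero C (Dom C v) (Cod C y)" "y \<cdot> x = Zero C (Dom C x) (Cod C y)"
    note k = kernel_Ker [OF y(1)]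
    have "subobject C B (Ker C y)"
      using kernel_monic [OF k] kernelD(3) [OF k] y by (simp add: subobject_def)
    then have "sub_le C (Ident C B) (Ker C y)"
      using sum y sub_le_kernel_iff [OF k, of v] sub_le_kernel_iff [OF k, of x] by (simp add: is_sum_def)
    then show "y = Zero C B (Cod C y)"
      using sub_le_kernel_iff [OF k, of "Ident C B"] y by simp
  qed
next
  note [simp] = subobject_arr(1,2,4) [OF v] subobject_arr(1,2) [OF x]
  assume R: ?R
  have id: "subobject C B (Ident C B)"
    by (auto simp: subobject_def intro: monicI)
  show "is_sum C B {v, x} (Ident C B)"
    unfolding is_sum_def
  proof (intro conjI ballI allI impI id)
    fix k
    assume "k \<in> {v, x}"
    then have "k \<in> Arr C" "Cod C k = B"
      by auto
    then show "sub_le C k (Ident C B)"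
      unfolding sub_le_def by (intro bexI [of _ k]) simp_all
  next
    fix w
    assume w: "subobject C B w \<and> (\<forall>k\<in>{v, x}. sub_le C k w)"
    then have "subobject C B w"
      by blast
    note w_arr = subobject_arr(1-3) [OF this]
    note wk = monic_kernel_Coker [OF w_arr(3)]
    note wc = cokernelD [OF cokernel_Coker [OF w_arr(1)]]
    note [simp] = w_arr(1,2) wc(1-3)
    have "Coker C w = Zero C B (Cod C (Coker C w))"
      using R [rule_format, of "Coker C w"] w sub_le_kernel_iff [OF wk, of v] sub_le_kernel_iff [OF wk, of x]
      by simp
    then show "sub_le C (Ident C B) w"
      using sub_le_kernel_iff [OF wk, of "Ident C B"] by simp
  qed
qed

text \<open>The subobject \<open>x\<close> of the definition is replaced by its quotient map
  \<open>c\<close>, with \<open>x\<close> the kernel of \<open>c\<close> and \<open>c\<close> the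
  cokernel of \<open>x\<close>. The result has the shape of the last clause in
  \<open>CS_idempotent_op\<close>.\<close>

lemma superfluous_iff:
  assumes v: "subobject C B v"
  shows "superfluous C B v \<longleftrightarrow>
    (\<forall>c. epic C c \<longrightarrow> Dom C c = B \<longrightarrow>
      (\<forall>t\<in>Arr C. Dom C t = Cod C c \<longrightarrow> t \<cdot> (c \<cdot> v) = Zero C (Dom C v) (Cod C t) \<longrightarrow>
        t \<cdot> c = Zero C B (Cod C t)) \<longrightarrow>
      c = Zero C B (Cod C c))" (is "_ \<longleftrightarrow> ?R")
proof
  note [simp] = subobject_arr(1,2,4) [OF v]
  assume sup: "superfluous C B v"
  show ?R
  proof (intro allI impI)
    fix c
    assume c: "epic C c" "Dom C c = B"
      and t: "\<forall>t\<in>Arr C. Dom C t = Cod C c \<longrightarrow> t \<cdot> (c \<cdot> v) = Zero C (Dom C v) (Cod C t) \<longrightarrow>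
        t \<cdot> c = Zero C B (Cod C t)"
    note [simp] = epicD(1) [OF c(1)] c(2)
    have k: "is_kernel C c (Ker C c)"
      by (rule kernel_Ker) simp
    note [simp] = kernelD(2,3) [OF k]
    have x: "subobject C B (Ker C c)"
      using kernel_monic [OF k] by (simp add: subobject_def)
    have "is_sum C B {v, Ker C c} (Ident C B)"
      unfolding is_sum_Ident_iff [OF v x]
    proof (intro ballI impI)
      fix y
      assume y: "y \<in> Arr C" "Dom C y = B" "y \<cdot> v = Zero C (Dom C v) (Cod C y)"
        "y \<cdot> Ker C c = Zero C (Dom C (Ker C c)) (Cod C y)"
      obtain h where h: "h \<in> Arr C" "Dom C h = Cod C c" "Cod C h = Cod C y" "h \<cdot> c = y"
        by (rule cokernel_factor [OF epic_cokernel_Ker [OF c(1)], of y]) (use y in auto)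
      have "h \<cdot> (c \<cdot> v) = y \<cdot> v"
        using reassoc [OF h(4), of v] h(1,2) by simp
      then show "y = Zero C B (Cod C y)"
        using t [rule_format, of h] h y(3) by simp
    qed
    then have "sub_le C (Ident C B) (Ker C c)"
      using sup x by (auto simp: superfluous_def sub_eq_def)
    then show "c = Zero C B (Cod C c)"
      using sub_le_kernel_iff [OF k, of "Ident C B"] by simp
  qed
next
  note [simp] = subobject_arr(1,2,4) [OF v]
  assume R: ?R
  show "superfluous C B v"
    unfolding superfluous_def
  proof (intro conjI allI impI v)
    fix x
    assume "subobject C B x \<and> is_sum C B {v, x} (Ident C B)"
    then have x: "subobject C B x" and sum: "is_sum C B {v, x} (Ident C B)"
      by auto
    note x_arr [simp] = subobject_arr(1,2) [OF x]
    note xk = monic_kernel_Coker [OF subobject_arr(3) [OF x]]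
    have xc: "is_cokernel C x (Coker C x)"
      by (rule cokernel_Coker) simp
    note [simp] = cokernelD(1-3) [OF xc]
    have "Coker C x = Zero C B (Cod C (Coker C x))"
    proof (rule R [rule_format])
      show "epic C (Coker C x)"
        by (rule cokernel_epic [OF xc])
      fix t
      assume t: "t \<in> Arr C" "Dom C t = Cod C (Coker C x)"
        "t \<cdot> (Coker C x \<cdot> v) = Zero C (Dom C v) (Cod C t)"
      have "t \<cdot> Coker C x = Zero C B (Cod C (t \<cdot> Coker C x))"
        by (rule sum [unfolded is_sum_Ident_iff [OF v x], rule_format])
          (use t cokernelD(4) [OF xc] in \<open>simp_all add: assoc\<close>)
      then show "t \<cdot> Coker C x = Zero C B (Cod C t)"
        using t by simp
    qed simp
    then have "sub_le C (Ident C B) x"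
      using sub_le_kernel_iff [OF xk, of "Ident C B"] by simp
    moreover have "sub_le C x (Ident C B)"
      unfolding sub_le_def by (intro bexI [of _ x]) simp_all
    ultimately show "sub_eq C x (Ident C B)"
      by (simp add: sub_eq_def)
  qed
qed

section \<open>Lying above a direct summand\<close>

text \<open>An epimorphism \<open>x\<close> fixed by \<open>j \<cdot> q\<close> kills
  \<open>d\<close>, so it is \<open>c \<cdot> k\<close> for a quotient \<open>c\<close> of M modulo
  \<open>d\<close>. If \<open>t \<cdot> c\<close> kills \<open>v\<close>, then
  \<open>t \<cdot> x\<close> kills \<open>s\<close> because v r = k s; so the condition on
  \<open>x\<close> becomes the test of superfluity for \<open>c\<close>.\<close>

lemma lies_above_CS_idempotent:
  assumes f: "\<And>l. l \<in> \<Lambda> \<Longrightarrow> f l \<in> hom_set C M M"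
    and s: "is_sum C M ((\<lambda>l. Img C (f l)) ` \<Lambda>) s" and sd: "lies_above C M s d"
    and b: "is_biproduct C D L M d j p q"
  shows "CS_idempotent (op_cat C) M \<Lambda> f (j \<cdot> q)"
proof -
  note [simp] = biproduct_props(1-15) [OF b]
  have qj [simp]: "q \<cdot> (j \<cdot> y) = y" if "y \<in> Arr C" "Cod C y = L" for y
    using that reassoc [OF biproduct_props(17) [OF b], of y] by simp
  obtain u k r v where u: "u \<in> hom_set C D (Dom C s)" "d = s \<cdot> u"
    and k: "is_cokernel C d k" and r: "is_cokernel C u r"
    and v: "v \<in> hom_set C (Cod C r) (Cod C k)" "v \<cdot> r = k \<cdot> s" "superfluous C (Cod C k) v"
    using sd by (auto simp: lies_above_def simp del: hom_set_iff)
  have "subobject C M s"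
    using s by (simp add: is_sum_def)
  note s_arr [simp] = subobject_arr(1,2) [OF this]
  have [simp]: "u \<in> Arr C" "Dom C u = D" "Cod C u = Dom C s" "v \<in> Arr C" "Dom C v = Cod C r" "Cod C v = Cod C k"
    using u(1) v(1) by simp_all
  have k_arr [simp]: "k \<in> Arr C" "Dom C k = M" "k \<cdot> d = Zero C D (Cod C k)"
    using cokernelD [OF k] by simp_all
  have r_arr [simp]: "r \<in> Arr C" "Dom C r = Dom C s"
    using cokernelD [OF r] by simp_all
  have vsub: "subobject C (Cod C k) v"
    using v(3) by (simp add: superfluous_def)
  have sum: "y \<cdot> s = Zero C (Dom C s) (Cod C y) \<longleftrightarrow> (\<forall>l\<in>\<Lambda>. y \<cdot> f l = Zero C M (Cod C y))"
    if "y \<in> Arr C" "Dom C y = M" for y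
    using Comp_sum_Img_eq_Zero_iff [OF s f that] .
  show ?thesis
    unfolding CS_idempotent_op
  proof (intro conjI ballI allI impI)
    show "j \<cdot> q \<in> hom_set C M M" "j \<cdot> q \<cdot> (j \<cdot> q) = j \<cdot> q"
      by (simp_all add: assoc)
  next
    fix y
    assume y: "y \<in> Arr C" "Dom C y = M" "\<forall>l\<in>\<Lambda>. y \<cdot> f l = Zero C M (Cod C y)"
    have "y \<cdot> d = y \<cdot> s \<cdot> u"
      using y(1,2) u(2) by (simp add: assoc)
    then have "y \<cdot> d = Zero C D (Cod C y)"
      using sum [OF y(1,2)] y by simp
    then show "y \<cdot> (j \<cdot> q) = y"
      using biproduct_props(20) [OF b, of y] y by simp
  next
    fix x
    assume x: "epic C x" "Dom C x = M" "x \<cdot> (j \<cdot> q) = x"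
      and xf: "\<forall>y\<in>Arr C. Dom C y = Cod C x \<longrightarrow> (\<forall>l\<in>\<Lambda>. y \<cdot> x \<cdot> f l = Zero C M (Cod C y)) \<longrightarrow>
        y \<cdot> x = Zero C M (Cod C y)"
    note [simp] = epicD(1) [OF x(1)] x(2)
    have "x \<cdot> d = Zero C (Dom C d) (Cod C x)"
      using biproduct_props(20) [OF b, of x] x(3) by simp
    then obtain c where c: "c \<in> Arr C" "Dom C c = Cod C k" "Cod C c = Cod C x" "c \<cdot> k = x"
      using cokernel_factor [OF k, of x] by auto
    have "c = Zero C (Cod C k) (Cod C c)"
    proof (rule v(3) [unfolded superfluous_iff [OF vsub], rule_format])
      show "epic C c"
        using epic_left_factor [of c k] x(1) c by simp
      fix t
      assume t: "t \<in> Arr C" "Dom C t = Cod C c" "t \<cdot> (c \<cdot> v) = Zero C (Dom C v) (Cod C t)"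
      have "t \<cdot> x \<cdot> s = t \<cdot> (c \<cdot> (k \<cdot> s))"
        using reassoc [OF c(4), of s] t(1,2) c(1-3) by (simp add: assoc)
      also have "\<dots> = t \<cdot> (c \<cdot> (v \<cdot> r))"
        by (simp add: v(2))
      also have "\<dots> = t \<cdot> (c \<cdot> v) \<cdot> r"
        using t(1,2) c(1-3) by (simp add: assoc)
      also have "\<dots> = Zero C (Dom C s) (Cod C t)"
        using t by simp
      finally have "\<forall>l\<in>\<Lambda>. t \<cdot> x \<cdot> f l = Zero C M (Cod C t)"
        using sum [of "t \<cdot> x"] t(1,2) c(3) by simp
      then have "t \<cdot> x = Zero C M (Cod C t)"
        using xf t c(3) by simp
      then have "t \<cdot> c \<cdot> k = Zero C (Dom C k) (Cod C (t \<cdot> c))"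
        using t(1,2) c by (simp add: assoc)
      then show "t \<cdot> c = Zero C (Cod C k) (Cod C t)"
        using epic_Comp_eq_Zero [OF cokernel_epic [OF k], of "t \<cdot> c"] t(1,2) c(1-3) by simp
    qed (use c in auto)
    then show "x = Zero C M (Cod C x)"
      using c Zero_Comp [of k "Cod C k" "Cod C c"] by simp
  qed
qed

lemma CS_idempotent_lies_above:
  assumes f: "\<And>l. l \<in> \<Lambda> \<Longrightarrow> f l \<in> hom_set C M M"
    and s: "is_sum C M ((\<lambda>l. Img C (f l)) ` \<Lambda>) s"
    and b: "is_biproduct C D L M d j p q"
    and e: "CS_idempotent (op_cat C) M \<Lambda> f (j \<cdot> q)"
  shows "lies_above C M s d"
proof -
  note [simp] = biproduct_props(1-15) [OF b]
  note eD = e [unfolded CS_idempotent_op]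
  have qj [simp]: "q \<cdot> (j \<cdot> y) = y" if "y \<in> Arr C" "Cod C y = L" for y
    using that reassoc [OF biproduct_props(17) [OF b], of y] by simp
  have q: "epic C q"
    by (rule split_epic [OF biproduct_props(17) [OF b]]) auto
  have ssub: "subobject C M s"
    using s by (simp add: is_sum_def)
  note s_arr [simp] = subobject_arr(1,2) [OF ssub]
  have sum: "y \<cdot> s = Zero C (Dom C s) (Cod C y) \<longleftrightarrow> (\<forall>l\<in>\<Lambda>. y \<cdot> f l = Zero C M (Cod C y))"
    if "y \<in> Arr C" "Dom C y = M" for y
    using Comp_sum_Img_eq_Zero_iff [OF s f that] .
  have sk: "is_kernel C (Coker C s) s"
    by (rule monic_kernel_Coker [OF subobject_arr(3) [OF ssub]])
  have sc: "is_cokernel C s (Coker C s)"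
    by (rule cokernel_Coker) simp
  note [simp] = cokernelD(1-3) [OF sc]
  \<comment> \<open>The cokernel of \<open>s\<close> kills all \<open>f l\<close>, so it is fixed by
    \<open>j \<cdot> q\<close> and kills \<open>d\<close>. Hence \<open>d\<close> lies below
    \<open>s\<close>.\<close>
  have "Coker C s \<cdot> (j \<cdot> q) = Coker C s"
    using eD sum [of "Coker C s"] cokernelD(4) [OF sc] by simp
  then have "Coker C s \<cdot> d = Zero C D (Cod C (Coker C s))"
    using biproduct_props(20) [OF b, of "Coker C s"] by simp
  then obtain u where u: "u \<in> Arr C" "Dom C u = D" "Cod C u = Dom C s" "s \<cdot> u = d"
    using kernel_factor [OF sk, of d] by auto
  \<comment> \<open>Restricting \<open>p\<close> to \<open>s\<close> retracts \<open>u\<close>, so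
    \<open>D\<close> is a direct summand of the domain of \<open>s\<close> as well. Its complement
    \<open>K\<close> there serves as the quotient of \<open>s\<close> by \<open>d\<close>, just as
    \<open>L\<close> serves as the quotient of M by \<open>d\<close>.\<close>
  have psu: "p \<cdot> s \<cdot> u = Ident C D"
    using u biproduct_props(16) [OF b] by (simp add: assoc)
  obtain K a r where b': "is_biproduct C D K (Dom C s) u a (p \<cdot> s) r"
    by (rule idempotent_direct_summand [of u D "Dom C s" "p \<cdot> s"]) (use u(1-3) psu in auto)
  note [simp] = biproduct_props(1-15) [OF b']
  have r: "epic C r"
    by (rule split_epic [OF biproduct_props(17) [OF b']]) auto
  have ra [simp]: "r \<cdot> (a \<cdot> y) = y" if "y \<in> Arr C" "Cod C y = K" for y
    using that reassoc [OF biproduct_props(17) [OF b'], of y] by simp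
  \<comment> \<open>The arrow between the quotients induced by \<open>s\<close>, written on the
    complements \<open>K\<close> and \<open>L\<close>.\<close>
  let ?v = "q \<cdot> (s \<cdot> a)"
  have "q \<cdot> s \<cdot> u = Zero C D L"
    using u biproduct_props(18) [OF b] by (simp add: assoc)
  then have "q \<cdot> s \<cdot> (a \<cdot> r) = q \<cdot> s"
    using biproduct_props(20) [OF b', of "q \<cdot> s"] by simp
  then have vr: "?v \<cdot> r = q \<cdot> s"
    by (simp add: assoc)
  \<comment> \<open>What \<open>?v\<close> kills is sent by \<open>s \<cdot> a\<close> into the
    kernel of \<open>q\<close>, the image of \<open>d\<close>. Its component under \<open>p\<close>
    is zero too, as \<open>a\<close> is complementary to \<open>u\<close>, so it vanishes.\<close>
  have "monic C ?v"
  proof (rule monicI)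
    fix A z
    assume z: "z \<in> Arr C" "Dom C z = A" "Cod C z = Dom C ?v" "?v \<cdot> z = Zero C A (Cod C ?v)"
    let ?y = "s \<cdot> (a \<cdot> z)"
    have "q \<cdot> ?y = Zero C (Dom C ?y) L"
      using z by (simp add: assoc)
    then have "d \<cdot> (p \<cdot> ?y) = ?y"
      using biproduct_props(21) [OF b, of ?y] z by simp
    moreover have "p \<cdot> ?y = Zero C A D"
      using reassoc [OF biproduct_props(19) [OF b'], of z] z by (simp add: assoc)
    ultimately have "s \<cdot> (a \<cdot> z) = Zero C (Dom C (a \<cdot> z)) (Cod C s)"
      using z Dom_Obj [of z] by simp
    then have "a \<cdot> z = Zero C A (Dom C s)"
      using monic_Comp_eq_Zero [OF subobject_arr(3) [OF ssub], of "a \<cdot> z"] z by simp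
    then have "r \<cdot> (a \<cdot> z) = Zero C A K"
      using z Dom_Obj [of z] by simp
    then show "z = Zero C A (Dom C ?v)"
      using z by simp
  qed simp
  then have vsub: "subobject C L ?v"
    by (simp add: subobject_def)
  have "superfluous C L ?v"
    unfolding superfluous_iff [OF vsub]
  proof (intro allI impI)
    fix c
    assume c: "epic C c" "Dom C c = L"
      and t: "\<forall>t\<in>Arr C. Dom C t = Cod C c \<longrightarrow> t \<cdot> (c \<cdot> ?v) = Zero C (Dom C ?v) (Cod C t) \<longrightarrow>
        t \<cdot> c = Zero C L (Cod C t)"
    note [simp] = epicD(1) [OF c(1)] c(2)
    \<comment> \<open>A quotient \<open>c\<close> of \<open>L\<close> is turned into the quotient
      \<open>c \<cdot> q\<close> of M, which \<open>j \<cdot> q\<close> fixes, and the last clause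
      in \<open>CS_idempotent_op\<close> is applied to it. As \<open>r\<close> is epic, killing
      \<open>s\<close> through \<open>c \<cdot> q\<close> amounts to killing \<open>?v\<close>
      through \<open>c\<close>.\<close>
    have "c \<cdot> q = Zero C M (Cod C (c \<cdot> q))"
    proof (rule eD [THEN conjunct2, THEN conjunct2, THEN conjunct2, rule_format])
      show "epic C (c \<cdot> q)"
        using q c by (intro epic_Comp) simp_all
      fix y
      assume y: "y \<in> Arr C" "Dom C y = Cod C (c \<cdot> q)"
        and yf: "\<And>l. l \<in> \<Lambda> \<Longrightarrow> y \<cdot> (c \<cdot> q) \<cdot> f l = Zero C M (Cod C y)"
      have "y \<cdot> (c \<cdot> q) \<cdot> s = Zero C (Dom C s) (Cod C y)"
        using sum [of "y \<cdot> (c \<cdot> q)"] yf y by simp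
      then have "y \<cdot> (c \<cdot> (?v \<cdot> r)) = Zero C (Dom C s) (Cod C y)"
        using y by (simp add: vr) (simp add: assoc)
      then have "y \<cdot> (c \<cdot> ?v) \<cdot> r = Zero C (Dom C r) (Cod C (y \<cdot> (c \<cdot> ?v)))"
        using y by (simp add: assoc)
      then have "y \<cdot> (c \<cdot> ?v) = Zero C K (Cod C y)"
        using epic_Comp_eq_Zero [OF r, of "y \<cdot> (c \<cdot> ?v)"] y by simp
      then have "y \<cdot> c = Zero C L (Cod C y)"
        using t y by simp
      then show "y \<cdot> (c \<cdot> q) = Zero C M (Cod C y)"
        using reassoc [of y c _ q] y by (simp flip: assoc)
    qed (simp_all add: assoc)
    then show "c = Zero C L (Cod C c)"
      using epic_Comp_eq_Zero [OF q, of c] by simp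
  qed
  moreover have "subobject C M d"
    using split_monic [OF biproduct_props(16) [OF b]] by (simp add: subobject_def)
  ultimately show ?thesis
    unfolding lies_above_def using ssub u vr biproduct_cokernel [OF b] biproduct_cokernel [OF b']
    by (intro conjI bexI [of _ u] exI [of _ q] exI [of _ r] bexI [of _ ?v]) simp_all
qed

lemma dual_CS_summand_iff:
  assumes AB: "AB3 U C" "\<Lambda> \<in> U" and M: "M \<in> Obj C" and f: "\<forall>l\<in>\<Lambda>. f l \<in> hom_set C M M"
  shows "(\<exists>s d. is_sum C M ((\<lambda>l. Img C (f l)) ` \<Lambda>) s \<and> direct_summand C M d \<and> lies_above C M s d)
      \<longleftrightarrow> (\<exists>e. CS_idempotent (op_cat C) M \<Lambda> f e)" (is "?A \<longleftrightarrow> ?A'")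
    and "(\<exists>s d. is_sum C M ((\<lambda>l. Img C (f l)) ` \<Lambda>) s \<and> direct_summand C M d \<and>
        fully_invariant C M d \<and> lies_above C M s d)
      \<longleftrightarrow> (\<exists>e. CS_idempotent (op_cat C) M \<Lambda> f e \<and> (\<forall>h\<in>hom_set C M M. e \<cdot> h = e \<cdot> h \<cdot> e))" (is "?B \<longleftrightarrow> ?B'")
proof -
  have f': "\<And>l. l \<in> \<Lambda> \<Longrightarrow> f l \<in> hom_set C M M"
    using f by blast
  have 1: "\<exists>e. CS_idempotent (op_cat C) M \<Lambda> f e \<and>
      (fully_invariant C M d \<longrightarrow> (\<forall>h\<in>hom_set C M M. e \<cdot> h = e \<cdot> h \<cdot> e))"
    if s: "is_sum C M ((\<lambda>l. Img C (f l)) ` \<Lambda>) s" and d: "direct_summand C M d"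
      and sd: "lies_above C M s d" for s d
  proof -
    obtain L j p q where b: "is_biproduct C (Dom C d) L M d j p q"
      using d by (auto simp: direct_summand_def)
    then show ?thesis
      using lies_above_CS_idempotent [OF f' s sd b] biproduct_fully_invariant_iff [OF b] by blast
  qed
  have 2: "\<exists>s d. is_sum C M ((\<lambda>l. Img C (f l)) ` \<Lambda>) s \<and> direct_summand C M d \<and>
      lies_above C M s d \<and> ((\<forall>h\<in>hom_set C M M. e \<cdot> h = e \<cdot> h \<cdot> e) \<longrightarrow> fully_invariant C M d)"
    if e: "CS_idempotent (op_cat C) M \<Lambda> f e" for e
  proof -
    have "e \<in> hom_set C M M" "e \<cdot> e = e"
      using e by (simp_all add: CS_idempotent_op)
    then obtain L j q where j: "j \<in> hom_set C L M" "q \<in> hom_set C M L" "q \<cdot> j = Ident C L" "j \<cdot> q = e"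
      by (rule split_idempotent) blast
    \<comment> \<open>\<open>e\<close> projects onto \<open>L\<close>, whereas the summand below the
      sum of the images is the complement \<open>d\<close> of \<open>L\<close>; so the two halves of
      the biproduct are exchanged.\<close>
    obtain D d p where "is_biproduct C L D M j d q p"
      by (rule idempotent_direct_summand [OF j(1-3)])
    then have b: "is_biproduct C D L M d j p q"
      by (rule biproduct_commute)
    have "direct_summand C M d"
      by (rule idempotent_direct_summand [of d D M p]) (use b in \<open>auto simp: is_biproduct_def\<close>)
    moreover obtain s where s: "is_sum C M ((\<lambda>l. Img C (f l)) ` \<Lambda>) s"
      by (rule sum_Img_exists [OF AB M f'])
    moreover have "lies_above C M s d"
      by (rule CS_idempotent_lies_above [OF f' s b]) (use e j(4) in auto)
    ultimately show ?thesis
      using biproduct_fully_invariant_iff [OF b] j(4) by blast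
  qed
  show "?A \<longleftrightarrow> ?A'" "?B \<longleftrightarrow> ?B'"
    using 1 2 by blast+
qed

lemma dual_self_CS_Baer_iff:
  assumes "AB3 U C" "M \<in> Obj C"
  shows "dual_self_CS_Baer U C M \<longleftrightarrow> CS_Baer_idem U (op_cat C) M"
    and "dual_strongly_self_CS_Baer U C M \<longleftrightarrow> strongly_CS_Baer_idem U (op_cat C) M"
  unfolding dual_self_CS_Baer_def CS_Baer_idem_def dual_strongly_self_CS_Baer_def
    strongly_CS_Baer_idem_def hom_set_op op_cat_simps
  using assms(2) dual_CS_summand_iff [OF assms(1) _ assms(2)] by (simp_all cong: ball_cong imp_cong)

end

theorem theorem8p8:
  fixes C :: "('o, 'm) ab_cat"
    and U :: "'l set set"
    and I :: "'i set"
    and N :: "'i \<Rightarrow> 'o"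
    and M :: 'o
    and \<iota> :: "'i \<Rightarrow> 'm"
  assumes "abelian_category C"
    and "index_universe U"
    and "finite I"
    and "\<forall>i\<in>I. N i \<in> Obj C"
    and "is_coproduct C I N M \<iota>"
  shows
    "(AB3_star U C \<longrightarrow>
        (pairwise_hom_zero C I N \<longrightarrow>
           (self_CS_Baer U C M \<longleftrightarrow> (\<forall>i\<in>I. self_CS_Baer U C (N i)))) \<and>
        (strongly_self_CS_Baer U C M \<longleftrightarrow>
           (\<forall>i\<in>I. strongly_self_CS_Baer U C (N i)) \<and> pairwise_hom_zero C I N)) \<and>
     (AB3 U C \<longrightarrow>
        (pairwise_hom_zero C I N \<longrightarrow>
           (dual_self_CS_Baer U C M \<longleftrightarrow> (\<forall>i\<in>I. dual_self_CS_Baer U C (N i)))) \<and>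
        (dual_strongly_self_CS_Baer U C M \<longleftrightarrow>
           (\<forall>i\<in>I. dual_strongly_self_CS_Baer U C (N i)) \<and> pairwise_hom_zero C I N))"
proof -
  interpret abelian_category C by (rule assms(1))
  obtain \<pi> where \<pi>: "biproduct_system C I N M \<iota> \<pi>"
    using coproduct_biproduct_system assms(3-5) by blast
  \<comment> \<open>The same summands decompose M in the opposite category, with the projections as
    injections. The vanishing of arrows between distinct summands is symmetric in i and j and
    carries over unchanged.\<close>
  then have op: "biproduct_system (op_cat C) I N M \<pi> \<iota>"
    by (rule biproduct_system_op)
  have M: "M \<in> Obj C"
    using assms(5) by (simp add: is_coproduct_def)
  have direct: "(pairwise_hom_zero C I N \<longrightarrow>
        (self_CS_Baer U C M \<longleftrightarrow> (\<forall>i\<in>I. self_CS_Baer U C (N i)))) \<and>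
      (strongly_self_CS_Baer U C M \<longleftrightarrow>
        (\<forall>i\<in>I. strongly_self_CS_Baer U C (N i)) \<and> pairwise_hom_zero C I N)" if AB: "AB3_star U C"
    using biproduct_system.CS_Baer_idem_direct_sum [OF \<pi> _ AB]
      biproduct_system.strongly_CS_Baer_idem_direct_sum [OF \<pi> assms(2) AB]
      self_CS_Baer_iff [OF AB] M assms(4) by simp
  moreover have "(pairwise_hom_zero C I N \<longrightarrow>
        (dual_self_CS_Baer U C M \<longleftrightarrow> (\<forall>i\<in>I. dual_self_CS_Baer U C (N i)))) \<and>
      (dual_strongly_self_CS_Baer U C M \<longleftrightarrow>
        (\<forall>i\<in>I. dual_strongly_self_CS_Baer U C (N i)) \<and> pairwise_hom_zero C I N)" if AB: "AB3 U C"
    using biproduct_system.CS_Baer_idem_direct_sum [OF op _ AB3_op [OF AB]]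
      biproduct_system.strongly_CS_Baer_idem_direct_sum [OF op assms(2) AB3_op [OF AB]]
      dual_self_CS_Baer_iff [OF AB] M assms(4) by simp
  ultimately show ?thesis
    by blast
qed

end
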